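(* Assume (A1)–(A3) of the context hold, and let $(\bar u(\cdot),\bar X(\cdot))$ be an optimal pair for minimizing $$J(u(\cdot))=\int_0^T f(X^u(t),u(t))\,dt+\Psi(X^u(T))$$ over $u(\cdot)\in\mathcal{U}[0,T]$ subject to $0\le X^u(t_i)$, $i=0,1,\dots,n$, where $0=t_0<t_1<\cdots<t_n=T$ is a given partition. Then there exist $(\beta^0,\beta^1,\dots,\beta^n)\in\mathbb{R}^{n+1}$ satisfying $$\beta^0\ge 0,\qquad |\beta^0|^2+\sum_{j=1}^n|\beta^j|^2=1,$$ $$\beta^j(\gamma-\bar X(t_j))\ge 0\quad\text{for all }\gamma\le 0,\ j=1,2,\dots,n,$$ and a solution $p(\cdot)$ of the series of first-order adjoint equations $$-dp(t)=\{b_x(\bar X(t),\bar u(t))p(t)-\beta^0 f_x(\bar X(t),\bar u(t))\}\,dt,\quad t\in(t_{i-1},t_i),$$ $$p(t_i)=-\beta^0\Psi_x(\bar X(t_n))1_{i=n}(i)-\beta^i+p(t_i^+),\quad i=1,2,\dots,n,$$ such that, for any $u\in U$ and almost every $t\in(t_i,t_{i+1})$, $i=0,1,\dots,n-1$, $$H(\beta^0,\bar X(t),\bar u(t),p(t))\ge H(\beta^0,\bar X(t),u,p(t)),$$ where $H(\beta^0,x,u,p)=b(x,u)p-\beta^0 f(x,u)$ for $(\beta^0,x,u,p)\in\mathbb{R}\times\mathbb{R}\times U\times\mathbb{R}$.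
   Context: Let $T>0$, $x_0\in\mathbb{R}$, and let $U\subset\mathbb{R}$ be connected. Let $b:\mathbb{R}\times U\to\mathbb{R}$, $f:\mathbb{R}\times U\to\mathbb{R}$, $\Psi:\mathbb{R}\to\mathbb{R}$ be uniformly continuous. Write $\mathcal{U}[0,T]=L^2(0,T;U)$. For $u(\cdot)\in\mathcal{U}[0,T]$, $X^u$ denotes the solution of $\dot X^u(s)=b(X^u(s),u(s))$, $s\in(0,T]$, $X^u(0)=x_0$. An optimal pair is a pair (minimizing control, corresponding state trajectory). Here $p(t_i^+)$ is the right limit of $p$ at $t_i$, with $p(t_n^+)=0$; on each interval $(t_{i-1},t_i)$, $p$ solves the linear equation with terminal value $p(t_i)$ at $t_i$. $1_{i=n}(i)$ equals $1$ if $i=n$ and $0$ otherwise. Subscripts $x$ denote derivatives in $x$. Assumptions: (A1) There is $c>0$ with $|b(x_1,u)-b(x_2,u)|\le c|x_1-x_2|$ for all $(x_1,u),(x_2,u)\in\mathbb{R}\times U$. (A2) There is $c>0$ with $\sup_{u\in\mathcal{U}[0,T]}\int_0^T|b(0,u(t))|^2dt\le c$. (A3) $b,f,\Psi$ are differentiable in $x$, and their derivatives in $x$ are continuous with respect to $(x,u)$.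
   Formalization: Added hypothesis: for some δ>0 and integrable k on (0,T), |f_x(x,ū(t))| ≤ k(t) for a.e. t and all |x−X̄(t)| ≤ δ. Without it f_x(X̄,ū) need not be integrable, the adjoint equation may have no solution, and the claim as stated fails. *)

theory Defs
  imports "HOL-Analysis.Analysis"
begin

text \<open>
  Elements of \<open>L\<^sup>2(0,T;U)\<close> are represented by functions that are Lebesgue measurable on
  \<open>[0,T]\<close>, hence the constraint \<open>u(t) \<in> U\<close> is imposed only almost everywhere.
\<close>

definition controls :: "real \<Rightarrow> real set \<Rightarrow> (real \<Rightarrow> real) set" where
  "controls T U = {u. u \<in> borel_measurable (lebesgue_on {0..T}) \<and>
     (AE t in lebesgue_on {0..T}. u t \<in> U) \<and>
     integrable (lebesgue_on {0..T}) (\<lambda>t. (u t)\<^sup>2)}"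

text \<open>
  The state equation is understood in the Caratheodory sense, that is, in integrated form.
  Under the Lipschitz assumption below the trajectory of a control is unique on \<open>[0,T]\<close>.
\<close>

definition trajectory ::
    "real \<Rightarrow> real \<Rightarrow> (real \<Rightarrow> real \<Rightarrow> real) \<Rightarrow> (real \<Rightarrow> real) \<Rightarrow> (real \<Rightarrow> real) \<Rightarrow> bool" where
  "trajectory T x0 b u X \<longleftrightarrow>
     integrable (lebesgue_on {0..T}) (\<lambda>s. b (X s) (u s)) \<and>
     (\<forall>t\<in>{0..T}. X t = x0 + (\<integral>s. b (X s) (u s) \<partial>lebesgue_on {0..t}))"

definition cost ::
    "real \<Rightarrow> (real \<Rightarrow> real \<Rightarrow> real) \<Rightarrow> (real \<Rightarrow> real) \<Rightarrow> (real \<Rightarrow> real) \<Rightarrow> (real \<Rightarrow> real) \<Rightarrow> real" where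
  "cost T f \<Psi> u X = (\<integral>t. f (X t) (u t) \<partial>lebesgue_on {0..T}) + \<Psi> (X T)"

definition feasible_pair ::
    "real \<Rightarrow> real \<Rightarrow> real set \<Rightarrow> (real \<Rightarrow> real \<Rightarrow> real) \<Rightarrow> nat \<Rightarrow> (nat \<Rightarrow> real)
       \<Rightarrow> (real \<Rightarrow> real) \<Rightarrow> (real \<Rightarrow> real) \<Rightarrow> bool" where
  "feasible_pair T x0 U b n \<tau> u X \<longleftrightarrow>
     u \<in> controls T U \<and> trajectory T x0 b u X \<and> (\<forall>i\<le>n. 0 \<le> X (\<tau> i))"

definition optimal_pair ::
    "real \<Rightarrow> real \<Rightarrow> real set \<Rightarrow> (real \<Rightarrow> real \<Rightarrow> real) \<Rightarrow> (real \<Rightarrow> real \<Rightarrow> real) \<Rightarrow> (real \<Rightarrow> real)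
       \<Rightarrow> nat \<Rightarrow> (nat \<Rightarrow> real) \<Rightarrow> (real \<Rightarrow> real) \<Rightarrow> (real \<Rightarrow> real) \<Rightarrow> bool" where
  "optimal_pair T x0 U b f \<Psi> n \<tau> u X \<longleftrightarrow>
     feasible_pair T x0 U b n \<tau> u X \<and>
     (\<forall>v Y. feasible_pair T x0 U b n \<tau> v Y \<longrightarrow> cost T f \<Psi> u X \<le> cost T f \<Psi> v Y)"

definition partial_x :: "(real \<Rightarrow> real \<Rightarrow> real) \<Rightarrow> real \<Rightarrow> real \<Rightarrow> real" where
  "partial_x g x u = deriv (\<lambda>y. g y u) x"

definition C1_in_x :: "real set \<Rightarrow> (real \<Rightarrow> real \<Rightarrow> real) \<Rightarrow> bool" where
  "C1_in_x U g \<longleftrightarrow>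
     (\<forall>x. \<forall>u\<in>U. (\<lambda>y. g y u) differentiable (at x)) \<and>
     continuous_on (UNIV \<times> U) (\<lambda>(x, u). partial_x g x u)"

definition lipschitz_in_x :: "real set \<Rightarrow> (real \<Rightarrow> real \<Rightarrow> real) \<Rightarrow> bool" where
  "lipschitz_in_x U b \<longleftrightarrow>
     (\<exists>c>0. \<forall>x1 x2. \<forall>u\<in>U. \<bar>b x1 u - b x2 u\<bar> \<le> c * \<bar>x1 - x2\<bar>)"

definition square_bounded_drift :: "real \<Rightarrow> real set \<Rightarrow> (real \<Rightarrow> real \<Rightarrow> real) \<Rightarrow> bool" where
  "square_bounded_drift T U b \<longleftrightarrow>
     (\<exists>c>0. (SUP u\<in>controls T U. \<integral>\<^sup>+t. ennreal (\<bar>b 0 (u t)\<bar>\<^sup>2) \<partial>lebesgue_on {0..T}) \<le> ennreal c)"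

text \<open>
  Well-posedness of the first-order expansion of the running cost along the pair \<open>(u, X)\<close>:
  \<open>f\<^sub>x\<close> is dominated by an integrable function of time near the trajectory. This holds, for
  instance, if \<open>f\<^sub>x\<close> is bounded or uniformly continuous on \<open>\<real> \<times> U\<close>, if \<open>U\<close> is compact,
  or if \<open>\<bar>f\<^sub>x(x,u)\<bar> \<le> K(1 + u\<^sup>2)\<close> for \<open>x\<close> in bounded sets.

  It does not follow from \<open>f\<close> being uniformly continuous and \<open>C\<^sup>1\<close> in \<open>x\<close>, and the
  maximum principle fails without it: the coefficient \<open>f\<^sub>x(X(t), u(t))\<close> of the adjoint equation
  need not be integrable. Take \<open>T = n = 1\<close>, \<open>x\<^sub>0 = 0\<close>, \<open>\<Psi> = 0\<close>, \<open>U = [1,\<infinity>)\<close>,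
  \<open>b(x,u) = sin\<^sup>2 u\<close>, \<open>f(x,u) = u\<^sup>3x / (1 + u\<^sup>8x\<^sup>2)\<close>, and an \<open>L\<^sup>2\<close> control with values in
  \<open>{k\<pi> | k \<ge> 1}\<close> whose cube is not integrable near \<open>1/2\<close>. It is optimal with \<open>X = 0\<close> and
  cost \<open>0\<close>, since all trajectories and costs are nonnegative. As \<open>f\<^sub>x(0,u) = u\<^sup>3\<close>, the adjoint
  equation has no solution if \<open>\<beta>\<^sup>0 > 0\<close>; if \<open>\<beta>\<^sup>0 = 0\<close>, then \<open>\<beta>\<^sup>1 = -1\<close> and \<open>p = 1\<close>, so
  that \<open>H = sin\<^sup>2 u\<close>, which the control does not maximise.
\<close>

definition dominated_partial_x ::
    "real \<Rightarrow> (real \<Rightarrow> real \<Rightarrow> real) \<Rightarrow> (real \<Rightarrow> real) \<Rightarrow> (real \<Rightarrow> real) \<Rightarrow> bool" where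
  "dominated_partial_x T f u X \<longleftrightarrow>
     (\<exists>\<delta>>0. \<exists>k. integrable (lebesgue_on {0..T}) k \<and>
        (AE t in lebesgue_on {0..T}. \<forall>x. \<bar>x - X t\<bar> \<le> \<delta> \<longrightarrow> \<bar>partial_x f x (u t)\<bar> \<le> k t))"

text \<open>
  The series of adjoint equations, each in integrated form on \<open>(\<tau>\<^sub>i\<^sub>-\<^sub>1, \<tau>\<^sub>i]\<close>.
  The number \<open>r i\<close> is the right limit \<open>p(\<tau>\<^sub>i\<^sup>+)\<close>, which is \<open>0\<close> by convention for \<open>i = n\<close>.
\<close>

definition adjoint_solution ::
    "(real \<Rightarrow> real \<Rightarrow> real) \<Rightarrow> (real \<Rightarrow> real \<Rightarrow> real) \<Rightarrow> (real \<Rightarrow> real) \<Rightarrow> nat \<Rightarrow> (nat \<Rightarrow> real)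
       \<Rightarrow> (nat \<Rightarrow> real) \<Rightarrow> (real \<Rightarrow> real) \<Rightarrow> (real \<Rightarrow> real) \<Rightarrow> (real \<Rightarrow> real) \<Rightarrow> bool" where
  "adjoint_solution b f \<Psi> n \<tau> \<beta> u X p \<longleftrightarrow>
     (let g = (\<lambda>t. partial_x b (X t) (u t) * p t - \<beta> 0 * partial_x f (X t) (u t)) in
     \<exists>r. r n = 0 \<and>
       (\<forall>i\<in>{1..<n}. (p \<longlongrightarrow> r i) (at_right (\<tau> i))) \<and>
       (\<forall>i\<in>{1..n}.
          integrable (lebesgue_on {\<tau> (i - 1)..\<tau> i}) g \<and>
          (\<forall>t\<in>{\<tau> (i - 1)<..<\<tau> i}. p t = p (\<tau> i) + (\<integral>s. g s \<partial>lebesgue_on {t..\<tau> i})) \<and>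
          p (\<tau> i) = - \<beta> 0 * deriv \<Psi> (X (\<tau> n)) * (if i = n then 1 else 0) - \<beta> i + r i))"

definition Hamiltonian ::
    "(real \<Rightarrow> real \<Rightarrow> real) \<Rightarrow> (real \<Rightarrow> real \<Rightarrow> real) \<Rightarrow> real \<Rightarrow> real \<Rightarrow> real \<Rightarrow> real \<Rightarrow> real" where
  "Hamiltonian b f \<beta>0 x u p = b x u * p - \<beta>0 * f x u"

end

(*
  Since X(t_j) >= 0, the sign condition in the statement only says that beta^j <= 0 for j >= 1;
  accordingly every state constraint is treated as if it were active. Replacing the optimal control
  by a competitor w on a set L that carries approximately the fraction eps of finitely many
  integrals changes the cost and the states at the times t_j, to first order in eps, by integrals of
  functions that depend on w pointwise in time. No w can decrease the cost and increase all states
  to first order. The set of these first-order vectors is convex up to approximation, again by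
  switching between two controls on a set carrying a given fraction, so a theorem of the alternative
  yields multipliers. The resulting integral inequality localises to almost every time because w may
  be the constant v on an arbitrary measurable set.
*)

theory Submission
  imports Defs
begin

section \<open>Sets carrying a given fraction of finitely many integrals\<close>

text \<open>Controls are merely measurable and f_x may be unbounded in the control; this shapes the
  variations. The set \<open>L\<close> is spread over [0,T], so that a single variation acts on all
  times t_j at once; it comes from an approximate form of Lyapunov's convexity theorem. Its error is
  taken of order eps^2, which disappears after division by eps. The strict inequalities of an
  improving direction absorb all remainders, so that for small eps the varied control itself is
  feasible and cheaper. On \<open>L\<close> the control is w, whereas f_x is dominated only along
  the reference control. There the uniform continuity of f bounds the increment of f by o(1), and
  \<open>L\<close> has measure O(eps). Off \<open>L\<close> dominated convergence applies. The
  costate is written in closed form with the fundamental solution \<open>Phi\<close> of the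
  linearised state equation and its reciprocal \<open>Theta\<close>. The multiplier of the
  constraint at t_j enters up to time t_j only, and this produces the jumps. Index 0 is free for the
  cost because X(t_0) is fixed by the initial condition.\<close>

lemma tagged_division_shrink:
  fixes a T :: real
  assumes p: "p tagged_division_of {0..T}" and a: "0 < a" "a \<le> 1"
  defines "q \<equiv> (\<lambda>(x, K). (x, (\<lambda>y. x + a * (y - x)) ` K)) ` p"
  shows "q tagged_partial_division_of {0..T}"
    and "inj_on (\<lambda>(x, K). (x, (\<lambda>y. x + a * (y - x)) ` K)) p"
    and "\<And>x K. (x, K) \<in> p \<Longrightarrow>
           measure lborel ((\<lambda>y. x + a * (y - x)) ` K) = a * measure lborel K \<and> (\<lambda>y. x + a * (y - x)) ` K \<subseteq> K"
proof -
  \<comment> \<open>Contracting towards the tag leaves the tag in the image and the image in the old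
    interval, so a fine tagged division stays tagged and fine while every length is multiplied by
    \<open>a\<close>.\<close>
  have *: "\<exists>c d. K = {c..d} \<and> c \<le> x \<and> x \<le> d \<and>
      (\<lambda>y. x + a * (y - x)) ` K = {x + a * (c - x)..x + a * (d - x)} \<and> {c..d} \<subseteq> {0..T}"
    if m: "(x, K) \<in> p" for x K
  proof -
    obtain c d where K: "K = cbox c d" using tagged_division_ofD(4)[OF p m] by auto
    have x: "x \<in> K" and sub: "K \<subseteq> {0..T}" using tagged_division_ofD(2,3)[OF p m] by auto
    have "(\<lambda>y. x + a * (y - x)) ` K = (\<lambda>y. a * y + (x - a * x)) ` {c..d}"
      by (auto simp: K algebra_simps intro!: image_cong)
    also have "\<dots> = {a * c + (x - a * x)..a * d + (x - a * x)}"
      using a x K by (subst image_affinity_atLeastAtMost) auto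
    finally have "(\<lambda>y. x + a * (y - x)) ` K = {x + a * (c - x)..x + a * (d - x)}"
      by (simp add: algebra_simps)
    then show ?thesis using K x sub by auto
  qed
  show inj: "inj_on (\<lambda>(x, K). (x, (\<lambda>y. x + a * (y - x)) ` K)) p"
  proof (rule inj_onI, clarsimp)
    fix x K L assume "(\<lambda>y. x + a * (y - x)) ` K = (\<lambda>y. x + a * (y - x)) ` L"
    moreover have "inj (\<lambda>y. x + a * (y - x))" using a by (auto intro!: injI)
    ultimately show "K = L" by (simp add: inj_image_eq_iff)
  qed
  show c: "measure lborel ((\<lambda>y. x + a * (y - x)) ` K) = a * measure lborel K \<and> (\<lambda>y. x + a * (y - x)) ` K \<subseteq> K"
    if m: "(x, K) \<in> p" for x K
  proof -
    obtain c d where K: "K = {c..d}" "c \<le> x" "x \<le> d"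
      "(\<lambda>y. x + a * (y - x)) ` K = {x + a * (c - x)..x + a * (d - x)}" using *[OF m] by auto
    have 1: "a * (c - x) \<le> a * (d - x)" using a K by simp
    have 2: "1 * (c - x) \<le> a * (c - x)" by (rule mult_right_mono_neg) (use a K in auto)
    have 3: "a * (d - x) \<le> 1 * (d - x)" by (rule mult_right_mono) (use a K in auto)
    show ?thesis using 1 2 3 K by (auto simp: algebra_simps)
  qed
  show "q tagged_partial_division_of {0..T}"
    unfolding tagged_partial_division_of_def
  proof (intro conjI allI impI)
    show "finite q" unfolding q_def using p by auto
    fix x K assume xK: "(x, K) \<in> q"
    then obtain K' where K': "(x, K') \<in> p" "K = (\<lambda>y. x + a * (y - x)) ` K'"
      by (auto simp: q_def)
    have "x \<in> K'" using tagged_division_ofD(2)[OF p K'(1)] .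
    then show "x \<in> K" unfolding K' by (rule rev_image_eqI) simp
    show "K \<subseteq> {0..T}" using c[OF K'(1)] K' tagged_division_ofD(3)[OF p K'(1)] by blast
    show "\<exists>a b. K = cbox a b" using *[OF K'(1)] K' by (metis box_real(2))
  next
    fix x K x2 L assume "(x, K) \<in> q \<and> (x2, L) \<in> q \<and> (x, K) \<noteq> (x2, L)"
    then have xK: "(x, K) \<in> q" and xL: "(x2, L) \<in> q" and ne: "(x, K) \<noteq> (x2, L)" by auto
    obtain K' where K': "(x, K') \<in> p" "K = (\<lambda>y. x + a * (y - x)) ` K'"
      using xK by (auto simp: q_def)
    from xL obtain L' where L': "(x2, L') \<in> p" "L = (\<lambda>y. x2 + a * (y - x2)) ` L'"
      by (auto simp: q_def)
    have "(x, K') \<noteq> (x2, L')" using ne K' L' by auto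
    then have "interior K' \<inter> interior L' = {}"
      using tagged_division_ofD(5)[OF p K'(1) L'(1)] by simp
    moreover have "interior K \<subseteq> interior K'" "interior L \<subseteq> interior L'"
      using c[OF K'(1)] c[OF L'(1)] K'(2) L'(2) by (simp_all add: interior_mono)
    ultimately show "interior K \<inter> interior L = {}" by blast
  qed
qed

text \<open>
  By the Henstock lemma, a fine tagged division each of whose intervals is contracted towards its
  tag by the factor \<open>a\<close> carries almost exactly the fraction \<open>a\<close> of the integral.
\<close>

lemma proportional_subset:
  fixes g :: "'i \<Rightarrow> real \<Rightarrow> real"
  assumes "finite I" and g: "\<And>i. i \<in> I \<Longrightarrow> g i integrable_on {0..T}"
    and a: "0 \<le> a" "a \<le> 1" and e: "0 < e"
  obtains L where "L \<in> sets borel" "L \<subseteq> {0..T}"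
    "\<And>i. i \<in> I \<Longrightarrow> g i integrable_on L"
    "\<And>i. i \<in> I \<Longrightarrow> \<bar>integral L (g i) - a * integral {0..T} (g i)\<bar> \<le> e"
proof (cases "a = 0")
  case True
  \<comment> \<open>For \<open>a = 0\<close> the contraction degenerates, and the empty set carries
    the fraction 0.\<close>
  show ?thesis by (rule that[of "{}"]) (use True e in auto)
next
  case False
  with a have a0: "0 < a" by simp
  \<comment> \<open>The tolerance \<open>e / 2\<close> is spent twice, on the original division and
    on the contracted one.\<close>
  define fine_for where "fine_for i \<gamma> \<longleftrightarrow> gauge \<gamma> \<and>
      (\<forall>p. p tagged_partial_division_of {0..T} \<longrightarrow> \<gamma> fine p \<longrightarrow>
       (\<Sum>(x, K)\<in>p. norm (measure lborel K *\<^sub>R g i x - integral K (g i))) < e / 2)" for i \<gamma>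
  have "\<exists>\<gamma>. fine_for i \<gamma>" if "i \<in> I" for i
  proof -
    have "g i integrable_on cbox 0 T" "0 < e / 2" using g[OF that] e by auto
    then obtain \<gamma> where "gauge \<gamma>" "\<And>p. p tagged_partial_division_of cbox 0 T \<Longrightarrow> \<gamma> fine p \<Longrightarrow>
        (\<Sum>(x, K)\<in>p. norm (measure lborel K *\<^sub>R g i x - integral K (g i))) < e / 2"
      by (rule Henstock_lemma) blast
    then show ?thesis unfolding fine_for_def box_real by blast
  qed
  then obtain \<gamma> where ff: "\<And>i. i \<in> I \<Longrightarrow> fine_for i (\<gamma> i)" by metis
  then have \<gamma>: "gauge (\<gamma> i)" if "i \<in> I" for i using that by (simp add: fine_for_def)
  have H: "(\<Sum>(x, K)\<in>p. norm (measure lborel K *\<^sub>R g i x - integral K (g i))) < e / 2"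
    if "i \<in> I" "p tagged_partial_division_of {0..T}" "\<gamma> i fine p" for i p
    using ff[OF that(1)] that(2,3) unfolding fine_for_def by blast
  have "gauge (\<lambda>x. \<Inter>i\<in>I. \<gamma> i x)"
    using \<gamma> \<open>finite I\<close> by (auto simp: gauge_def)
  then obtain p where p: "p tagged_division_of {0..T}" and fp: "(\<lambda>x. \<Inter>i\<in>I. \<gamma> i x) fine p"
    by (rule fine_division_exists_real)
  define s where "s = (\<lambda>(x, K). (x, (\<lambda>y. x + a * (y - x)) ` K))"
  note sh = tagged_division_shrink[OF p a0 a(2), folded s_def]
  define L where "L = \<Union>(snd ` s ` p)"
  have q: "s ` p tagged_division_of L"
    unfolding L_def by (rule tagged_partial_division_of_Union_self[OF sh(1)])
  have fin: "finite p" by (rule tagged_division_of_finite[OF p])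
  have box: "\<exists>c d. K = {c..d} \<and> K \<subseteq> {0..T}" if "(x, K) \<in> s ` p" for x K
  proof -
    have "K \<subseteq> {0..T}" using tagged_partial_division_ofD(3)[OF sh(1) that] .
    moreover obtain c d where "K = cbox c d" using tagged_partial_division_ofD(4)[OF sh(1) \<open>(x, K) \<in> s ` p\<close>] by auto
    moreover from this have "K = {c..d}" by simp
    ultimately show ?thesis by blast
  qed
  show ?thesis
  proof (rule that)
    show "L \<in> sets borel" unfolding L_def
    proof (rule sets.finite_Union)
      show "finite (snd ` s ` p)" using fin by blast
      show "snd ` s ` p \<subseteq> sets borel"
      proof
        fix K assume "K \<in> snd ` s ` p"
        then obtain x where "(x, K) \<in> s ` p" by (metis imageE prod.collapse)
        with box obtain c d where "K = {c..d}" by meson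
        then show "K \<in> sets borel" by simp
      qed
    qed
    show "L \<subseteq> {0..T}"
    proof
      fix y assume "y \<in> L"
      then obtain K where "y \<in> K" "K \<in> snd ` s ` p" unfolding L_def by (rule UnionE)
      moreover from this obtain x where "(x, K) \<in> s ` p" by (metis imageE prod.collapse)
      ultimately show "y \<in> {0..T}" using box[of x K] by blast
    qed
    fix i assume i: "i \<in> I"
    have int: "g i integrable_on K" if "(x, K) \<in> s ` p" for x K
      using box[OF that] integrable_on_subinterval[OF g[OF i]] by blast
    have hi: "(g i has_integral (\<Sum>(x, K)\<in>s ` p. integral K (g i))) L"
      by (rule has_integral_combine_tagged_division[OF q]) (use int in blast)
    then show "g i integrable_on L" by (rule has_integral_integrable)
    from hi have IL: "integral L (g i) = (\<Sum>(x, K)\<in>s ` p. integral K (g i))"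
      by (rule integral_unique)
    have I0: "integral {0..T} (g i) = (\<Sum>(x, K)\<in>p. integral K (g i))"
      using integral_combine_tagged_division_topdown[of "g i" 0 T p] g[OF i] p by simp
    have sub: "K \<subseteq> \<gamma> i x" if "(x, K) \<in> p" for x K
      using fineD[OF fp that] i by auto
    have fine: "\<gamma> i fine p" by (rule fineI) (rule sub)
    have fine': "\<gamma> i fine s ` p"
    proof (rule fineI)
      fix x K assume "(x, K) \<in> s ` p"
      then obtain K' where K': "(x, K') \<in> p" "K = (\<lambda>y. x + a * (y - x)) ` K'"
        by (auto simp: s_def)
      then have "K \<subseteq> K'" using sh(3)[OF K'(1)] by simp
      then show "K \<subseteq> \<gamma> i x" using sub[OF K'(1)] by blast
    qed
    have H1: "(\<Sum>(x, K)\<in>s ` p. norm (measure lborel K *\<^sub>R g i x - integral K (g i))) < e / 2"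
      by (rule H[OF i sh(1) fine'])
    have H2: "(\<Sum>(x, K)\<in>p. norm (measure lborel K *\<^sub>R g i x - integral K (g i))) < e / 2"
      using H[OF i _ fine] p unfolding tagged_division_of_def by blast
    \<comment> \<open>The tags are unchanged, hence the two Riemann sums differ exactly by the
      factor \<open>a\<close>; only the two Henstock errors remain.\<close>
    have S: "(\<Sum>(x, K)\<in>s ` p. measure lborel K *\<^sub>R g i x) = a * (\<Sum>(x, K)\<in>p. measure lborel K *\<^sub>R g i x)"
      unfolding sum_distrib_left by (subst sum.reindex[OF sh(2)])
        (rule sum.cong, use sh(3) in \<open>auto simp: s_def\<close>)
    define A where "A = (\<Sum>(x, K)\<in>p. measure lborel K *\<^sub>R g i x)"
    have dist_sum: "\<bar>sum h r - sum k r\<bar> \<le> (\<Sum>z\<in>r. norm (h z - k z))" for h k :: "real \<times> real set \<Rightarrow> real" and r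
      by (simp add: sum_abs flip: sum_subtractf)
    have "\<bar>a * A - integral L (g i)\<bar> \<le> e / 2"
      unfolding IL A_def S[symmetric]
      by (rule order_trans[OF dist_sum less_imp_le]) (use H1 in \<open>simp add: split_def\<close>)
    moreover have "\<bar>A - integral {0..T} (g i)\<bar> \<le> e / 2"
      unfolding I0 A_def
      by (rule order_trans[OF dist_sum less_imp_le]) (use H2 in \<open>simp add: split_def\<close>)
    then have "a * \<bar>A - integral {0..T} (g i)\<bar> \<le> 1 * (e / 2)"
      using a by (intro mult_mono) auto
    then have "\<bar>a * A - a * integral {0..T} (g i)\<bar> \<le> e / 2"
      using a by (simp add: abs_mult flip: right_diff_distrib)
    ultimately show "\<bar>integral L (g i) - a * integral {0..T} (g i)\<bar> \<le> e" by linarith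
  qed
qed

section \<open>A theorem of the alternative\<close>

text \<open>Convexity of the image of \<open>S\<close> under the vector of all \<open>F i\<close>,
  up to an error uniform in \<open>i\<close>: sets carrying a given fraction of several integrals
  are constructed only approximately.\<close>

definition almost_convexlike :: "'i set \<Rightarrow> ('i \<Rightarrow> 'w \<Rightarrow> real) \<Rightarrow> 'w set \<Rightarrow> bool" where
  "almost_convexlike I F S \<longleftrightarrow> (\<forall>w1\<in>S. \<forall>w2\<in>S. \<forall>a\<in>{0..1}. \<forall>e>0. \<exists>w\<in>S. \<forall>i\<in>I.
     \<bar>F i w - ((1 - a) * F i w1 + a * F i w2)\<bar> \<le> e)"

text \<open>Separation in the plane: the image of \<open>S\<close> avoids the open positive
  quadrant. Points with \<open>g > 0\<close> bound \<open>\<mu>\<close> from below and points with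
  \<open>h > 0\<close> from above, the bound being \<open>r\<close>, the weight at which the
  combination vanishes. By \<open>cross\<close> all lower bounds lie below all upper bounds.\<close>

lemma convexlike_two:
  fixes g h :: "'w \<Rightarrow> real"
  assumes cv: "\<And>w1 w2 a e. w1 \<in> S \<Longrightarrow> w2 \<in> S \<Longrightarrow> 0 \<le> a \<Longrightarrow> a \<le> 1 \<Longrightarrow> 0 < e \<Longrightarrow>
      \<exists>w\<in>S. \<bar>g w - ((1 - a) * g w1 + a * g w2)\<bar> \<le> e \<and> \<bar>h w - ((1 - a) * h w1 + a * h w2)\<bar> \<le> e"
    and no: "\<And>w. w \<in> S \<Longrightarrow> \<not> (g w > 0 \<and> h w > 0)"
  shows "\<exists>\<mu>\<in>{0..1}. \<forall>w\<in>S. (1 - \<mu>) * g w + \<mu> * h w \<le> 0"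
proof (cases "\<exists>w\<in>S. h w > 0")
  case False
  then show ?thesis by (intro bexI[of _ 1]) auto
next
  case True
  define r where "r w = g w / (g w - h w)" for w
  define A where "A = {w \<in> S. g w > 0}"
  define B where "B = {w \<in> S. h w > 0}"
  have A: "g w > 0" "h w \<le> 0" if "w \<in> A" for w using that no[of w] by (auto simp: A_def)
  have B: "h w > 0" "g w \<le> 0" if "w \<in> B" for w using that no[of w] by (auto simp: B_def)
  have cross: "g v * h w \<le> g w * h v" if v: "v \<in> A" and w: "w \<in> B" for v w
  proof (rule ccontr)
    assume "\<not> ?thesis"
    then have gt: "g w * h v < g v * h w" by simp
    define D where "D = (g v - h v) + (h w - g w)"
    \<comment> \<open>At this weight the interpolated values of \<open>g\<close> and
      \<open>h\<close> coincide. Their common value \<open>m\<close> is positive if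
      \<open>cross\<close> fails, and the tolerance \<open>m / 2\<close> then yields a point of the
      forbidden quadrant.\<close>
    define a where "a = (g v - h v) / D"
    have D: "D > 0" using A[OF v] B[OF w] by (simp add: D_def)
    have a: "0 \<le> a" "a \<le> 1" using A[OF v] B[OF w] D by (auto simp: a_def D_def)
    have 1: "(1 - a) * g v + a * g w = (g v * h w - g w * h v) / D"
      using D by (simp add: a_def field_simps) (simp add: D_def algebra_simps)
    have 2: "(1 - a) * h v + a * h w = (g v * h w - g w * h v) / D"
      using D by (simp add: a_def field_simps) (simp add: D_def algebra_simps)
    define m where "m = (g v * h w - g w * h v) / D"
    have m: "m > 0" using gt D by (simp add: m_def)
    obtain x where "x \<in> S" "\<bar>g x - m\<bar> \<le> m / 2" "\<bar>h x - m\<bar> \<le> m / 2"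
      using cv[of v w a "m / 2"] v w a m unfolding 1 2 m_def[symmetric] A_def B_def by auto
    then show False using no[of x] m by linarith
  qed
  have rr: "r v \<le> r w" if "v \<in> A" "w \<in> B" for v w
    using cross[OF that] A[OF that(1)] B[OF that(2)]
    by (simp add: r_def divide_simps) (simp add: algebra_simps)
  have rA: "0 \<le> r v" "r v \<le> 1" if "v \<in> A" for v
    using A[OF that] by (auto simp: r_def divide_simps)
  have rB: "0 \<le> r v" "r v \<le> 1" if "v \<in> B" for v
    using B[OF that] by (auto simp: r_def divide_simps)
  \<comment> \<open>The inserted 0 covers an empty \<open>A\<close>; it respects the upper bounds
    because \<open>r\<close> is nonnegative on \<open>B\<close>.\<close>
  define \<mu> where "\<mu> = Sup (insert 0 (r ` A))"
  have bdd: "bdd_above (insert 0 (r ` A))" using rA by (auto intro!: bdd_aboveI[of _ 1])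
  have \<mu>0: "0 \<le> \<mu>" unfolding \<mu>_def by (rule cSup_upper) (use bdd in auto)
  have \<mu>1: "\<mu> \<le> 1" unfolding \<mu>_def by (rule cSup_least) (use rA in auto)
  have \<mu>A: "r v \<le> \<mu>" if "v \<in> A" for v unfolding \<mu>_def by (rule cSup_upper) (use bdd that in auto)
  have \<mu>B: "\<mu> \<le> r w" if "w \<in> B" for w
    unfolding \<mu>_def by (rule cSup_least) (use rr rB that in auto)
  show ?thesis
  proof (intro bexI ballI)
    show "\<mu> \<in> {0..1}" using \<mu>0 \<mu>1 by simp
    fix w assume "w \<in> S"
    consider "w \<in> A" | "w \<in> B" | "g w \<le> 0" "h w \<le> 0"
      using \<open>w \<in> S\<close> by (force simp: A_def B_def)
    then show "(1 - \<mu>) * g w + \<mu> * h w \<le> 0"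
    proof cases
      case 1
      then show ?thesis using \<mu>A[OF 1] A[OF 1] by (simp add: r_def divide_simps) (simp add: algebra_simps)
    next
      case 2
      then show ?thesis using \<mu>B[OF 2] B[OF 2] by (simp add: r_def divide_simps) (simp add: algebra_simps)
    next
      case 3
      then show ?thesis using \<mu>0 \<mu>1 by (simp add: add_nonpos_nonpos mult_nonneg_nonpos)
    qed
  qed
qed

text \<open>
  Fan's theorem of the alternative. Induction on the number of functions: the multipliers of
  \<open>F 0, \<dots>, F n\<close> on the subset of \<open>S\<close> where \<open>F (Suc n)\<close> is positive combine these functions to a
  single one, which the case of two functions balances against \<open>F (Suc n)\<close>.
\<close>

lemma convexlike_alternative:
  fixes F :: "nat \<Rightarrow> 'w \<Rightarrow> real"
  assumes "almost_convexlike {..n} F S" "\<And>w. w \<in> S \<Longrightarrow> \<not> (\<forall>i\<le>n. F i w > 0)"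
  shows "\<exists>l. (\<forall>i. 0 \<le> l i) \<and> (\<Sum>i\<le>n. l i) = 1 \<and> (\<forall>w\<in>S. (\<Sum>i\<le>n. l i * F i w) \<le> 0)"
  using assms
proof (induction n arbitrary: S)
  case 0
  then have "F 0 w \<le> 0" if "w \<in> S" for w using that by (auto simp: not_less)
  then show ?case by (intro exI[of _ "\<lambda>_. 1"]) simp
next
  case (Suc n)
  define S' where "S' = {w \<in> S. F (Suc n) w > 0}"
  have cv: "\<exists>w\<in>S. \<forall>i\<le>Suc n. \<bar>F i w - ((1 - a) * F i w1 + a * F i w2)\<bar> \<le> e"
    if "w1 \<in> S" "w2 \<in> S" "0 \<le> a" "a \<le> 1" "0 < e" for w1 w2 a e
    using Suc.prems(1)[unfolded almost_convexlike_def, rule_format, OF that(1,2) _ that(5), of a] that(3,4)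
    by auto
  have "almost_convexlike {..n} F S'"
    unfolding almost_convexlike_def
  proof (intro ballI allI impI)
    fix w1 w2 and a e :: real assume w: "w1 \<in> S'" "w2 \<in> S'" and a: "a \<in> {0..1}" and e: "0 < e"
    define m where "m = (1 - a) * F (Suc n) w1 + a * F (Suc n) w2"
    have m: "m > 0"
    proof (cases "a = 0")
      case True then show ?thesis using w by (simp add: m_def S'_def)
    next
      case False then show ?thesis using w a unfolding m_def S'_def
        by (intro add_nonneg_pos mult_nonneg_nonneg mult_pos_pos) auto
    qed
    \<comment> \<open>The tolerance \<open>m / 2\<close> keeps \<open>F (Suc n)\<close> positive at
      \<open>x\<close>, so that the approximate combination stays in \<open>S'\<close>.\<close>
    obtain x where x: "x \<in> S" "\<And>i. i \<le> Suc n \<Longrightarrow> \<bar>F i x - ((1 - a) * F i w1 + a * F i w2)\<bar> \<le> min e (m / 2)"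
    proof -
      have "w1 \<in> S" "w2 \<in> S" "0 \<le> a" "a \<le> 1" "0 < min e (m / 2)" using w a e m by (auto simp: S'_def)
      from cv[OF this] show ?thesis using that by blast
    qed
    have "\<bar>F (Suc n) x - m\<bar> \<le> m / 2" using x(2)[of "Suc n"] unfolding m_def[symmetric] by simp
    then have "F (Suc n) x > 0" using m by linarith
    then have "x \<in> S'" using x(1) by (simp add: S'_def)
    then show "\<exists>w\<in>S'. \<forall>i\<in>{..n}. \<bar>F i w - ((1 - a) * F i w1 + a * F i w2)\<bar> \<le> e"
      using x(2) by (intro bexI[of _ x]) (simp_all add: le_SucI)
  qed
  then obtain l where l: "\<And>i. 0 \<le> l i" "(\<Sum>i\<le>n. l i) = 1" "\<And>w. w \<in> S' \<Longrightarrow> (\<Sum>i\<le>n. l i * F i w) \<le> 0"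
  proof -
    have "\<not> (\<forall>i\<le>n. F i w > 0)" if "w \<in> S'" for w
      using Suc.prems(2)[of w] that by (auto simp: S'_def le_Suc_eq)
    from Suc.IH[OF \<open>almost_convexlike {..n} F S'\<close> this] show ?thesis using that by blast
  qed
  define g where "g w = (\<Sum>i\<le>n. l i * F i w)" for w
  have "\<exists>\<mu>\<in>{0..1}. \<forall>w\<in>S. (1 - \<mu>) * g w + \<mu> * F (Suc n) w \<le> 0"
  proof (rule convexlike_two)
    fix w1 w2 and a e :: real assume w: "w1 \<in> S" "w2 \<in> S" "0 \<le> a" "a \<le> 1" "0 < e"
    obtain x where x: "x \<in> S" "\<And>i. i \<le> Suc n \<Longrightarrow> \<bar>F i x - ((1 - a) * F i w1 + a * F i w2)\<bar> \<le> e"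
      using cv[OF w] by auto
    have "g x - ((1 - a) * g w1 + a * g w2) = (\<Sum>i\<le>n. l i * (F i x - ((1 - a) * F i w1 + a * F i w2)))"
      unfolding g_def sum_distrib_left sum.distrib[symmetric] sum_subtractf[symmetric]
      by (rule sum.cong) (auto simp: algebra_simps)
    also have "\<bar>\<dots>\<bar> \<le> (\<Sum>i\<le>n. l i * e)"
      using x(2) l(1) by (intro order_trans[OF sum_abs] sum_mono) (auto simp: abs_mult intro!: mult_left_mono)
    also have "\<dots> = e" using l(2) by (simp flip: sum_distrib_right)
    finally show "\<exists>w\<in>S. \<bar>g w - ((1 - a) * g w1 + a * g w2)\<bar> \<le> e \<and>
        \<bar>F (Suc n) w - ((1 - a) * F (Suc n) w1 + a * F (Suc n) w2)\<bar> \<le> e"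
      using x by blast
  next
    fix w assume "w \<in> S"
    then show "\<not> (g w > 0 \<and> F (Suc n) w > 0)" using l(3)[of w] by (auto simp: S'_def g_def)
  qed
  then obtain \<mu> where \<mu>: "0 \<le> \<mu>" "\<mu> \<le> 1" "\<And>w. w \<in> S \<Longrightarrow> (1 - \<mu>) * g w + \<mu> * F (Suc n) w \<le> 0" by auto
  define k where "k i = (if i \<le> n then (1 - \<mu>) * l i else \<mu>)" for i
  have "(\<Sum>i\<le>n. k i) = (1 - \<mu>)" using l(2) by (simp add: k_def flip: sum_distrib_left)
  moreover have "(\<Sum>i\<le>n. k i * F i w) = (1 - \<mu>) * g w" for w
    unfolding g_def sum_distrib_left by (rule sum.cong) (auto simp: k_def)
  ultimately show ?case using \<mu> l(1) by (intro exI[of _ k]) (auto simp: k_def)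
qed

section \<open>Indefinite integrals and Caratheodory equations\<close>

lemma integrable_on_Icc:
  fixes f :: "real \<Rightarrow> real"
  assumes "integrable (lebesgue_on {0..T}) f" "0 \<le> s" "t \<le> T"
  shows "f integrable_on {s..t}"
proof -
  have "f integrable_on {0..T}" by (rule integrable_on_lebesgue_on[OF assms(1)]) simp
  then show ?thesis by (rule integrable_on_subinterval) (use assms in auto)
qed

text \<open>Bridge from the Lebesgue integrals in which the problem is stated to the gauge integrals
  in which the estimates are carried out.\<close>

lemma lebesgue_integral_Icc:
  fixes f :: "real \<Rightarrow> real"
  assumes "integrable (lebesgue_on {0..T}) f" "0 \<le> s" "t \<le> T"
  shows "integrable (lebesgue_on {s..t}) f"
    and "integral\<^sup>L (lebesgue_on {s..t}) f = integral {s..t} f"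
proof -
  show "integrable (lebesgue_on {s..t}) f"
    by (rule integrable_subinterval[OF assms(1)]) (use assms in auto)
  then show "integral\<^sup>L (lebesgue_on {s..t}) f = integral {s..t} f"
    by (rule lebesgue_integral_eq_integral) simp
qed

lemma integral_abs_le:
  fixes f g :: "real \<Rightarrow> real"
  assumes "integrable (lebesgue_on {0..T}) f" "integrable (lebesgue_on {0..T}) g" "0 \<le> s" "t \<le> T"
    and "\<And>r. s \<le> r \<Longrightarrow> r \<le> t \<Longrightarrow> \<bar>f r\<bar> \<le> g r"
  shows "\<bar>integral {s..t} f\<bar> \<le> integral {s..t} g"
  unfolding real_norm_def[symmetric]
  by (rule Henstock_Kurzweil_Integration.integral_norm_bound_integral)
    (use assms in \<open>auto intro: integrable_on_Icc\<close>)

lemma integral_Icc_diff: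
  fixes f :: "real \<Rightarrow> real"
  assumes "integrable (lebesgue_on {0..T}) f" "0 \<le> s" "s \<le> t" "t \<le> T"
  shows "integral {0..t} f - integral {0..s} f = integral {s..t} f"
  using Henstock_Kurzweil_Integration.integral_combine[OF assms(2,3) integrable_on_Icc[OF assms(1) _ assms(4)]]
  by simp

lemma continuous_on_indefinite_integral:
  fixes f :: "real \<Rightarrow> real"
  assumes "integrable (lebesgue_on {0..T}) f"
  shows "continuous_on {0..T} (\<lambda>t. x0 + integral {0..t} f)"
  by (intro continuous_intros indefinite_integral_continuous_1 integrable_on_Icc[OF assms]) auto

lemma borel_measurable_continuous_Icc:
  fixes g :: "real \<Rightarrow> real"
  assumes "continuous_on {0..T} g"
  shows "g \<in> borel_measurable (lebesgue_on {0..T})"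
  by (rule continuous_imp_measurable_on_sets_lebesgue[OF assms]) simp

lemma integrable_continuous_Icc:
  fixes g :: "real \<Rightarrow> real"
  assumes "continuous_on {0..T} g"
  shows "integrable (lebesgue_on {0..T}) g"
  using assms by (rule continuous_imp_integrable_real)

lemma continuous_on_Icc_bound:
  fixes g :: "real \<Rightarrow> real"
  assumes "continuous_on {a..b} g"
  obtains B where "0 \<le> B" "\<And>t. t \<in> {a..b} \<Longrightarrow> \<bar>g t\<bar> \<le> B"
proof -
  have "bounded (g ` {a..b})" by (intro compact_imp_bounded compact_continuous_image assms) simp
  then obtain B where "\<forall>t\<in>{a..b}. \<bar>g t\<bar> \<le> B" by (auto simp: bounded_iff)
  then have "\<bar>g t\<bar> \<le> \<bar>B\<bar>" if "t \<in> {a..b}" for t using that by force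
  then show ?thesis using that[of "\<bar>B\<bar>"] by simp
qed

lemma integrable_bounded_mult:
  fixes f g :: "real \<Rightarrow> real"
  assumes f: "integrable (lebesgue_on {0..T}) f" and g: "g \<in> borel_measurable (lebesgue_on {0..T})"
    and B: "\<And>t. t \<in> {0..T} \<Longrightarrow> \<bar>g t\<bar> \<le> B"
  shows "integrable (lebesgue_on {0..T}) (\<lambda>t. g t * f t)"
proof (rule Bochner_Integration.integrable_bound)
  show "integrable (lebesgue_on {0..T}) (\<lambda>t. B * f t)" using f by simp
  show "(\<lambda>t. g t * f t) \<in> borel_measurable (lebesgue_on {0..T})"
    using f g by (intro borel_measurable_times) auto
  show "AE t in lebesgue_on {0..T}. norm (g t * f t) \<le> norm (B * f t)"
  proof (rule AE_I2)
    fix t assume "t \<in> space (lebesgue_on {0..T})"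
    then have "\<bar>g t\<bar> \<le> B" using B by simp
    then show "norm (g t * f t) \<le> norm (B * f t)"
      by (simp add: abs_mult) (intro mult_right_mono, auto)
  qed
qed

lemma integrable_continuous_mult:
  fixes f g :: "real \<Rightarrow> real"
  assumes f: "integrable (lebesgue_on {0..T}) f" and g: "continuous_on {0..T} g"
  shows "integrable (lebesgue_on {0..T}) (\<lambda>t. g t * f t)"
proof -
  obtain B where "\<And>t. t \<in> {0..T} \<Longrightarrow> \<bar>g t\<bar> \<le> B"
    by (rule continuous_on_Icc_bound[OF g]) blast
  then show ?thesis by (rule integrable_bounded_mult[OF f borel_measurable_continuous_Icc[OF g]])
qed

section \<open>Exponential weights: Gronwall inequality and Picard iteration\<close>

lemma integral_exp_weight:
  fixes c D t :: real
  assumes "0 < c" "0 \<le> t"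
  shows "integral {0..t} (\<lambda>s. D * exp (2 * c * s)) = D * (exp (2 * c * t) - 1) / (2 * c)"
proof (rule integral_unique)
  have "((\<lambda>s. D * exp (2 * c * s)) has_integral D * exp (2 * c * t) / (2 * c) - D * exp (2 * c * 0) / (2 * c)) {0..t}"
    using assms by (intro fundamental_theorem_of_calculus)
      (auto intro!: derivative_eq_intros simp: has_real_derivative_iff_has_vector_derivative[symmetric])
  then show "((\<lambda>s. D * exp (2 * c * s)) has_integral D * (exp (2 * c * t) - 1) / (2 * c)) {0..t}"
    by (simp add: right_diff_distrib diff_divide_distrib)
qed

text \<open>
  The exponential weight turns integration against the Lipschitz constant into multiplication by
  \<open>1/2\<close>.
\<close>

lemma integral_weight_le:
  fixes z :: "real \<Rightarrow> real"
  assumes z: "integrable (lebesgue_on {0..T}) z" and c: "0 < c" and D: "0 \<le> D"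
    and le: "\<And>s. s \<in> {0..T} \<Longrightarrow> \<bar>z s\<bar> \<le> c * (D * exp (2 * c * s))" and t: "t \<in> {0..T}"
  shows "\<bar>integral {0..t} z\<bar> \<le> D / 2 * exp (2 * c * t)"
proof -
  have "\<bar>integral {0..t} z\<bar> \<le> integral {0..t} (\<lambda>s. (c * D) * exp (2 * c * s))"
    by (rule integral_abs_le[OF z integrable_continuous_Icc])
      (use le t in \<open>auto intro!: continuous_intros simp: mult.assoc\<close>)
  also have "\<dots> = c * D * (exp (2 * c * t) - 1) / (2 * c)"
    by (rule integral_exp_weight) (use c t in auto)
  also have "\<dots> = D / 2 * (exp (2 * c * t) - 1)" using c by (simp add: field_simps)
  also have "\<dots> \<le> D / 2 * exp (2 * c * t)" using D by (intro mult_left_mono) auto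
  finally show ?thesis .
qed

text \<open>Evaluate the hypothesis where \<open>\<bar>z t\<bar> * exp (- (2 * c * t))\<close> is
  maximal: the integral term is at most half of the left-hand side and is absorbed. This is the
  origin of the factor 2 and of the exponent \<open>2 * c\<close>.\<close>

lemma gronwall:
  fixes z :: "real \<Rightarrow> real"
  assumes z: "continuous_on {0..T} z" and c: "0 < c" and a: "0 \<le> a"
    and le: "\<And>t. t \<in> {0..T} \<Longrightarrow> \<bar>z t\<bar> \<le> a + c * integral {0..t} (\<lambda>s. \<bar>z s\<bar>)"
    and t: "t \<in> {0..T}"
  shows "\<bar>z t\<bar> \<le> 2 * a * exp (2 * c * T)"
proof -
  have "continuous_on {0..T} (\<lambda>t. \<bar>z t\<bar> * exp (- (2 * c * t)))" by (intro continuous_intros z)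
  from continuous_attains_sup[OF _ _ this] t obtain r where r: "r \<in> {0..T}"
    and max: "\<And>s. s \<in> {0..T} \<Longrightarrow> \<bar>z s\<bar> * exp (- (2 * c * s)) \<le> \<bar>z r\<bar> * exp (- (2 * c * r))" by auto
  define m where "m = \<bar>z r\<bar> * exp (- (2 * c * r))"
  have zs: "\<bar>z s\<bar> \<le> m * exp (2 * c * s)" if "s \<in> {0..T}" for s
  proof -
    have "\<bar>z s\<bar> = \<bar>z s\<bar> * exp (- (2 * c * s)) * exp (2 * c * s)" by (simp add: exp_minus)
    also have "\<dots> \<le> m * exp (2 * c * s)" unfolding m_def by (intro mult_right_mono max that) auto
    finally show ?thesis .
  qed
  have zr: "\<bar>z r\<bar> = m * exp (2 * c * r)" by (simp add: m_def exp_minus)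
  have m: "0 \<le> m" by (simp add: m_def)
  \<comment> \<open>Taking \<open>D = m / c\<close> in the weighted bound turns its hypothesis into
    \<open>zs\<close>.\<close>
  have "\<bar>integral {0..r} (\<lambda>s. \<bar>z s\<bar>)\<bar> \<le> (m / c) / 2 * exp (2 * c * r)"
    by (rule integral_weight_le[OF integrable_continuous_Icc])
      (use zs z c m r in \<open>auto intro!: continuous_intros\<close>)
  then have "c * integral {0..r} (\<lambda>s. \<bar>z s\<bar>) \<le> c * ((m / c) / 2 * exp (2 * c * r))"
    using c by (intro mult_left_mono) auto
  then have "m * exp (2 * c * r) \<le> 2 * a" using le[OF r] zr c by simp
  moreover have "m * 1 \<le> m * exp (2 * c * r)" using m c r by (intro mult_left_mono) auto
  ultimately have "m \<le> 2 * a" by simp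
  then have "m * exp (2 * c * t) \<le> 2 * a * exp (2 * c * T)"
    using t c a by (intro mult_mono) auto
  then show ?thesis using zs[OF t] by simp
qed

text \<open>Picard iteration in the norm weighted by \<open>exp (2 * c * t)\<close>: the integral
  operator halves distances on the whole of [0,T], so the solution is global at once. Measurability
  of \<open>F\<close> enters through \<open>int\<close>, for continuous arguments.\<close>

lemma caratheodory_solution_exists:
  fixes F :: "real \<Rightarrow> real \<Rightarrow> real"
  assumes c: "0 < c"
    and int: "\<And>Y. continuous_on {0..T} Y \<Longrightarrow> integrable (lebesgue_on {0..T}) (\<lambda>s. F s (Y s))"
    and lip: "\<And>s x y. s \<in> {0..T} \<Longrightarrow> \<bar>F s x - F s y\<bar> \<le> c * \<bar>x - y\<bar>"
  obtains Y where "continuous_on {0..T} Y"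
    "\<And>t. t \<in> {0..T} \<Longrightarrow> Y t = x0 + integral {0..t} (\<lambda>s. F s (Y s))"
proof -
  define P where "P Y t = x0 + integral {0..t} (\<lambda>s. F s (Y s))" for Y t
  have contP: "continuous_on {0..T} (P Y)" if "continuous_on {0..T} Y" for Y
    unfolding P_def by (rule continuous_on_indefinite_integral[OF int[OF that]])
  have contr: "\<bar>P Y t - P Z t\<bar> \<le> D / 2 * exp (2 * c * t)"
    if Y: "continuous_on {0..T} Y" and Z: "continuous_on {0..T} Z" and D: "0 \<le> D"
      and le: "\<And>s. s \<in> {0..T} \<Longrightarrow> \<bar>Y s - Z s\<bar> \<le> D * exp (2 * c * s)" and t: "t \<in> {0..T}"
    for Y Z D t
  proof -
    have "P Y t - P Z t = integral {0..t} (\<lambda>s. F s (Y s) - F s (Z s))"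
      unfolding P_def using t
      by (subst Henstock_Kurzweil_Integration.integral_diff) (auto intro!: integrable_on_Icc int Y Z)
    also have "\<bar>\<dots>\<bar> \<le> D / 2 * exp (2 * c * t)"
    proof (rule integral_weight_le[OF _ c D _ t])
      show "integrable (lebesgue_on {0..T}) (\<lambda>s. F s (Y s) - F s (Z s))"
        by (intro Bochner_Integration.integrable_diff int Y Z)
      fix s assume s: "s \<in> {0..T}"
      have "\<bar>F s (Y s) - F s (Z s)\<bar> \<le> c * \<bar>Y s - Z s\<bar>" by (rule lip[OF s])
      also have "\<dots> \<le> c * (D * exp (2 * c * s))" using c le[OF s] by (intro mult_left_mono) auto
      finally show "\<bar>F s (Y s) - F s (Z s)\<bar> \<le> c * (D * exp (2 * c * s))" .
    qed
    finally show ?thesis .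
  qed
  define Ym where "Ym m = (P ^^ m) (\<lambda>_. x0)" for m
  have iter: "Ym (Suc m) = P (Ym m)" for m by (simp add: Ym_def)
  have cont: "continuous_on {0..T} (Ym m)" for m
    by (induction m) (auto simp: iter contP, simp add: Ym_def)
  have "continuous_on {0..T} (\<lambda>t. Ym 1 t - Ym 0 t)" by (intro continuous_intros cont)
  then obtain D where D: "\<And>t. t \<in> {0..T} \<Longrightarrow> \<bar>Ym 1 t - Ym 0 t\<bar> \<le> D"
    by (rule continuous_on_Icc_bound) blast
  define D' where "D' = max D 0"
  have step: "\<bar>Ym (Suc m) t - Ym m t\<bar> \<le> D' * (1/2) ^ m * exp (2 * c * t)" if "t \<in> {0..T}" for m t
    using that
  proof (induction m arbitrary: t)
    case 0
    have "\<bar>Ym 1 t - Ym 0 t\<bar> \<le> D' * 1" using D[OF 0] by (simp add: D'_def)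
    also have "\<dots> \<le> D' * exp (2 * c * t)" using 0 c by (intro mult_left_mono) (auto simp: D'_def)
    finally show ?case by simp
  next
    case (Suc m)
    have "\<bar>P (Ym (Suc m)) t - P (Ym m) t\<bar> \<le> (D' * (1/2) ^ m) / 2 * exp (2 * c * t)"
      by (rule contr[OF cont cont _ Suc.IH Suc.prems]) (auto simp: D'_def)
    then show ?case by (simp add: iter)
  qed
  \<comment> \<open>The iterates are partial sums of their increments, which a geometric series
    dominates uniformly in \<open>t\<close>.\<close>
  have "\<exists>l. uniform_limit {0..T} (\<lambda>n t. \<Sum>i<n. Ym (Suc i) t - Ym i t) l sequentially"
  proof (rule exI, rule Weierstrass_m_test)
    show "norm (Ym (Suc m) t - Ym m t) \<le> D' * exp (2 * c * T) * (1/2) ^ m" if "t \<in> {0..T}" for m t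
    proof -
      have "D' * (1/2) ^ m * exp (2 * c * t) \<le> D' * (1/2) ^ m * exp (2 * c * T)"
        using that c by (intro mult_left_mono) (auto simp: D'_def)
      then show ?thesis using step[OF that, of m] by (simp add: mult_ac)
    qed
    show "summable (\<lambda>m. D' * exp (2 * c * T) * (1/2::real) ^ m)"
      by (intro summable_mult summable_geometric) simp
  qed
  then obtain l where l: "uniform_limit {0..T} (\<lambda>n t. \<Sum>i<n. Ym (Suc i) t - Ym i t) l sequentially" ..
  have "(\<Sum>i<n. Ym (Suc i) t - Ym i t) = Ym n t - x0" for n t
    using sum_lessThan_telescope[of "\<lambda>i. Ym i t" n] by (simp add: Ym_def)
  with l have l: "uniform_limit {0..T} (\<lambda>n t. Ym n t - x0) l sequentially" by simp
  define Y where "Y t = l t + x0" for t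
  have ul: "uniform_limit {0..T} Ym Y sequentially"
  proof -
    have "uniform_limit {0..T} (\<lambda>n t. (Ym n t - x0) + x0) (\<lambda>t. l t + x0) sequentially"
      by (intro uniform_limit_intros l)
    then show ?thesis by (simp add: Y_def[abs_def])
  qed
  have Y: "continuous_on {0..T} Y"
    by (rule uniform_limit_theorem[OF always_eventually[OF allI[OF cont]] ul]) simp
  have "Y t = P Y t" if t: "t \<in> {0..T}" for t
  proof (rule LIMSEQ_unique)
    show "(\<lambda>m. Ym (Suc m) t) \<longlonglongrightarrow> Y t"
      using tendsto_uniform_limitI[OF ul t] by (rule LIMSEQ_Suc)
    show "(\<lambda>m. Ym (Suc m) t) \<longlonglongrightarrow> P Y t"
    proof (rule LIMSEQ_I)
      fix e :: real assume e: "0 < e"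
      \<comment> \<open>Dividing by the weight makes the contraction estimate at \<open>t\<close>
        equal to \<open>e / 2\<close>.\<close>
      define d where "d = e / exp (2 * c * t)"
      have d: "0 < d" using e by (simp add: d_def)
      from uniform_limitD[OF ul d] obtain N where "\<forall>m\<ge>N. \<forall>s\<in>{0..T}. dist (Ym m s) (Y s) < d"
        by (auto simp: eventually_sequentially)
      then have N: "dist (Ym m s) (Y s) < d" if "m \<ge> N" "s \<in> {0..T}" for m s using that by blast
      have "norm (Ym (Suc m) t - P Y t) < e" if "m \<ge> N" for m
      proof -
        have "\<bar>P (Ym m) t - P Y t\<bar> \<le> d / 2 * exp (2 * c * t)"
        proof (rule contr[OF cont Y _ _ t])
          fix s assume s: "s \<in> {0..T}"
          have "d * 1 \<le> d * exp (2 * c * s)" using d c s by (intro mult_left_mono) auto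
          then show "\<bar>Ym m s - Y s\<bar> \<le> d * exp (2 * c * s)"
            using N[OF that s] by (simp add: dist_real_def)
        qed (use d in simp)
        also have "\<dots> = e / 2" by (simp add: d_def)
        finally show ?thesis using e by (simp add: iter)
      qed
      then show "\<exists>no. \<forall>m\<ge>no. norm (Ym (Suc m) t - P Y t) < e" by blast
    qed
  qed
  then show ?thesis using that[OF Y] by (simp add: P_def)
qed

section \<open>Product rule for indefinite integrals\<close>

text \<open>Increments are summed over a uniform grid of mesh below \<open>\<delta>\<close>; the
  right-hand sides telescope, and \<open>\<eta>\<close> is arbitrary. This takes the place of the
  fact that an absolutely continuous function with zero derivative almost everywhere is
  constant.\<close>

lemma constant_if_small_increments:
  fixes D H :: "real \<Rightarrow> real"
  assumes small: "\<And>\<eta>. 0 < \<eta> \<Longrightarrow> \<exists>\<delta>>0. \<forall>s t. 0 \<le> s \<longrightarrow> s \<le> t \<longrightarrow> t \<le> T \<longrightarrow> t - s < \<delta> \<longrightarrow>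
      \<bar>D t - D s\<bar> \<le> \<eta> * (H t - H s)"
    and t: "t \<in> {0..T}"
  shows "D t = D 0"
proof (cases "t = 0")
  case False
  with t have t0: "0 < t" by simp
  have key: "\<bar>D t - D 0\<bar> \<le> \<eta> * (H t - H 0)" if \<eta>: "0 < \<eta>" for \<eta>
  proof -
    obtain \<delta> where \<delta>: "\<delta> > 0" and S: "\<And>s r. 0 \<le> s \<Longrightarrow> s \<le> r \<Longrightarrow> r \<le> T \<Longrightarrow> r - s < \<delta> \<Longrightarrow>
      \<bar>D r - D s\<bar> \<le> \<eta> * (H r - H s)" using small[OF \<eta>] by blast
    obtain N :: nat where N: "t / \<delta> < real N" using reals_Archimedean2 by blast
    have N0: "0 < real N" using N \<delta> t0 by (smt (verit) divide_pos_pos)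
    define x where "x k = t * real k / real N" for k
    have "\<bar>D (x (Suc k)) - D (x k)\<bar> \<le> \<eta> * (H (x (Suc k)) - H (x k))" if "k < N" for k
    proof (rule S)
      have "t * real (Suc k) / real N \<le> t * real N / real N"
        using that t0 N0 by (intro divide_right_mono mult_left_mono) auto
      then show "x (Suc k) \<le> T" using t N0 by (simp add: x_def)
      have "x (Suc k) - x k = t / real N" using N0 by (simp add: x_def field_simps)
      also have "\<dots> < \<delta>" using N N0 \<delta> by (simp add: field_simps)
      finally show "x (Suc k) - x k < \<delta>" .
      show "0 \<le> x k" "x k \<le> x (Suc k)" using t0 N0 by (auto simp: x_def intro!: divide_right_mono)
    qed
    then have "(\<Sum>k<N. \<bar>D (x (Suc k)) - D (x k)\<bar>) \<le> (\<Sum>k<N. \<eta> * (H (x (Suc k)) - H (x k)))"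
      by (intro sum_mono) auto
    also have "\<dots> = \<eta> * (H (x N) - H (x 0))"
      unfolding sum_distrib_left[symmetric] using sum_lessThan_telescope[of "\<lambda>k. H (x k)" N] by simp
    also have "\<bar>\<Sum>k<N. D (x (Suc k)) - D (x k)\<bar> \<le> (\<Sum>k<N. \<bar>D (x (Suc k)) - D (x k)\<bar>)" by (rule sum_abs)
    moreover have "(\<Sum>k<N. D (x (Suc k)) - D (x k)) = D (x N) - D (x 0)"
      by (rule sum_lessThan_telescope)
    moreover have "x N = t" "x 0 = 0" using N0 by (auto simp: x_def)
    ultimately show ?thesis by simp
  qed
  have "\<bar>D t - D 0\<bar> \<le> e" if e: "0 < e" for e
  proof -
    \<comment> \<open>The added 1 keeps the divisor positive when \<open>H t = H 0\<close>.\<close>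
    define h where "h = \<bar>H t - H 0\<bar> + 1"
    have h: "0 < h" by (simp add: h_def)
    have "\<bar>D t - D 0\<bar> \<le> e / h * (H t - H 0)" using key[of "e / h"] e h by simp
    also have "\<dots> \<le> e / h * h" using e h by (intro mult_left_mono) (auto simp: h_def)
    finally show ?thesis using h by simp
  qed
  then show ?thesis using field_le_epsilon[of "\<bar>D t - D 0\<bar>" 0] by simp
qed simp

text \<open>On a short interval the increment of \<open>F * G\<close> and the integral of the
  claimed integrand differ by at most an oscillation of \<open>F\<close> and \<open>G\<close>, small
  by uniform continuity, times the integral of \<open>\<bar>f\<bar> + \<bar>g\<bar>\<close> over
  that interval.\<close>

lemma integral_product_rule:
  fixes f g F G :: "real \<Rightarrow> real"
  assumes f: "integrable (lebesgue_on {0..T}) f" and g: "integrable (lebesgue_on {0..T}) g"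
    and F: "\<And>t. t \<in> {0..T} \<Longrightarrow> F t = F0 + integral {0..t} f"
    and G: "\<And>t. t \<in> {0..T} \<Longrightarrow> G t = G0 + integral {0..t} g"
    and t: "t \<in> {0..T}"
  shows "F t * G t = F0 * G0 + integral {0..t} (\<lambda>s. G s * f s + F s * g s)"
proof -
  have cF: "continuous_on {0..T} F"
    by (rule continuous_on_eq[OF continuous_on_indefinite_integral[OF f, of F0]]) (use F in simp)
  have cG: "continuous_on {0..T} G"
    by (rule continuous_on_eq[OF continuous_on_indefinite_integral[OF g, of G0]]) (use G in simp)
  have i1: "integrable (lebesgue_on {0..T}) (\<lambda>s. G s * f s + F s * g s)"
    by (intro Bochner_Integration.integrable_add integrable_continuous_mult f g cF cG)
  have i2: "integrable (lebesgue_on {0..T}) (\<lambda>s. \<bar>f s\<bar> + \<bar>g s\<bar>)"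
    using f g by (intro Bochner_Integration.integrable_add integrable_abs)
  define D where "D t = F t * G t - integral {0..t} (\<lambda>s. G s * f s + F s * g s)" for t
  define H where "H t = integral {0..t} (\<lambda>s. \<bar>f s\<bar> + \<bar>g s\<bar>)" for t
  have "D t = D 0"
  proof (rule constant_if_small_increments[OF _ t])
    fix \<eta> :: real assume \<eta>: "0 < \<eta>"
    have "uniformly_continuous_on {0..T} F" "uniformly_continuous_on {0..T} G"
      by (auto intro!: compact_uniformly_continuous cF cG)
    then obtain d1 d2 where d: "d1 > 0" "d2 > 0"
      and dF: "\<And>s t. s \<in> {0..T} \<Longrightarrow> t \<in> {0..T} \<Longrightarrow> \<bar>t - s\<bar> < d1 \<Longrightarrow> \<bar>F t - F s\<bar> < \<eta>"
      and dG: "\<And>s t. s \<in> {0..T} \<Longrightarrow> t \<in> {0..T} \<Longrightarrow> \<bar>t - s\<bar> < d2 \<Longrightarrow> \<bar>G t - G s\<bar> < \<eta>"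
      using \<eta> unfolding uniformly_continuous_on_def dist_real_def by metis
    show "\<exists>\<delta>>0. \<forall>s t. 0 \<le> s \<longrightarrow> s \<le> t \<longrightarrow> t \<le> T \<longrightarrow> t - s < \<delta> \<longrightarrow> \<bar>D t - D s\<bar> \<le> \<eta> * (H t - H s)"
    proof (intro exI[of _ "min d1 d2"] conjI allI impI)
      show "0 < min d1 d2" using d by simp
      fix s t assume st: "0 \<le> s" "s \<le> t" "t \<le> T" "t - s < min d1 d2"
      define h where "h r = G t * f r + F s * g r - (G r * f r + F r * g r)" for r
      have fi: "f integrable_on {s..t}" and gi: "g integrable_on {s..t}"
        using f g st by (auto intro: integrable_on_Icc)
      have "F t = F s + integral {s..t} f" "G t = G s + integral {s..t} g"
        using F[of t] F[of s] G[of t] G[of s] st integral_Icc_diff[OF f, of s t] integral_Icc_diff[OF g, of s t] by auto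
      \<comment> \<open>Freezing \<open>G\<close> at the right end and \<open>F\<close> at the left
        end makes this splitting exact, with no product of increments left over.\<close>
      then have "F t * G t - F s * G s = G t * integral {s..t} f + F s * integral {s..t} g"
        by (simp add: algebra_simps)
      also have "\<dots> = integral {s..t} (\<lambda>r. G t * f r + F s * g r)"
        using fi gi by (subst Henstock_Kurzweil_Integration.integral_add) (auto intro: integrable_on_mult_right)
      finally have "D t - D s = integral {s..t} (\<lambda>r. G t * f r + F s * g r)
          - integral {s..t} (\<lambda>r. G r * f r + F r * g r)"
        using integral_Icc_diff[OF i1 st(1-3)] by (simp add: D_def)
      also have "\<dots> = integral {s..t} h"
        unfolding h_def
      proof (rule Henstock_Kurzweil_Integration.integral_diff[symmetric])
        show "(\<lambda>r. G t * f r + F s * g r) integrable_on {s..t}"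
          by (intro Henstock_Kurzweil_Integration.integrable_add integrable_on_mult_right fi gi)
        show "(\<lambda>r. G r * f r + F r * g r) integrable_on {s..t}"
          by (rule integrable_on_Icc[OF i1]) (use st in auto)
      qed
      also have "\<bar>\<dots>\<bar> \<le> integral {s..t} (\<lambda>r. \<eta> * (\<bar>f r\<bar> + \<bar>g r\<bar>))"
      proof (rule integral_abs_le)
        show "integrable (lebesgue_on {0..T}) h" unfolding h_def
          by (intro Bochner_Integration.integrable_diff i1 Bochner_Integration.integrable_add)
            (use f g in auto)
        show "integrable (lebesgue_on {0..T}) (\<lambda>r. \<eta> * (\<bar>f r\<bar> + \<bar>g r\<bar>))" using i2 by simp
        fix r assume r: "s \<le> r" "r \<le> t"
        have "\<bar>G t - G r\<bar> \<le> \<eta>" "\<bar>F r - F s\<bar> \<le> \<eta>"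
          using dG[of r t] dF[of s r] r st by auto
        then have "\<bar>(G t - G r) * f r\<bar> + \<bar>(F s - F r) * g r\<bar> \<le> \<eta> * \<bar>f r\<bar> + \<eta> * \<bar>g r\<bar>"
          unfolding abs_mult by (intro add_mono mult_right_mono) auto
        moreover have "h r = (G t - G r) * f r + (F s - F r) * g r" by (simp add: h_def algebra_simps)
        ultimately show "\<bar>h r\<bar> \<le> \<eta> * (\<bar>f r\<bar> + \<bar>g r\<bar>)"
          using abs_triangle_ineq[of "(G t - G r) * f r" "(F s - F r) * g r"] by (simp add: distrib_left)
      qed (use st in auto)
      also have "\<dots> = \<eta> * (H t - H s)"
        using integral_Icc_diff[OF i2 st(1-3)] by (simp add: H_def)
      finally show "\<bar>D t - D s\<bar> \<le> \<eta> * (H t - H s)" .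
    qed
  qed
  moreover have "D 0 = F0 * G0" using F[of 0] G[of 0] t by (simp add: D_def)
  ultimately show ?thesis by (simp add: D_def)
qed

section \<open>Dominated integrands, measurability along trajectories, first-order
  remainders\<close>

lemma integrable_dominated:
  fixes h g :: "real \<Rightarrow> real"
  assumes "h \<in> borel_measurable (lebesgue_on {0..T})" "integrable (lebesgue_on {0..T}) g"
    and le: "\<And>t. t \<in> {0..T} \<Longrightarrow> \<bar>h t\<bar> \<le> g t"
  shows "integrable (lebesgue_on {0..T}) h"
proof (rule Bochner_Integration.integrable_bound[OF assms(2,1)])
  show "AE t in lebesgue_on {0..T}. norm (h t) \<le> norm (g t)"
  proof (rule AE_I2)
    fix t assume "t \<in> space (lebesgue_on {0..T})"
    then show "norm (h t) \<le> norm (g t)" using le[of t] by simp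
  qed
qed

lemma integrable_bounded_Icc:
  fixes h :: "real \<Rightarrow> real"
  assumes "h \<in> borel_measurable (lebesgue_on {0..T})" "\<And>t. t \<in> {0..T} \<Longrightarrow> \<bar>h t\<bar> \<le> B"
  shows "integrable (lebesgue_on {0..T}) h"
  by (rule integrable_dominated[OF assms(1) integrable_continuous_Icc[OF continuous_on_const] assms(2)])

lemma integral_add_Icc:
  fixes f g :: "real \<Rightarrow> real"
  assumes "integrable (lebesgue_on {0..T}) f" "integrable (lebesgue_on {0..T}) g" "t \<in> {0..T}"
  shows "integral {0..t} (\<lambda>s. f s + g s) = integral {0..t} f + integral {0..t} g"
  by (rule Henstock_Kurzweil_Integration.integral_add) (use assms in \<open>auto intro: integrable_on_Icc\<close>)

lemma integral_diff_Icc: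
  fixes f g :: "real \<Rightarrow> real"
  assumes "integrable (lebesgue_on {0..T}) f" "integrable (lebesgue_on {0..T}) g" "t \<in> {0..T}"
  shows "integral {0..t} (\<lambda>s. f s - g s) = integral {0..t} f - integral {0..t} g"
  by (rule Henstock_Kurzweil_Integration.integral_diff) (use assms in \<open>auto intro: integrable_on_Icc\<close>)

lemma integral_nonneg_mono_Icc:
  fixes f :: "real \<Rightarrow> real"
  assumes f: "integrable (lebesgue_on {0..T}) f" and t: "t \<in> {0..T}"
    and "\<And>s. s \<in> {0..T} \<Longrightarrow> 0 \<le> f s"
  shows "integral {0..t} f \<le> integral {0..T} f"
  by (rule integral_subset_le) (use assms in \<open>auto intro: integrable_on_Icc\<close>)

text \<open>Continuity of \<open>h\<close> is given on \<open>UNIV \<times> U\<close> only, so the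
  pair is regarded as a map into that subspace; hence \<open>w\<close> takes values in
  \<open>U\<close> at every time and not just at almost every time.\<close>

lemma borel_measurable_compose_cont:
  fixes h :: "real \<Rightarrow> real \<Rightarrow> real" and Y w :: "real \<Rightarrow> real"
  assumes h: "continuous_on (UNIV \<times> U) (\<lambda>(x, v). h x v)"
    and Y: "continuous_on {0..T} Y" and w: "w \<in> borel_measurable (lebesgue_on {0..T})"
    and wU: "\<And>t. t \<in> {0..T} \<Longrightarrow> w t \<in> U"
  shows "(\<lambda>t. h (Y t) (w t)) \<in> borel_measurable (lebesgue_on {0..T})"
proof -
  have "(\<lambda>t. (Y t, w t)) \<in> borel_measurable (lebesgue_on {0..T})"
    by (rule borel_measurable_Pair[OF borel_measurable_continuous_Icc[OF Y] w])
  then have "(\<lambda>t. (Y t, w t)) \<in> lebesgue_on {0..T} \<rightarrow>\<^sub>M restrict_space borel (UNIV \<times> U)"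
    by (rule measurable_restrict_space2[rotated]) (use wU in auto)
  from measurable_compose[OF this borel_measurable_continuous_on_restrict[OF h]]
  show ?thesis by simp
qed

lemma derivative_le_lipschitz:
  fixes h :: "real \<Rightarrow> real"
  assumes d: "(h has_real_derivative h') (at x)" and "0 < \<delta>"
    and lip: "\<And>y. \<bar>y - x\<bar> \<le> \<delta> \<Longrightarrow> \<bar>h y - h x\<bar> \<le> L * \<bar>y - x\<bar>"
  shows "\<bar>h'\<bar> \<le> L"
proof (rule tendsto_upperbound)
  have "((\<lambda>y. (h y - h x) / (y - x)) \<longlongrightarrow> h') (at x)"
    using d by (simp add: has_field_derivative_iff)
  then show "((\<lambda>y. \<bar>(h y - h x) / (y - x)\<bar>) \<longlongrightarrow> \<bar>h'\<bar>) (at x)" by (rule tendsto_rabs)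
  have "\<bar>(h y - h x) / (y - x)\<bar> \<le> L" if "y \<noteq> x" "dist y x < \<delta>" for y
    using lip[of y] that by (simp add: dist_real_def divide_simps abs_divide)
  then show "\<forall>\<^sub>F y in at x. \<bar>(h y - h x) / (y - x)\<bar> \<le> L"
    using \<open>0 < \<delta>\<close> by (auto simp: eventually_at)
qed simp

text \<open>Dominated convergence for the remainder divided by \<open>\<epsilon> m\<close>: at each
  time it tends to 0 by differentiability, since \<open>Y m t - X t\<close> is of order
  \<open>\<epsilon> m\<close>, and it is dominated by \<open>2 * C * k t\<close>. The domination is
  available once \<open>C * \<epsilon> m < \<delta>\<close>, whence the shift of the sequence by
  \<open>N\<close>.\<close>

lemma first_order_remainder:
  fixes h :: "real \<Rightarrow> real \<Rightarrow> real"
  assumes der: "\<And>t. t \<in> {0..T} \<Longrightarrow> (h t has_real_derivative h' t) (at (X t))"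
    and k: "integrable (lebesgue_on {0..T}) k" and \<delta>: "0 < \<delta>"
    and lip: "\<And>t y. t \<in> {0..T} \<Longrightarrow> \<bar>y - X t\<bar> \<le> \<delta> \<Longrightarrow> \<bar>h t y - h t (X t)\<bar> \<le> k t * \<bar>y - X t\<bar>"
    and z: "\<And>m t. t \<in> {0..T} \<Longrightarrow> \<bar>Y m t - X t\<bar> \<le> C * \<epsilon> m"
    and \<epsilon>: "\<And>m. 0 < \<epsilon> m" "\<epsilon> \<longlonglongrightarrow> 0"
    and meas: "\<And>m. (\<lambda>t. h t (Y m t) - h t (X t) - h' t * (Y m t - X t)) \<in> borel_measurable (lebesgue_on {0..T})"
  shows "(\<lambda>m. integral {0..T} (\<lambda>t. \<bar>h t (Y m t) - h t (X t) - h' t * (Y m t - X t)\<bar>) / \<epsilon> m) \<longlonglongrightarrow> 0"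
proof -
  define q where "q m t = h t (Y m t) - h t (X t) - h' t * (Y m t - X t)" for m t
  have h': "\<bar>h' t\<bar> \<le> k t" if "t \<in> {0..T}" for t
    by (rule derivative_le_lipschitz[OF der[OF that] \<delta> lip[OF that]])
  have "(\<lambda>m. C * \<epsilon> m) \<longlonglongrightarrow> C * 0" by (intro tendsto_intros \<epsilon>)
  then have "\<forall>\<^sub>F m in sequentially. C * \<epsilon> m < \<delta>" using \<delta> by (simp add: order_tendstoD(2))
  then obtain N where N: "\<And>m. m \<ge> N \<Longrightarrow> C * \<epsilon> m < \<delta>" by (auto simp: eventually_sequentially)
  have bound: "\<bar>q m t\<bar> \<le> 2 * C * \<epsilon> m * k t" if t: "t \<in> {0..T}" and m: "m \<ge> N" for m t
  proof -
    have z': "\<bar>Y m t - X t\<bar> \<le> C * \<epsilon> m" "\<bar>Y m t - X t\<bar> \<le> \<delta>" using z[OF t, of m] N[OF m] by auto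
    have k0: "0 \<le> k t" using h'[OF t] by simp
    have "\<bar>q m t\<bar> \<le> \<bar>h t (Y m t) - h t (X t)\<bar> + \<bar>h' t\<bar> * \<bar>Y m t - X t\<bar>"
      unfolding q_def by (metis abs_mult abs_triangle_ineq4)
    also have "\<dots> \<le> k t * \<bar>Y m t - X t\<bar> + k t * \<bar>Y m t - X t\<bar>"
      by (intro add_mono mult_right_mono lip t z' h') auto
    also have "\<dots> \<le> k t * (C * \<epsilon> m) + k t * (C * \<epsilon> m)"
      by (intro add_mono mult_left_mono z' k0)
    finally show ?thesis by (simp add: algebra_simps)
  qed
  have int: "integrable (lebesgue_on {0..T}) (q m)" if "m \<ge> N" for m
    by (rule integrable_dominated[where g = "\<lambda>t. 2 * C * \<epsilon> m * k t"])
      (use bound that k meas in \<open>auto simp: q_def[abs_def]\<close>)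
  have "(\<lambda>m. integral\<^sup>L (lebesgue_on {0..T}) (\<lambda>t. \<bar>q (m + N) t\<bar> / \<epsilon> (m + N))) \<longlonglongrightarrow> integral\<^sup>L (lebesgue_on {0..T}) (\<lambda>t. 0)"
  proof (rule integral_dominated_convergence)
    show "integrable (lebesgue_on {0..T}) (\<lambda>t. 2 * C * k t)" using k by simp
    show "(\<lambda>t. \<bar>q (m + N) t\<bar> / \<epsilon> (m + N)) \<in> borel_measurable (lebesgue_on {0..T})" for m
      using meas[of "m + N"] unfolding q_def by simp
    show "AE t in lebesgue_on {0..T}. norm (\<bar>q (m + N) t\<bar> / \<epsilon> (m + N)) \<le> 2 * C * k t" for m
    proof (rule AE_I2)
      fix t assume "t \<in> space (lebesgue_on {0..T})"
      then show "norm (\<bar>q (m + N) t\<bar> / \<epsilon> (m + N)) \<le> 2 * C * k t"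
        using bound[of t "m + N"] \<epsilon>(1)[of "m + N"] by (simp add: abs_divide divide_simps mult_ac)
    qed
    show "AE t in lebesgue_on {0..T}. (\<lambda>m. \<bar>q (m + N) t\<bar> / \<epsilon> (m + N)) \<longlonglongrightarrow> 0"
    proof (rule AE_I2)
      fix t assume "t \<in> space (lebesgue_on {0..T})"
      then have t: "t \<in> {0..T}" by simp
      have "C * \<epsilon> 0 \<ge> 0" using z[OF t, of 0] by linarith
      then have C0: "0 \<le> C" using \<epsilon>(1)[of 0] by (simp add: zero_le_mult_iff)
      have "(\<lambda>m. \<bar>q m t\<bar> / \<epsilon> m) \<longlonglongrightarrow> 0"
      proof (rule LIMSEQ_I)
        fix r :: real assume r: "0 < r"
        \<comment> \<open>The divisor \<open>C + 1\<close> also serves the case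
          \<open>C = 0\<close>.\<close>
        define e where "e = r / (C + 1)"
        have e: "0 < e" "e * C < r" using r C0 by (auto simp: e_def field_simps)
        from der[OF t] have "(h t has_derivative (\<lambda>y. h' t * y)) (at (X t))"
          by (simp add: has_field_derivative_def)
        then obtain d where d: "0 < d" and D: "\<And>y. \<bar>y - X t\<bar> < d \<Longrightarrow>
            \<bar>h t y - h t (X t) - h' t * (y - X t)\<bar> \<le> e * \<bar>y - X t\<bar>"
          using e(1) unfolding has_derivative_at_alt real_norm_def by blast
        have "(\<lambda>m. C * \<epsilon> m) \<longlonglongrightarrow> C * 0" by (intro tendsto_intros \<epsilon>)
        then have "\<forall>\<^sub>F m in sequentially. C * \<epsilon> m < d" using d by (simp add: order_tendstoD(2))
        then obtain N1 where N1: "\<And>m. m \<ge> N1 \<Longrightarrow> C * \<epsilon> m < d" by (auto simp: eventually_sequentially)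
        have "norm (\<bar>q m t\<bar> / \<epsilon> m - 0) < r" if m: "m \<ge> N1" for m
        proof -
          have "\<bar>q m t\<bar> \<le> e * \<bar>Y m t - X t\<bar>" unfolding q_def
            by (rule D) (use z[OF t, of m] N1[OF m] in linarith)
          also have "\<dots> \<le> e * (C * \<epsilon> m)" using e z[OF t] by (intro mult_left_mono) auto
          finally have "\<bar>q m t\<bar> / \<epsilon> m \<le> e * C" using \<epsilon>(1)[of m] by (simp add: divide_simps)
          then show ?thesis using e \<epsilon>(1)[of m] by simp
        qed
        then show "\<exists>no. \<forall>m\<ge>no. norm (\<bar>q m t\<bar> / \<epsilon> m - 0) < r" by blast
      qed
      then show "(\<lambda>m. \<bar>q (m + N) t\<bar> / \<epsilon> (m + N)) \<longlonglongrightarrow> 0" by (rule LIMSEQ_ignore_initial_segment)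
    qed
  qed simp
  moreover have "(\<lambda>m. integral\<^sup>L (lebesgue_on {0..T}) (\<lambda>t. \<bar>q (m + N) t\<bar> / \<epsilon> (m + N)))
      = (\<lambda>m. integral {0..T} (\<lambda>t. \<bar>q (m + N) t\<bar>) / \<epsilon> (m + N))"
    using int by (simp add: lebesgue_integral_eq_integral)
  moreover have "integral\<^sup>L (lebesgue_on {0..T}) (\<lambda>t. 0) = (0::real)" by simp
  ultimately have "(\<lambda>m. integral {0..T} (\<lambda>t. \<bar>q (m + N) t\<bar>) / \<epsilon> (m + N)) \<longlonglongrightarrow> 0"
    by (simp only:)
  then have "(\<lambda>m. integral {0..T} (\<lambda>t. \<bar>q m t\<bar>) / \<epsilon> m) \<longlonglongrightarrow> 0" by (rule LIMSEQ_offset)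
  then show "(\<lambda>m. integral {0..T} (\<lambda>t. \<bar>h t (Y m t) - h t (X t) - h' t * (Y m t - X t)\<bar>) / \<epsilon> m) \<longlonglongrightarrow> 0"
    by (simp add: q_def)
qed

section \<open>The control system\<close>

text \<open>Unlike in \<open>controls\<close>, the values lie in \<open>U\<close> at every time, so
  that hypotheses stated for \<open>v \<in> U\<close> apply pointwise, without null sets.\<close>

definition admissible :: "real \<Rightarrow> real set \<Rightarrow> (real \<Rightarrow> real) set" where
  "admissible T U = {w. w \<in> borel_measurable (lebesgue_on {0..T}) \<and> (\<forall>t\<in>{0..T}. w t \<in> U) \<and>
     integrable (lebesgue_on {0..T}) (\<lambda>t. (w t)\<^sup>2)}"

definition state_solution ::
    "real \<Rightarrow> real \<Rightarrow> (real \<Rightarrow> real \<Rightarrow> real) \<Rightarrow> (real \<Rightarrow> real) \<Rightarrow> (real \<Rightarrow> real) \<Rightarrow> bool" where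
  "state_solution T x0 b w Y \<longleftrightarrow> continuous_on {0..T} Y \<and>
     (\<forall>t\<in>{0..T}. Y t = x0 + integral {0..t} (\<lambda>s. b (Y s) (w s)))"

definition total_cost ::
    "real \<Rightarrow> (real \<Rightarrow> real \<Rightarrow> real) \<Rightarrow> (real \<Rightarrow> real) \<Rightarrow> (real \<Rightarrow> real) \<Rightarrow> (real \<Rightarrow> real) \<Rightarrow> real" where
  "total_cost T f \<Psi> w Y = integral {0..T} (\<lambda>t. f (Y t) (w t)) + \<Psi> (Y T)"

text \<open>\<open>b_bound\<close> is the pointwise form that the integral bound (A2) takes on
  constant controls; \<open>f_growth\<close> is what uniform continuity gives on a connected control
  set.\<close>

locale control_system =
  fixes T x0 c M K :: real and U :: "real set" and b f :: "real \<Rightarrow> real \<Rightarrow> real"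
  assumes T: "0 < T" and c: "0 < c"
    and b_cont: "continuous_on (UNIV \<times> U) (\<lambda>(x, v). b x v)"
    and b_lip: "\<And>x y v. v \<in> U \<Longrightarrow> \<bar>b x v - b y v\<bar> \<le> c * \<bar>x - y\<bar>"
    and b_bound: "\<And>v. v \<in> U \<Longrightarrow> \<bar>b 0 v\<bar> \<le> M"
    and b_der: "\<And>x v. v \<in> U \<Longrightarrow> ((\<lambda>y. b y v) has_real_derivative partial_x b x v) (at x)"
    and bx_cont: "continuous_on (UNIV \<times> U) (\<lambda>(x, v). partial_x b x v)"
    and f_uc: "uniformly_continuous_on (UNIV \<times> U) (\<lambda>(x, v). f x v)"
    and f_growth: "\<And>x v. v \<in> U \<Longrightarrow> \<bar>f x v\<bar> \<le> K * (1 + \<bar>x\<bar> + \<bar>v\<bar>)"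
    and f_der: "\<And>x v. v \<in> U \<Longrightarrow> ((\<lambda>y. f y v) has_real_derivative partial_x f x v) (at x)"
    and fx_cont: "continuous_on (UNIV \<times> U) (\<lambda>(x, v). partial_x f x v)"
begin

lemma admissibleD:
  assumes "w \<in> admissible T U"
  shows "w \<in> borel_measurable (lebesgue_on {0..T})" "\<And>t. t \<in> {0..T} \<Longrightarrow> w t \<in> U"
    "integrable (lebesgue_on {0..T}) (\<lambda>t. (w t)\<^sup>2)"
  using assms by (auto simp: admissible_def)

lemma f_cont: "continuous_on (UNIV \<times> U) (\<lambda>(x, v). f x v)"
  by (rule uniformly_continuous_imp_continuous[OF f_uc])

lemma measurable_along:
  assumes "w \<in> admissible T U" "continuous_on {0..T} Y"
  shows "(\<lambda>t. b (Y t) (w t)) \<in> borel_measurable (lebesgue_on {0..T})"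
    "(\<lambda>t. f (Y t) (w t)) \<in> borel_measurable (lebesgue_on {0..T})"
    "(\<lambda>t. partial_x b (Y t) (w t)) \<in> borel_measurable (lebesgue_on {0..T})"
    "(\<lambda>t. partial_x f (Y t) (w t)) \<in> borel_measurable (lebesgue_on {0..T})"
  using borel_measurable_compose_cont[OF _ assms(2) admissibleD(1,2)[OF assms(1)]]
    b_cont f_cont bx_cont fx_cont by blast+

lemma b_growth: "v \<in> U \<Longrightarrow> \<bar>b x v\<bar> \<le> M + c * \<bar>x\<bar>"
  using b_lip[of v x 0] b_bound[of v] by simp

lemma bounded_b_along:
  assumes "continuous_on {0..T} Y"
  obtains B where "0 \<le> B" "\<And>t v. t \<in> {0..T} \<Longrightarrow> v \<in> U \<Longrightarrow> \<bar>b (Y t) v\<bar> \<le> B"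
proof -
  obtain B where B: "0 \<le> B" "\<And>t. t \<in> {0..T} \<Longrightarrow> \<bar>Y t\<bar> \<le> B" by (rule continuous_on_Icc_bound[OF assms]) blast
  show ?thesis
  proof (rule that[of "\<bar>M\<bar> + c * B"])
    show "0 \<le> \<bar>M\<bar> + c * B" using B c by simp
    fix t v assume t: "t \<in> {0..T}" and v: "v \<in> U"
    have "c * \<bar>Y t\<bar> \<le> c * B" using c B(2)[OF t] by simp
    then show "\<bar>b (Y t) v\<bar> \<le> \<bar>M\<bar> + c * B" using b_growth[OF v, of "Y t"] by linarith
  qed
qed

lemma integrable_b_along:
  assumes "w \<in> admissible T U" "continuous_on {0..T} Y"
  shows "integrable (lebesgue_on {0..T}) (\<lambda>t. b (Y t) (w t))"
proof -
  obtain B where B: "\<And>t v. t \<in> {0..T} \<Longrightarrow> v \<in> U \<Longrightarrow> \<bar>b (Y t) v\<bar> \<le> B"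
    by (rule bounded_b_along[OF assms(2)]) blast
  show ?thesis
    by (rule integrable_bounded_Icc[OF measurable_along(1)[OF assms] B])
      (use admissibleD(2)[OF assms(1)] in auto)
qed

text \<open>Linear growth in the control is controlled by the square through
  \<open>\<bar>w t\<bar> \<le> 1 + (w t)^2\<close>, so square integrability of \<open>w\<close>
  makes the running cost finite.\<close>

lemma integrable_f_along:
  assumes "w \<in> admissible T U" "continuous_on {0..T} Y"
  shows "integrable (lebesgue_on {0..T}) (\<lambda>t. f (Y t) (w t))"
proof (rule integrable_dominated[OF measurable_along(2)[OF assms]])
  show "integrable (lebesgue_on {0..T}) (\<lambda>t. \<bar>K\<bar> * (2 + \<bar>Y t\<bar> + (w t)\<^sup>2))"
    by (intro integrable_mult_right Bochner_Integration.integrable_add integrable_continuous_Icc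
        continuous_intros assms(2) admissibleD(3)[OF assms(1)])
  fix t assume t: "t \<in> {0..T}"
  have "0 \<le> (\<bar>w t\<bar> - 1)\<^sup>2" by simp
  then have w: "\<bar>w t\<bar> \<le> 1 + (w t)\<^sup>2" by (auto simp: power2_eq_square algebra_simps)
  have "\<bar>f (Y t) (w t)\<bar> \<le> K * (1 + \<bar>Y t\<bar> + \<bar>w t\<bar>)" by (rule f_growth[OF admissibleD(2)[OF assms(1) t]])
  also have "\<dots> \<le> \<bar>K\<bar> * (2 + \<bar>Y t\<bar> + (w t)\<^sup>2)" using w by (intro mult_mono) auto
  finally show "\<bar>f (Y t) (w t)\<bar> \<le> \<bar>K\<bar> * (2 + \<bar>Y t\<bar> + (w t)\<^sup>2)" .
qed

lemma state_solution_exists: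
  assumes "w \<in> admissible T U"
  shows "\<exists>Y. state_solution T x0 b w Y"
proof (rule caratheodory_solution_exists[of c T "\<lambda>s x. b x (w s)" x0])
  fix Y :: "real \<Rightarrow> real" assume "continuous_on {0..T} Y"
    "\<And>t. t \<in> {0..T} \<Longrightarrow> Y t = x0 + integral {0..t} (\<lambda>s. b (Y s) (w s))"
  then show ?thesis unfolding state_solution_def by blast
qed (use c b_lip integrable_b_along[OF assms] admissibleD(2)[OF assms] in auto)

text \<open>Spike variations, the convexity argument and the localisation in time all use switches
  of this kind.\<close>

lemma admissible_switch:
  assumes w: "w \<in> admissible T U" and v: "v \<in> admissible T U" and L: "L \<in> sets lebesgue"
  shows "(\<lambda>t. if t \<in> L then w t else v t) \<in> admissible T U"
proof -
  have m: "(\<lambda>t. if t \<in> L then w t else v t) \<in> borel_measurable (lebesgue_on {0..T})"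
  proof (rule measurable_If_set[OF admissibleD(1)[OF w] admissibleD(1)[OF v]])
    show "L \<inter> space (lebesgue_on {0..T}) \<in> sets (lebesgue_on {0..T})"
      using L by (simp add: sets_restrict_space_iff sets.Int)
  qed
  moreover have "integrable (lebesgue_on {0..T}) (\<lambda>t. (if t \<in> L then w t else v t)\<^sup>2)"
    by (rule integrable_dominated[where g = "\<lambda>t. (w t)\<^sup>2 + (v t)\<^sup>2"])
      (use m admissibleD(3)[OF w] admissibleD(3)[OF v] in auto)
  ultimately show ?thesis
    using admissibleD(2)[OF w] admissibleD(2)[OF v] by (auto simp: admissible_def)
qed

end

section \<open>First-order expansion along spike variations\<close>

lemma borel_measurable_indicator_Icc:
  assumes "L \<in> sets lebesgue"
  shows "(indicator L :: real \<Rightarrow> real) \<in> borel_measurable (lebesgue_on {0..T})"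
  using borel_measurable_indicator[OF assms] by (rule measurable_restrict_space1)

lemma integrable_indicator_mult:
  fixes g :: "real \<Rightarrow> real"
  assumes "L \<in> sets lebesgue" "integrable (lebesgue_on {0..T}) g"
  shows "integrable (lebesgue_on {0..T}) (\<lambda>s. indicator L s * g s)"
  by (rule integrable_bounded_mult[OF assms(2) borel_measurable_indicator_Icc[OF assms(1)], of 1])
    (auto simp: indicator_def)

lemma integral_if_Icc:
  fixes g :: "real \<Rightarrow> real"
  assumes "t \<in> {0..T}"
  shows "integral {0..T} (\<lambda>s. if s \<in> {0..t} then g s else 0) = integral {0..t} g"
proof -
  have "{0..t} \<inter> {0..T} = {0..t}" using assms by auto
  then show ?thesis by (simp only: integral_restrict_Int)
qed

lemma proportional_indicator:
  fixes G :: "(real \<Rightarrow> real) set"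
  assumes G: "finite G" "\<And>g. g \<in> G \<Longrightarrow> integrable (lebesgue_on {0..T}) g"
    and a: "0 \<le> a" "a \<le> 1" and e: "0 < e"
  shows "\<exists>L\<in>sets lebesgue. \<forall>g\<in>G. \<bar>integral {0..T} (\<lambda>s. indicator L s * g s) - a * integral {0..T} g\<bar> \<le> e"
proof (rule proportional_subset[of G "\<lambda>g. g" T a e, OF G(1) _ a e])
  show "g integrable_on {0..T}" if "g \<in> G" for g by (rule integrable_on_Icc[OF G(2)[OF that]]) auto
  fix L assume L: "L \<in> sets borel" "L \<subseteq> {0..T}"
    and close: "\<And>g. g \<in> G \<Longrightarrow> \<bar>integral L g - a * integral {0..T} g\<bar> \<le> e"
  have "integral {0..T} (\<lambda>s. indicator L s * g s) = integral L g" for g :: "real \<Rightarrow> real"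
  proof -
    have "(\<lambda>s. indicator L s * g s) = (\<lambda>s. if s \<in> L then g s else 0)" by (auto simp: indicator_def)
    then show ?thesis using L(2) by (simp add: integral_restrict_Int Int_absorb2)
  qed
  note restrict = this
  have "L \<in> sets lebesgue" using L(1) by (simp add: sets_completionI_sets)
  then show ?thesis by (rule bexI[rotated]) (simp add: restrict close)
qed

text \<open>\<open>Phi\<close> is the fundamental solution of the state equation linearised along
  the reference pair, and \<open>Theta\<close> that of the equation with the opposite sign.
  \<open>k\<close> bounds f_x in a tube of radius \<open>\<delta>\<close> around \<open>X\<close>;
  \<open>Psi\<close> is the terminal cost and \<open>\<kappa>\<close> its slope at
  \<open>X T\<close>.\<close>

locale reference_pair = control_system +
  fixes u X k Phi Theta Psi :: "real \<Rightarrow> real" and \<delta> \<kappa> :: real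
  assumes u: "u \<in> admissible T U" and X: "state_solution T x0 b u X"
    and \<delta>: "0 < \<delta>" and k_int: "integrable (lebesgue_on {0..T}) k"
    and k_dom: "\<And>t x. t \<in> {0..T} \<Longrightarrow> \<bar>x - X t\<bar> \<le> \<delta> \<Longrightarrow> \<bar>partial_x f x (u t)\<bar> \<le> k t"
    and Phi: "continuous_on {0..T} Phi"
      "\<And>t. t \<in> {0..T} \<Longrightarrow> Phi t = 1 + integral {0..t} (\<lambda>s. partial_x b (X s) (u s) * Phi s)"
    and Theta: "continuous_on {0..T} Theta"
      "\<And>t. t \<in> {0..T} \<Longrightarrow> Theta t = 1 + integral {0..t} (\<lambda>s. - partial_x b (X s) (u s) * Theta s)"
    and Psi: "(Psi has_real_derivative \<kappa>) (at (X T))"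
begin

definition a where "a t = partial_x b (X t) (u t)"
definition d where "d t = partial_x f (X t) (u t)"
text \<open>A unit perturbation of the state at time \<open>t\<close> becomes
  \<open>Theta t * Phi s\<close> at time \<open>s\<close>; hence \<open>Theta t * Q t\<close> is its
  first-order effect on the remaining running cost.\<close>

definition Q where "Q t = integral {t..T} (\<lambda>s. d s * Phi s)"
definition \<eta> where "\<eta> w t = b (X t) (w t) - b (X t) (u t)"
definition \<zeta> where "\<zeta> w t = f (X t) (w t) - f (X t) (u t)"

lemma X_cont: "continuous_on {0..T} X" using X by (simp add: state_solution_def)

lemma a_meas: "a \<in> borel_measurable (lebesgue_on {0..T})"
  unfolding a_def[abs_def] by (rule measurable_along(3)[OF u X_cont])

lemma a_bound: "t \<in> {0..T} \<Longrightarrow> \<bar>a t\<bar> \<le> c"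
  unfolding a_def
  by (rule derivative_le_lipschitz[OF b_der zero_less_one b_lip]) (use admissibleD(2)[OF u] in auto)

lemma integrable_a_mult:
  assumes "continuous_on {0..T} Y"
  shows "integrable (lebesgue_on {0..T}) (\<lambda>t. a t * Y t)"
  by (rule integrable_bounded_mult[OF integrable_continuous_Icc[OF assms] a_meas a_bound])

lemma d_meas: "d \<in> borel_measurable (lebesgue_on {0..T})"
  unfolding d_def[abs_def] by (rule measurable_along(4)[OF u X_cont])

lemma d_bound: "t \<in> {0..T} \<Longrightarrow> \<bar>d t\<bar> \<le> k t"
  unfolding d_def by (rule k_dom) (use \<delta> in auto)

lemma d_int: "integrable (lebesgue_on {0..T}) d"
  by (rule integrable_dominated[OF d_meas k_int d_bound])

text \<open>In the product rule the two terms cancel, so the product keeps its initial value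
  1.\<close>

lemma Phi_Theta: "t \<in> {0..T} \<Longrightarrow> Phi t * Theta t = 1"
proof -
  assume t: "t \<in> {0..T}"
  have "Phi t * Theta t = 1 * 1 + integral {0..t} (\<lambda>s. Theta s * (a s * Phi s) + Phi s * (- a s * Theta s))"
  proof (rule integral_product_rule[OF integrable_a_mult[OF Phi(1)] _ _ _ t])
    show "integrable (lebesgue_on {0..T}) (\<lambda>s. - a s * Theta s)"
      using integrable_a_mult[OF Theta(1)] by simp
  qed (use Phi(2) Theta(2) in \<open>simp_all add: a_def\<close>)
  also have "(\<lambda>s. Theta s * (a s * Phi s) + Phi s * (- a s * Theta s)) = (\<lambda>s. 0)" by (simp add: algebra_simps)
  finally show ?thesis by simp
qed

lemma d_Phi_int: "integrable (lebesgue_on {0..T}) (\<lambda>t. d t * Phi t)"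
  using integrable_continuous_mult[OF d_int Phi(1)] by (simp add: mult.commute)

lemma Q_eq: "t \<in> {0..T} \<Longrightarrow> Q t = Q 0 + integral {0..t} (\<lambda>s. - (d s * Phi s))"
  using integral_Icc_diff[OF d_Phi_int, of t T] by (simp add: Q_def)

lemma Q_cont: "continuous_on {0..T} Q"
  by (rule continuous_on_eq[OF continuous_on_indefinite_integral[of T "\<lambda>s. - (d s * Phi s)" "Q 0"]
        Q_eq[symmetric]]) (simp_all add: d_Phi_int)

lemma \<eta>_int: "w \<in> admissible T U \<Longrightarrow> integrable (lebesgue_on {0..T}) (\<eta> w)"
  unfolding \<eta>_def[abs_def] by (intro Bochner_Integration.integrable_diff integrable_b_along X_cont u)

lemma \<zeta>_int: "w \<in> admissible T U \<Longrightarrow> integrable (lebesgue_on {0..T}) (\<zeta> w)"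
  unfolding \<zeta>_def[abs_def] by (intro Bochner_Integration.integrable_diff integrable_f_along X_cont u)

text \<open>The drift along \<open>X\<close> is bounded uniformly over \<open>U\<close>, so its jump
  is bounded even when the controls are unbounded.\<close>

lemma \<eta>_bound:
  assumes "w \<in> admissible T U"
  obtains D where "0 \<le> D" "\<And>t. t \<in> {0..T} \<Longrightarrow> \<bar>\<eta> w t\<bar> \<le> D"
proof (rule bounded_b_along[OF X_cont])
  fix B assume B: "0 \<le> B" "\<And>t v. t \<in> {0..T} \<Longrightarrow> v \<in> U \<Longrightarrow> \<bar>b (X t) v\<bar> \<le> B"
  have "\<bar>\<eta> w t\<bar> \<le> 2 * B" if "t \<in> {0..T}" for t
    using B(2)[OF that admissibleD(2)[OF u that]] B(2)[OF that admissibleD(2)[OF assms that]]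
    unfolding \<eta>_def by linarith
  then show ?thesis using that[of "2 * B"] B(1) by simp
qed

end

text \<open>The functions listed in \<open>close\<close> are those whose integrals over
  \<open>L m\<close> occur: the constant for its measure, \<open>k\<close> for the bound on f_x
  there, and the densities of the cost and state changes. The latter are cut off at each
  \<open>\<tau> \<in> J\<close>, so that integrals up to \<open>\<tau>\<close> become integrals over
  [0,T].\<close>

locale spike_variation = reference_pair +
  fixes w :: "real \<Rightarrow> real" and J L v Y and \<epsilon> :: "nat \<Rightarrow> real"
  assumes w: "w \<in> admissible T U" and J: "finite J" "J \<subseteq> {0..T}" "T \<in> J"
    and \<epsilon>: "\<And>m. 0 < \<epsilon> m" "\<And>m. \<epsilon> m \<le> 1" "\<epsilon> \<longlonglongrightarrow> 0"
    and L: "\<And>m. L m \<in> sets lebesgue"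
    and close: "\<And>m g. g \<in> {\<lambda>_. 1, k, \<lambda>s. Theta s * Q s * \<eta> w s, \<zeta> w} \<union>
        (\<lambda>\<tau> s. if s \<in> {0..\<tau>} then Theta s * \<eta> w s else 0) ` J \<Longrightarrow>
        \<bar>integral {0..T} (\<lambda>s. indicator (L m) s * g s) - \<epsilon> m * integral {0..T} g\<bar> \<le> \<epsilon> m * \<epsilon> m"
    and v_def: "\<And>m. v m = (\<lambda>t. if t \<in> L m then w t else u t)"
    and Y: "\<And>m. state_solution T x0 b (v m) (Y m)"
begin

definition z where "z m t = Y m t - X t"
text \<open>The forcing term with which the deviation \<open>z\<close> solves the linearised
  equation exactly; \<open>r\<close> is what remains of it after the direct effect of switching to
  \<open>w\<close>.\<close>

definition \<sigma> where "\<sigma> m t = b (Y m t) (v m t) - b (X t) (u t) - a t * z m t"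
definition r where "r m t = \<sigma> m t - indicator (L m) t * \<eta> w t"

lemma v: "v m \<in> admissible T U"
  unfolding v_def by (rule admissible_switch[OF w u L])

lemma Y_cont: "continuous_on {0..T} (Y m)" using Y by (simp add: state_solution_def)

lemma z_cont: "continuous_on {0..T} (z m)"
  unfolding z_def[abs_def] by (intro continuous_intros Y_cont X_cont)

lemma lane_limit:
  assumes "g \<in> {\<lambda>_. 1, k, \<lambda>s. Theta s * Q s * \<eta> w s, \<zeta> w} \<union>
        (\<lambda>\<tau> s. if s \<in> {0..\<tau>} then Theta s * \<eta> w s else 0) ` J"
  shows "(\<lambda>m. integral {0..T} (\<lambda>s. indicator (L m) s * g s) / \<epsilon> m) \<longlonglongrightarrow> integral {0..T} g"
proof -
  have "(\<lambda>m. integral {0..T} (\<lambda>s. indicator (L m) s * g s) / \<epsilon> m - integral {0..T} g) \<longlonglongrightarrow> 0"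
  proof (rule Lim_null_comparison[OF always_eventually \<epsilon>(3)], rule allI)
    fix m
    have "integral {0..T} (\<lambda>s. indicator (L m) s * g s) / \<epsilon> m - integral {0..T} g
        = (integral {0..T} (\<lambda>s. indicator (L m) s * g s) - \<epsilon> m * integral {0..T} g) / \<epsilon> m"
      using \<epsilon>(1)[of m] by (simp add: diff_divide_distrib)
    then show "norm (integral {0..T} (\<lambda>s. indicator (L m) s * g s) / \<epsilon> m - integral {0..T} g) \<le> \<epsilon> m"
      using close[OF assms, of m] \<epsilon>(1)[of m] by (simp add: abs_divide divide_simps mult.commute)
  qed
  then show ?thesis by (rule LIM_zero_cancel)
qed

text \<open>The test function 1 gives \<open>\<epsilon> m * T\<close> up to
  \<open>\<epsilon> m * \<epsilon> m\<close>, and the latter is at most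
  \<open>\<epsilon> m\<close>.\<close>

lemma lane_le:
  "integral {0..T} (\<lambda>s. indicator (L m) s) \<le> (T + 1) * \<epsilon> m"
proof -
  have "\<bar>integral {0..T} (\<lambda>s. indicator (L m) s * 1) - \<epsilon> m * integral {0..T} (\<lambda>_. 1)\<bar> \<le> \<epsilon> m * \<epsilon> m"
    by (rule close) simp
  moreover have "\<epsilon> m * \<epsilon> m \<le> \<epsilon> m * 1" using \<epsilon>(1,2)[of m] by (intro mult_left_mono) auto
  ultimately show ?thesis using T by (simp add: algebra_simps)
qed

lemma ind_int: "integrable (lebesgue_on {0..T}) (indicator (L m) :: real \<Rightarrow> real)"
  using integrable_indicator_mult[OF L[of m] integrable_continuous_Icc[of T "\<lambda>_. 1"]] by simp

lemma z_eq: "t \<in> {0..T} \<Longrightarrow> z m t = 0 + integral {0..t} (\<lambda>s. a s * z m s + \<sigma> m s)"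
  using X Y[of m] integral_diff_Icc[OF integrable_b_along[OF v[of m] Y_cont[of m]] integrable_b_along[OF u X_cont], of t]
  by (simp add: \<sigma>_def z_def state_solution_def)

lemma b_bracket:
  assumes t: "t \<in> {0..T}"
  shows "\<bar>b (Y m t) (v m t) - b (X t) (u t)\<bar> \<le> c * \<bar>z m t\<bar> + indicator (L m) t * \<bar>\<eta> w t\<bar>"
proof -
  have "\<bar>b (Y m t) (v m t) - b (X t) (v m t)\<bar> \<le> c * \<bar>z m t\<bar>"
    unfolding z_def by (rule b_lip) (rule admissibleD(2)[OF v t])
  moreover have "\<bar>b (X t) (v m t) - b (X t) (u t)\<bar> = indicator (L m) t * \<bar>\<eta> w t\<bar>"
    by (simp add: v_def \<eta>_def)
  ultimately show ?thesis by linarith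
qed

text \<open>Gronwall's inequality with the Lipschitz constant of the drift: the forcing is at most
  the bound \<open>D\<close> of \<open>\<eta>\<close> times the measure of \<open>L m\<close>, hence
  of order \<open>\<epsilon> m\<close>.\<close>

lemma z_bound: "\<exists>C\<ge>0. \<forall>m. \<forall>t\<in>{0..T}. \<bar>z m t\<bar> \<le> C * \<epsilon> m"
proof (rule \<eta>_bound[OF w])
  fix D assume D: "0 \<le> D" "\<And>t. t \<in> {0..T} \<Longrightarrow> \<bar>\<eta> w t\<bar> \<le> D"
  define C where "C = 2 * (D * (T + 1)) * exp (2 * c * T)"
  have "\<bar>z m t\<bar> \<le> C * \<epsilon> m" if t: "t \<in> {0..T}" for m t
  proof -
    have "\<bar>z m t\<bar> \<le> 2 * (D * (T + 1) * \<epsilon> m) * exp (2 * c * T)"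
    proof (rule gronwall[OF z_cont c _ _ t])
      show "0 \<le> D * (T + 1) * \<epsilon> m" using D(1) T \<epsilon>(1)[of m] by simp
      fix t assume t: "t \<in> {0..T}"
      have i1: "integrable (lebesgue_on {0..T}) (\<lambda>s. c * \<bar>z m s\<bar>)"
        by (intro integrable_continuous_Icc continuous_intros z_cont)
      have i2: "integrable (lebesgue_on {0..T}) (\<lambda>s. D * indicator (L m) s)"
        by (intro integrable_mult_right ind_int)
      have "z m t = integral {0..t} (\<lambda>s. b (Y m s) (v m s) - b (X s) (u s))"
        using z_eq[OF t, of m] by (simp add: \<sigma>_def)
      also have "\<bar>\<dots>\<bar> \<le> integral {0..t} (\<lambda>s. c * \<bar>z m s\<bar> + D * indicator (L m) s)"
      proof (rule integral_abs_le[of T])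
        show "integrable (lebesgue_on {0..T}) (\<lambda>s. b (Y m s) (v m s) - b (X s) (u s))"
          by (intro Bochner_Integration.integrable_diff integrable_b_along v u X_cont Y_cont)
        fix s assume "0 \<le> s" "s \<le> t"
        then have s: "s \<in> {0..T}" using t by simp
        have "indicator (L m) s * \<bar>\<eta> w s\<bar> \<le> D * indicator (L m) s"
          using D(2)[OF s] by (simp add: indicator_def)
        then show "\<bar>b (Y m s) (v m s) - b (X s) (u s)\<bar> \<le> c * \<bar>z m s\<bar> + D * indicator (L m) s"
          using b_bracket[OF s, of m] by linarith
      qed (use t i1 i2 in auto)
      also have "\<dots> = c * integral {0..t} (\<lambda>s. \<bar>z m s\<bar>) + D * integral {0..t} (indicator (L m))"
        using integral_add_Icc[OF i1 i2 t] by simp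
      also have "D * integral {0..t} (indicator (L m)) \<le> D * integral {0..T} (indicator (L m))"
        by (intro mult_left_mono integral_nonneg_mono_Icc ind_int t D) simp
      also have "\<dots> \<le> D * ((T + 1) * \<epsilon> m)" by (intro mult_left_mono lane_le D)
      finally show "\<bar>z m t\<bar> \<le> D * (T + 1) * \<epsilon> m + c * integral {0..t} (\<lambda>s. \<bar>z m s\<bar>)"
        by (simp add: mult_ac)
    qed
    then show ?thesis by (simp add: C_def mult_ac)
  qed
  moreover have "0 \<le> C" using D(1) T by (simp add: C_def)
  ultimately show ?thesis by blast
qed

lemma \<sigma>_int: "integrable (lebesgue_on {0..T}) (\<sigma> m)"
  unfolding \<sigma>_def[abs_def]
  by (intro Bochner_Integration.integrable_diff integrable_b_along v u X_cont Y_cont integrable_a_mult z_cont)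

lemma r_int: "integrable (lebesgue_on {0..T}) (r m)"
  unfolding r_def[abs_def]
  by (intro Bochner_Integration.integrable_diff \<sigma>_int integrable_indicator_mult L \<eta>_int w)

text \<open>Off \<open>L m\<close> the function \<open>r m\<close> is the first-order remainder
  \<open>q m\<close> at the control \<open>u\<close>, negligible by dominated convergence. On
  \<open>L m\<close> it is at most \<open>2 * c * C * \<epsilon> m\<close>, and the measure of
  \<open>L m\<close> contributes another factor of order \<open>\<epsilon> m\<close>.\<close>

lemma r_limit: "(\<lambda>m. integral {0..T} (\<lambda>t. \<bar>r m t\<bar>) / \<epsilon> m) \<longlonglongrightarrow> 0"
proof -
  obtain C where C: "0 \<le> C" "\<And>m t. t \<in> {0..T} \<Longrightarrow> \<bar>z m t\<bar> \<le> C * \<epsilon> m" using z_bound by blast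
  define q where "q m t = b (Y m t) (u t) - b (X t) (u t) - a t * (Y m t - X t)" for m t
  have q_int: "integrable (lebesgue_on {0..T}) (q m)" for m
    using integrable_a_mult[OF z_cont[of m]] unfolding q_def[abs_def] z_def
    by (intro Bochner_Integration.integrable_diff integrable_b_along u X_cont Y_cont)
  have lim: "(\<lambda>m. integral {0..T} (\<lambda>t. \<bar>q m t\<bar>) / \<epsilon> m) \<longlonglongrightarrow> 0"
    unfolding q_def
  proof (rule first_order_remainder[where h = "\<lambda>t y. b y (u t)" and k = "\<lambda>_. c" and \<delta> = 1 and C = C])
    show "((\<lambda>y. b y (u t)) has_real_derivative a t) (at (X t))" if "t \<in> {0..T}" for t
      unfolding a_def by (rule b_der[OF admissibleD(2)[OF u that]])
    show "\<bar>Y m t - X t\<bar> \<le> C * \<epsilon> m" if "t \<in> {0..T}" for m t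
      using C(2)[OF that, of m] by (simp add: z_def)
    show "(\<lambda>t. b (Y m t) (u t) - b (X t) (u t) - a t * (Y m t - X t)) \<in> borel_measurable (lebesgue_on {0..T})" for m
      using borel_measurable_integrable[OF q_int] by (simp add: q_def[abs_def])
  qed (use b_lip admissibleD(2)[OF u] \<epsilon> in \<open>auto intro: integrable_continuous_Icc\<close>)
  have bound: "\<bar>r m t\<bar> \<le> 2 * c * C * \<epsilon> m * indicator (L m) t + \<bar>q m t\<bar>" if t: "t \<in> {0..T}" for m t
  proof (cases "t \<in> L m")
    case True
    have "\<bar>b (Y m t) (w t) - b (X t) (w t)\<bar> \<le> c * \<bar>z m t\<bar>"
      unfolding z_def by (rule b_lip[OF admissibleD(2)[OF w t]])
    moreover have "\<bar>a t * z m t\<bar> \<le> c * \<bar>z m t\<bar>"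
      unfolding abs_mult by (intro mult_right_mono a_bound t) simp
    moreover have "c * \<bar>z m t\<bar> \<le> c * (C * \<epsilon> m)" using c C(2)[OF t, of m] by simp
    moreover have "r m t = b (Y m t) (w t) - b (X t) (w t) - a t * z m t"
      using True by (simp add: r_def \<sigma>_def v_def \<eta>_def)
    ultimately have "\<bar>r m t\<bar> \<le> 2 * (c * (C * \<epsilon> m))" by linarith
    then show ?thesis using True by (simp add: mult.assoc)
  next
    case False
    then show ?thesis by (simp add: r_def \<sigma>_def v_def q_def z_def)
  qed
  show ?thesis
  proof (rule Lim_null_comparison)
    show "\<forall>\<^sub>F m in sequentially. norm (integral {0..T} (\<lambda>t. \<bar>r m t\<bar>) / \<epsilon> m)
        \<le> 2 * c * C * ((T + 1) * \<epsilon> m) + integral {0..T} (\<lambda>t. \<bar>q m t\<bar>) / \<epsilon> m"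
    proof (rule always_eventually, rule allI)
      fix m
      have i: "integrable (lebesgue_on {0..T}) (\<lambda>t. 2 * c * C * \<epsilon> m * indicator (L m) t)"
        by (intro integrable_mult_right ind_int)
      have T': "T \<in> {0..T}" using T by simp
      have "\<bar>integral {0..T} (\<lambda>t. \<bar>r m t\<bar>)\<bar> \<le> integral {0..T} (\<lambda>t. 2 * c * C * \<epsilon> m * indicator (L m) t + \<bar>q m t\<bar>)"
        by (rule integral_abs_le[of T]) (use r_int q_int i bound T in auto)
      also have "\<dots> = 2 * c * C * \<epsilon> m * integral {0..T} (indicator (L m)) + integral {0..T} (\<lambda>t. \<bar>q m t\<bar>)"
        using integral_add_Icc[OF i integrable_abs[OF q_int] T'] by simp
      also have "\<dots> \<le> 2 * c * C * \<epsilon> m * ((T + 1) * \<epsilon> m) + integral {0..T} (\<lambda>t. \<bar>q m t\<bar>)"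
        using c C(1) \<epsilon>(1)[of m] by (intro add_right_mono mult_left_mono lane_le) auto
      finally show "norm (integral {0..T} (\<lambda>t. \<bar>r m t\<bar>) / \<epsilon> m)
        \<le> 2 * c * C * ((T + 1) * \<epsilon> m) + integral {0..T} (\<lambda>t. \<bar>q m t\<bar>) / \<epsilon> m"
        using \<epsilon>(1)[of m] by (simp add: abs_divide divide_simps mult_ac)
    qed
    have "(\<lambda>m. 2 * c * C * ((T + 1) * \<epsilon> m) + integral {0..T} (\<lambda>t. \<bar>q m t\<bar>) / \<epsilon> m) \<longlonglongrightarrow> 2 * c * C * ((T + 1) * 0) + 0"
      by (intro tendsto_intros \<epsilon> lim)
    then show "(\<lambda>m. 2 * c * C * ((T + 1) * \<epsilon> m) + integral {0..T} (\<lambda>t. \<bar>q m t\<bar>) / \<epsilon> m) \<longlonglongrightarrow> 0" by simp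
  qed
qed

lemma weighted_r_limit:
  assumes g: "continuous_on {0..T} g" and t: "t \<in> {0..T}"
  shows "(\<lambda>m. integral {0..t} (\<lambda>s. g s * r m s) / \<epsilon> m) \<longlonglongrightarrow> 0"
proof -
  obtain B where B: "0 \<le> B" "\<And>s. s \<in> {0..T} \<Longrightarrow> \<bar>g s\<bar> \<le> B" by (rule continuous_on_Icc_bound[OF g]) blast
  show ?thesis
  proof (rule Lim_null_comparison[OF always_eventually], rule allI)
    fix m
    have "\<bar>integral {0..t} (\<lambda>s. g s * r m s)\<bar> \<le> integral {0..t} (\<lambda>s. B * \<bar>r m s\<bar>)"
    proof (rule integral_abs_le[OF integrable_continuous_mult[OF r_int g]])
      show "integrable (lebesgue_on {0..T}) (\<lambda>s. B * \<bar>r m s\<bar>)" using r_int by auto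
      fix s assume "0 \<le> s" "s \<le> t"
      then show "\<bar>g s * r m s\<bar> \<le> B * \<bar>r m s\<bar>"
        using t unfolding abs_mult by (intro mult_right_mono B) auto
    qed (use t in auto)
    also have "\<dots> \<le> integral {0..T} (\<lambda>s. B * \<bar>r m s\<bar>)"
      by (rule integral_nonneg_mono_Icc[OF _ t]) (use r_int B in auto)
    finally show "norm (integral {0..t} (\<lambda>s. g s * r m s) / \<epsilon> m) \<le> B * (integral {0..T} (\<lambda>t. \<bar>r m t\<bar>) / \<epsilon> m)"
      using \<epsilon>(1)[of m] by (simp add: abs_divide divide_simps)
  next
    show "(\<lambda>m. B * (integral {0..T} (\<lambda>t. \<bar>r m t\<bar>) / \<epsilon> m)) \<longlonglongrightarrow> 0"
      using tendsto_mult_left[OF r_limit, of B] by simp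
  qed
qed

text \<open>In the product rule for \<open>Theta * z\<close> the terms with \<open>a\<close> cancel;
  multiplying by \<open>Phi\<close>, the reciprocal of \<open>Theta\<close>, solves for
  \<open>z\<close>.\<close>

lemma variation_of_constants:
  assumes t: "t \<in> {0..T}"
  shows "z m t = Phi t * integral {0..t} (\<lambda>s. Theta s * \<sigma> m s)"
proof -
  have "Theta t * z m t = 1 * 0 + integral {0..t} (\<lambda>s. z m s * (- a s * Theta s) + Theta s * (a s * z m s + \<sigma> m s))"
  proof (rule integral_product_rule[OF _ _ _ z_eq t])
    show "integrable (lebesgue_on {0..T}) (\<lambda>s. - a s * Theta s)"
      using integrable_a_mult[OF Theta(1)] by simp
    show "integrable (lebesgue_on {0..T}) (\<lambda>s. a s * z m s + \<sigma> m s)"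
      by (intro Bochner_Integration.integrable_add integrable_a_mult z_cont \<sigma>_int)
    show "Theta t = 1 + integral {0..t} (\<lambda>s. - a s * Theta s)" if "t \<in> {0..T}" for t
      using Theta(2)[OF that] by (simp add: a_def)
  qed
  also have "(\<lambda>s. z m s * (- a s * Theta s) + Theta s * (a s * z m s + \<sigma> m s)) = (\<lambda>s. Theta s * \<sigma> m s)"
    by (simp add: algebra_simps)
  finally have "Phi t * (Theta t * z m t) = Phi t * integral {0..t} (\<lambda>s. Theta s * \<sigma> m s)" by simp
  then show ?thesis using Phi_Theta[OF t] by (simp flip: mult.assoc)
qed

lemma integral_weight_\<sigma>:
  assumes g: "continuous_on {0..T} g" and t: "t \<in> {0..T}"
  shows "integral {0..t} (\<lambda>s. g s * \<sigma> m s)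
    = integral {0..t} (\<lambda>s. indicator (L m) s * (g s * \<eta> w s)) + integral {0..t} (\<lambda>s. g s * r m s)"
proof -
  have "(\<lambda>s. g s * \<sigma> m s) = (\<lambda>s. indicator (L m) s * (g s * \<eta> w s) + g s * r m s)"
    by (simp add: r_def algebra_simps)
  then show ?thesis
    using integral_add_Icc[OF integrable_indicator_mult[OF L integrable_continuous_mult[OF \<eta>_int[OF w] g]]
        integrable_continuous_mult[OF r_int g] t] by simp
qed

text \<open>The deviation at \<open>\<tau>\<close> is a weighted integral of the forcing. Its
  switching part carries nearly the fraction \<open>\<epsilon> m\<close> of the full integral, and
  the part from \<open>r\<close> is negligible.\<close>

lemma state_expansion:
  assumes \<tau>: "\<tau> \<in> J"
  shows "(\<lambda>m. z m \<tau> / \<epsilon> m) \<longlonglongrightarrow> Phi \<tau> * integral {0..\<tau>} (\<lambda>s. Theta s * \<eta> w s)"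
proof -
  have t: "\<tau> \<in> {0..T}" using \<tau> J by blast
  have e: "(\<lambda>s. indicator (L m) s * (if s \<in> {0..\<tau>} then Theta s * \<eta> w s else 0))
      = (\<lambda>s. if s \<in> {0..\<tau>} then indicator (L m) s * (Theta s * \<eta> w s) else 0)" for m
    by auto
  have "(\<lambda>m. integral {0..T} (\<lambda>s. indicator (L m) s * (if s \<in> {0..\<tau>} then Theta s * \<eta> w s else 0)) / \<epsilon> m)
      \<longlonglongrightarrow> integral {0..T} (\<lambda>s. if s \<in> {0..\<tau>} then Theta s * \<eta> w s else 0)"
    by (rule lane_limit) (use \<tau> in blast)
  then have "(\<lambda>m. integral {0..\<tau>} (\<lambda>s. indicator (L m) s * (Theta s * \<eta> w s)) / \<epsilon> m)
      \<longlonglongrightarrow> integral {0..\<tau>} (\<lambda>s. Theta s * \<eta> w s)"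
    by (simp only: e integral_if_Icc[OF t])
  from tendsto_mult_left[OF tendsto_add[OF this weighted_r_limit[OF Theta(1) t]], of "Phi \<tau>"]
  have "(\<lambda>m. Phi \<tau> * (integral {0..\<tau>} (\<lambda>s. indicator (L m) s * (Theta s * \<eta> w s)) / \<epsilon> m
        + integral {0..\<tau>} (\<lambda>s. Theta s * r m s) / \<epsilon> m))
      \<longlonglongrightarrow> Phi \<tau> * (integral {0..\<tau>} (\<lambda>s. Theta s * \<eta> w s) + 0)" .
  moreover have "z m \<tau> / \<epsilon> m = Phi \<tau> * (integral {0..\<tau>} (\<lambda>s. indicator (L m) s * (Theta s * \<eta> w s)) / \<epsilon> m
        + integral {0..\<tau>} (\<lambda>s. Theta s * r m s) / \<epsilon> m)" for m
    unfolding variation_of_constants[OF t] integral_weight_\<sigma>[OF Theta(1) t]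
    by (simp only: add_divide_distrib[symmetric] times_divide_eq_right)
  ultimately show ?thesis by (simp only: add_0_right)
qed
end

section \<open>First-order expansion of the cost\<close>

context spike_variation
begin

definition rf where "rf m t = f (Y m t) (v m t) - f (X t) (u t) - d t * z m t - indicator (L m) t * \<zeta> w t"

lemma d_z_int: "integrable (lebesgue_on {0..T}) (\<lambda>t. d t * z m t)"
  using integrable_continuous_mult[OF d_int z_cont[of m]] by (simp add: mult.commute)

lemma rf_int: "integrable (lebesgue_on {0..T}) (rf m)"
  unfolding rf_def[abs_def]
  by (intro Bochner_Integration.integrable_diff integrable_f_along v u X_cont Y_cont d_z_int
      integrable_indicator_mult L \<zeta>_int w)

text \<open>Stands in for a derivative bound along \<open>w\<close>: \<open>Y m\<close> tends to
  \<open>X\<close> uniformly, and the modulus of continuity of \<open>f\<close> does not depend on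
  the control value.\<close>

lemma f_uniform:
  assumes "0 < e"
  shows "\<forall>\<^sub>F m in sequentially. \<forall>t\<in>{0..T}. \<bar>f (Y m t) (w t) - f (X t) (w t)\<bar> \<le> e"
proof -
  obtain C where C: "\<And>m t. t \<in> {0..T} \<Longrightarrow> \<bar>z m t\<bar> \<le> C * \<epsilon> m" using z_bound by blast
  obtain \<rho> where \<rho>: "0 < \<rho>" and close_f: "\<And>x y p. p \<in> U \<Longrightarrow> \<bar>x - y\<bar> < \<rho> \<Longrightarrow> \<bar>f x p - f y p\<bar> < e"
  proof -
    obtain \<rho> where "0 < \<rho>" and H: "\<forall>p\<in>UNIV \<times> U. \<forall>q\<in>UNIV \<times> U. dist q p < \<rho> \<longrightarrow>
        dist (case q of (x, v) \<Rightarrow> f x v) (case p of (x, v) \<Rightarrow> f x v) < e"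
      using f_uc \<open>0 < e\<close> unfolding uniformly_continuous_on_def by blast
    have "\<bar>f x p - f y p\<bar> < e" if "p \<in> U" "\<bar>x - y\<bar> < \<rho>" for x y p
      using H[rule_format, of "(y, p)" "(x, p)"] that by (simp add: dist_Pair_Pair dist_real_def)
    then show ?thesis using that \<open>0 < \<rho>\<close> by blast
  qed
  have "(\<lambda>m. C * \<epsilon> m) \<longlonglongrightarrow> C * 0" by (intro tendsto_mult tendsto_const \<epsilon>)
  then have "\<forall>\<^sub>F m in sequentially. C * \<epsilon> m < \<rho>" using \<rho> by (simp add: order_tendstoD(2))
  then show ?thesis
  proof (rule eventually_mono)
    fix m assume m: "C * \<epsilon> m < \<rho>"
    show "\<forall>t\<in>{0..T}. \<bar>f (Y m t) (w t) - f (X t) (w t)\<bar> \<le> e"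
    proof
      fix t assume t: "t \<in> {0..T}"
      have "\<bar>Y m t - X t\<bar> < \<rho>" using C[OF t, of m] m unfolding z_def by linarith
      from close_f[OF admissibleD(2)[OF w t] this] show "\<bar>f (Y m t) (w t) - f (X t) (w t)\<bar> \<le> e" by simp
    qed
  qed
qed

text \<open>Off \<open>L m\<close> the integrand is the remainder \<open>q m\<close>, for which
  \<open>k\<close> provides the domination. On \<open>L m\<close> the increment of \<open>f\<close>
  at the fixed control \<open>w\<close> is at most \<open>e\<close>, and \<open>d * z\<close> is at
  most \<open>C * \<epsilon> m * k\<close>; \<open>e\<close> is chosen last.\<close>

lemma rf_limit: "(\<lambda>m. integral {0..T} (rf m) / \<epsilon> m) \<longlonglongrightarrow> 0"
proof -
  obtain C where C: "0 \<le> C" "\<And>m t. t \<in> {0..T} \<Longrightarrow> \<bar>z m t\<bar> \<le> C * \<epsilon> m" using z_bound by blast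
  have T': "T \<in> {0..T}" using T by simp
  define q where "q m t = f (Y m t) (u t) - f (X t) (u t) - d t * (Y m t - X t)" for m t
  have q_int: "integrable (lebesgue_on {0..T}) (q m)" for m
    using d_z_int[of m] unfolding q_def[abs_def] z_def
    by (intro Bochner_Integration.integrable_diff integrable_f_along u X_cont Y_cont)
  have lim: "(\<lambda>m. integral {0..T} (\<lambda>t. \<bar>q m t\<bar>) / \<epsilon> m) \<longlonglongrightarrow> 0"
    unfolding q_def
  proof (rule first_order_remainder[where h = "\<lambda>t y. f y (u t)" and C = C, OF _ k_int \<delta>])
    show "((\<lambda>y. f y (u t)) has_real_derivative d t) (at (X t))" if "t \<in> {0..T}" for t
      unfolding d_def by (rule f_der[OF admissibleD(2)[OF u that]])
    show "\<bar>Y m t - X t\<bar> \<le> C * \<epsilon> m" if "t \<in> {0..T}" for m t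
      using C(2)[OF that, of m] by (simp add: z_def)
    show "(\<lambda>t. f (Y m t) (u t) - f (X t) (u t) - d t * (Y m t - X t)) \<in> borel_measurable (lebesgue_on {0..T})" for m
      using borel_measurable_integrable[OF q_int] by (simp add: q_def[abs_def])
    \<comment> \<open>Mean value inequality on the ball of radius \<open>\<delta>\<close>, where
      \<open>k t\<close> bounds the derivative.\<close>
    show "\<bar>f y (u t) - f (X t) (u t)\<bar> \<le> k t * \<bar>y - X t\<bar>" if t: "t \<in> {0..T}" and y: "\<bar>y - X t\<bar> \<le> \<delta>" for t y
      using field_differentiable_bound[of "cball (X t) \<delta>" "\<lambda>y. f y (u t)" "\<lambda>y. partial_x f y (u t)" "k t" y "X t"]
        f_der[OF admissibleD(2)[OF u t]] k_dom[OF t] y \<delta>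
      by (auto simp: dist_real_def abs_minus_commute intro: has_field_derivative_at_within)
  qed (use \<epsilon> in auto)
  have bound: "\<bar>rf m t\<bar> \<le> (e * indicator (L m) t + C * \<epsilon> m * (indicator (L m) t * k t)) + \<bar>q m t\<bar>"
    if t: "t \<in> {0..T}" and e: "\<bar>f (Y m t) (w t) - f (X t) (w t)\<bar> \<le> e" for m t e
  proof (cases "t \<in> L m")
    case True
    have k0: "0 \<le> k t" using d_bound[OF t] by simp
    have "\<bar>d t * z m t\<bar> \<le> k t * (C * \<epsilon> m)"
      unfolding abs_mult by (intro mult_mono d_bound C t k0) auto
    moreover have "rf m t = f (Y m t) (w t) - f (X t) (w t) - d t * z m t"
      using True by (simp add: rf_def v_def \<zeta>_def)
    ultimately have "\<bar>rf m t\<bar> \<le> e + k t * (C * \<epsilon> m)" using e by linarith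
    then show ?thesis using True by (simp add: mult_ac)
  next
    case False
    then show ?thesis by (simp add: rf_def v_def q_def z_def)
  qed
  have int_bound: "\<bar>integral {0..T} (rf m) / \<epsilon> m\<bar>
      \<le> e * (T + 1) + C * integral {0..T} (\<lambda>t. indicator (L m) t * k t) + integral {0..T} (\<lambda>t. \<bar>q m t\<bar>) / \<epsilon> m"
    if e: "0 < e" and m: "\<forall>t\<in>{0..T}. \<bar>f (Y m t) (w t) - f (X t) (w t)\<bar> \<le> e" for m e
  proof -
    have i1: "integrable (lebesgue_on {0..T}) (\<lambda>t. e * indicator (L m) t)"
      by (intro integrable_mult_right ind_int)
    have i2: "integrable (lebesgue_on {0..T}) (\<lambda>t. C * \<epsilon> m * (indicator (L m) t * k t))"
      by (intro integrable_mult_right integrable_indicator_mult L k_int)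
    have "\<bar>integral {0..T} (rf m)\<bar> \<le> integral {0..T}
        (\<lambda>t. (e * indicator (L m) t + C * \<epsilon> m * (indicator (L m) t * k t)) + \<bar>q m t\<bar>)"
      by (rule integral_abs_le[of T]) (use rf_int q_int i1 i2 bound m T in auto)
    also have "\<dots> = e * integral {0..T} (indicator (L m))
        + C * \<epsilon> m * integral {0..T} (\<lambda>t. indicator (L m) t * k t) + integral {0..T} (\<lambda>t. \<bar>q m t\<bar>)"
      using integral_add_Icc[OF Bochner_Integration.integrable_add[OF i1 i2] integrable_abs[OF q_int] T']
        integral_add_Icc[OF i1 i2 T'] by simp
    also have "\<dots> \<le> e * ((T + 1) * \<epsilon> m)
        + C * \<epsilon> m * integral {0..T} (\<lambda>t. indicator (L m) t * k t) + integral {0..T} (\<lambda>t. \<bar>q m t\<bar>)"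
      using e by (intro add_right_mono mult_left_mono lane_le) auto
    also have "\<dots> = (e * (T + 1) + C * integral {0..T} (\<lambda>t. indicator (L m) t * k t)
        + integral {0..T} (\<lambda>t. \<bar>q m t\<bar>) / \<epsilon> m) * \<epsilon> m"
      using \<epsilon>(1)[of m] by (simp add: algebra_simps)
    finally show ?thesis using \<epsilon>(1)[of m] by (simp add: abs_divide pos_divide_le_eq)
  qed
  \<comment> \<open>As one of the functions in \<open>close\<close>, \<open>k\<close> has an
    integral of order \<open>\<epsilon> m\<close> over \<open>L m\<close>, although it may be
    unbounded.\<close>
  have k_lane: "(\<lambda>m. integral {0..T} (\<lambda>t. indicator (L m) t * k t)) \<longlonglongrightarrow> 0"
  proof -
    have "(\<lambda>m. integral {0..T} (\<lambda>t. indicator (L m) t * k t) / \<epsilon> m * \<epsilon> m) \<longlonglongrightarrow> integral {0..T} k * 0"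
      by (rule tendsto_mult[OF lane_limit \<epsilon>(3)]) simp
    moreover have "integral {0..T} (\<lambda>t. indicator (L m) t * k t) / \<epsilon> m * \<epsilon> m
        = integral {0..T} (\<lambda>t. indicator (L m) t * k t)" for m
      using \<epsilon>(1)[of m] by simp
    ultimately show ?thesis by simp
  qed
  show ?thesis
  proof (rule tendstoI)
    fix s :: real assume s: "0 < s"
    define e where "e = s / (2 * (T + 1))"
    have e: "0 < e" and eT: "e * (T + 1) = s / 2" using s T by (simp_all add: e_def divide_simps)
    have "(\<lambda>m. C * integral {0..T} (\<lambda>t. indicator (L m) t * k t) + integral {0..T} (\<lambda>t. \<bar>q m t\<bar>) / \<epsilon> m) \<longlonglongrightarrow> C * 0 + 0"
      by (rule tendsto_add[OF tendsto_mult_left[OF k_lane] lim])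
    then have "\<forall>\<^sub>F m in sequentially. C * integral {0..T} (\<lambda>t. indicator (L m) t * k t)
        + integral {0..T} (\<lambda>t. \<bar>q m t\<bar>) / \<epsilon> m < s / 2"
      by (rule order_tendstoD(2)) (use s in simp)
    with f_uniform[OF e] show "\<forall>\<^sub>F m in sequentially. dist (integral {0..T} (rf m) / \<epsilon> m) 0 < s"
    proof (eventually_elim)
      case (elim m)
      then show ?case
        using int_bound[OF e elim(1)] eT unfolding dist_real_def diff_zero by linarith
    qed
  qed
qed

text \<open>An exchange of the order of integration, done by parts between \<open>Q\<close> and the
  running integral \<open>W\<close> of \<open>Theta * \<sigma>\<close>: by variation of constants
  \<open>z = Phi * W\<close>, and the boundary terms vanish because \<open>Q T = 0\<close> and
  \<open>W 0 = 0\<close>.\<close>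

lemma integral_d_z: "integral {0..T} (\<lambda>t. d t * z m t) = integral {0..T} (\<lambda>t. (Theta t * Q t) * \<sigma> m t)"
proof -
  define W where "W t = integral {0..t} (\<lambda>s. Theta s * \<sigma> m s)" for t
  have T': "T \<in> {0..T}" using T by simp
  have i1: "integrable (lebesgue_on {0..T}) (\<lambda>s. Theta s * \<sigma> m s)"
    by (rule integrable_continuous_mult[OF \<sigma>_int Theta(1)])
  have i2: "integrable (lebesgue_on {0..T}) (\<lambda>s. (Theta s * Q s) * \<sigma> m s)"
    by (intro integrable_continuous_mult \<sigma>_int continuous_intros Theta(1) Q_cont)
  have i3: "integrable (lebesgue_on {0..T}) (\<lambda>s. - (d s * Phi s))" using d_Phi_int by simp
  have "Q T * W T = Q 0 * 0 + integral {0..T} (\<lambda>s. W s * (- (d s * Phi s)) + Q s * (Theta s * \<sigma> m s))"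
    by (rule integral_product_rule[OF i3 i1 Q_eq _ T']) (simp_all add: W_def)
  moreover have "Q T = 0" by (simp add: Q_def)
  moreover have "integral {0..T} (\<lambda>s. W s * (- (d s * Phi s)) + Q s * (Theta s * \<sigma> m s))
      = integral {0..T} (\<lambda>s. (Theta s * Q s) * \<sigma> m s - d s * z m s)"
    by (rule integral_cong) (simp add: variation_of_constants W_def algebra_simps)
  ultimately show ?thesis using integral_diff_Icc[OF i2 d_z_int T', of m] by simp
qed

lemma Psi_limit: "(\<lambda>m. (Psi (Y m T) - Psi (X T)) / \<epsilon> m) \<longlonglongrightarrow> \<kappa> * (Phi T * integral {0..T} (\<lambda>s. Theta s * \<eta> w s))"
proof -
  \<comment> \<open>Caratheodory's form of the derivative: the increment factors through
    \<open>z m T\<close>, which may be 0 and hence cannot serve as a divisor.\<close>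
  obtain g where g: "\<And>y. Psi y - Psi (X T) = g y * (y - X T)" "isCont g (X T)" "g (X T) = \<kappa>"
    using Psi unfolding CARAT_DERIV by blast
  have zT: "(\<lambda>m. z m T / \<epsilon> m) \<longlonglongrightarrow> Phi T * integral {0..T} (\<lambda>s. Theta s * \<eta> w s)"
    by (rule state_expansion[OF J(3)])
  from tendsto_mult[OF this \<epsilon>(3)] have "(\<lambda>m. z m T / \<epsilon> m * \<epsilon> m) \<longlonglongrightarrow> 0" by simp
  moreover have "z m T / \<epsilon> m * \<epsilon> m = Y m T - X T" for m using \<epsilon>(1)[of m] by (simp add: z_def)
  ultimately have "(\<lambda>m. Y m T - X T) \<longlonglongrightarrow> 0" by simp
  then have "(\<lambda>m. Y m T) \<longlonglongrightarrow> X T" by (rule LIM_zero_cancel)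
  then have "(\<lambda>m. g (Y m T)) \<longlonglongrightarrow> \<kappa>" using isCont_tendsto_compose[OF g(2)] g(3) by simp
  from tendsto_mult[OF this zT] show ?thesis by (simp add: g(1) z_def)
qed

text \<open>\<open>Theta s * (Q s + \<kappa> * Phi T)\<close> is the sensitivity of running plus
  terminal cost to the state at time \<open>s\<close>. Times the drift jump \<open>\<eta>\<close> it
  gives the indirect effect of switching; \<open>\<zeta>\<close> is the direct one.\<close>

lemma cost_expansion:
  "(\<lambda>m. (total_cost T f Psi (v m) (Y m) - total_cost T f Psi u X) / \<epsilon> m) \<longlonglongrightarrow>
     integral {0..T} (\<lambda>s. \<zeta> w s + Theta s * (Q s + \<kappa> * Phi T) * \<eta> w s)"
proof -
  have T': "T \<in> {0..T}" using T by simp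
  have cTQ: "continuous_on {0..T} (\<lambda>s. Theta s * Q s)" by (intro continuous_intros Theta(1) Q_cont)
  have i1: "integrable (lebesgue_on {0..T}) (\<lambda>s. Theta s * Q s * \<eta> w s)"
    by (rule integrable_continuous_mult[OF \<eta>_int[OF w] cTQ])
  have i2: "integrable (lebesgue_on {0..T}) (\<lambda>s. Theta s * \<eta> w s)"
    by (rule integrable_continuous_mult[OF \<eta>_int[OF w] Theta(1)])
  have split: "integral {0..T} (\<lambda>t. f (Y m t) (v m t)) - integral {0..T} (\<lambda>t. f (X t) (u t))
      = integral {0..T} (\<lambda>t. indicator (L m) t * \<zeta> w t)
        + (integral {0..T} (\<lambda>t. indicator (L m) t * (Theta t * Q t * \<eta> w t)) + integral {0..T} (\<lambda>t. Theta t * Q t * r m t))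
        + integral {0..T} (rf m)" for m
  proof -
    have j1: "integrable (lebesgue_on {0..T}) (\<lambda>t. indicator (L m) t * \<zeta> w t)"
      by (intro integrable_indicator_mult L \<zeta>_int w)
    have "integral {0..T} (\<lambda>t. f (Y m t) (v m t)) - integral {0..T} (\<lambda>t. f (X t) (u t))
        = integral {0..T} (\<lambda>t. f (Y m t) (v m t) - f (X t) (u t))"
      by (rule integral_diff_Icc[OF integrable_f_along[OF v Y_cont] integrable_f_along[OF u X_cont] T', symmetric])
    also have "(\<lambda>t. f (Y m t) (v m t) - f (X t) (u t)) = (\<lambda>t. (indicator (L m) t * \<zeta> w t + d t * z m t) + rf m t)"
      by (simp add: rf_def)
    also have "integral {0..T} \<dots> = integral {0..T} (\<lambda>t. indicator (L m) t * \<zeta> w t)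
        + integral {0..T} (\<lambda>t. d t * z m t) + integral {0..T} (rf m)"
      using integral_add_Icc[OF Bochner_Integration.integrable_add[OF j1 d_z_int[of m]] rf_int T']
        integral_add_Icc[OF j1 d_z_int T'] by simp
    finally show ?thesis unfolding integral_d_z integral_weight_\<sigma>[OF cTQ T'] .
  qed
  have eq: "(total_cost T f Psi (v m) (Y m) - total_cost T f Psi u X) / \<epsilon> m
      = integral {0..T} (\<lambda>t. indicator (L m) t * \<zeta> w t) / \<epsilon> m
        + (integral {0..T} (\<lambda>t. indicator (L m) t * (Theta t * Q t * \<eta> w t)) / \<epsilon> m + integral {0..T} (\<lambda>t. Theta t * Q t * r m t) / \<epsilon> m)
        + integral {0..T} (rf m) / \<epsilon> m + (Psi (Y m T) - Psi (X T)) / \<epsilon> m" for m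
    unfolding total_cost_def add_divide_distrib[symmetric] split[symmetric] by (simp add: algebra_simps)
  have l1: "(\<lambda>m. integral {0..T} (\<lambda>t. indicator (L m) t * \<zeta> w t) / \<epsilon> m) \<longlonglongrightarrow> integral {0..T} (\<zeta> w)"
    by (rule lane_limit) simp
  have l2: "(\<lambda>m. integral {0..T} (\<lambda>t. indicator (L m) t * (Theta t * Q t * \<eta> w t)) / \<epsilon> m)
      \<longlonglongrightarrow> integral {0..T} (\<lambda>t. Theta t * Q t * \<eta> w t)"
    by (rule lane_limit) simp
  note lim = tendsto_add[OF tendsto_add[OF tendsto_add[OF l1 tendsto_add[OF l2 weighted_r_limit[OF cTQ T']]] rf_limit] Psi_limit]
  have "integral {0..T} (\<lambda>s. \<zeta> w s + Theta s * (Q s + \<kappa> * Phi T) * \<eta> w s)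
      = integral {0..T} (\<lambda>s. (\<zeta> w s + Theta s * Q s * \<eta> w s) + (\<kappa> * Phi T) * (Theta s * \<eta> w s))"
    by (simp add: algebra_simps)
  also have "\<dots> = integral {0..T} (\<zeta> w) + (integral {0..T} (\<lambda>t. Theta t * Q t * \<eta> w t) + 0) + 0
      + \<kappa> * (Phi T * integral {0..T} (\<lambda>s. Theta s * \<eta> w s))"
    using integral_add_Icc[OF Bochner_Integration.integrable_add[OF \<zeta>_int[OF w] i1] integrable_mult_right[OF i2] T', of "\<kappa> * Phi T"]
      integral_add_Icc[OF \<zeta>_int[OF w] i1 T'] by simp
  finally show ?thesis using lim by (simp only: eq)
qed

end

section \<open>Multipliers and costate\<close>

context reference_pair
begin

text \<open>
  Densities of the first-order changes caused by switching to \<open>w\<close>: index \<open>0\<close> stands for the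
  decrease of the cost, index \<open>i > 0\<close> for the increase of the state at \<open>\<tau> i\<close>.
\<close>

definition needle :: "(nat \<Rightarrow> real) \<Rightarrow> nat \<Rightarrow> (real \<Rightarrow> real) \<Rightarrow> real \<Rightarrow> real" where
  "needle \<tau> i w s = (if i = 0 then - (\<zeta> w s + Theta s * (Q s + \<kappa> * Phi T) * \<eta> w s)
     else if s \<in> {0..\<tau> i} then Phi (\<tau> i) * (Theta s * \<eta> w s) else 0)"

lemma needle_int:
  assumes w: "w \<in> admissible T U"
  shows "integrable (lebesgue_on {0..T}) (needle \<tau> i w)"
proof (cases "i = 0")
  case True
  have "integrable (lebesgue_on {0..T}) (\<lambda>s. - (\<zeta> w s + Theta s * (Q s + \<kappa> * Phi T) * \<eta> w s))"
    by (intro Bochner_Integration.integrable_minus Bochner_Integration.integrable_add \<zeta>_int w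
        integrable_continuous_mult \<eta>_int continuous_intros Theta(1) Q_cont)
  then show ?thesis using True by (simp add: needle_def[abs_def])
next
  case False
  have "integrable (lebesgue_on {0..T}) (\<lambda>s. indicator {0..\<tau> i} s * (Phi (\<tau> i) * (Theta s * \<eta> w s)))"
    by (intro integrable_indicator_mult integrable_mult_right integrable_continuous_mult \<eta>_int w Theta(1)) simp
  then show ?thesis
    by (rule Bochner_Integration.integrable_cong[THEN iffD1, rotated -1])
      (use False in \<open>auto simp: needle_def indicator_def\<close>)
qed

text \<open>\<open>needle\<close> depends on a control only through its value at the time
  \<open>s\<close>, so a switch acts linearly on the densities, through the indicator.\<close>

lemma needle_switch:
  "needle \<tau> i (\<lambda>t. if t \<in> L then w t else v t) s
    = needle \<tau> i v s + indicator L s * (needle \<tau> i w s - needle \<tau> i v s)"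
  by (simp add: needle_def \<zeta>_def \<eta>_def)

lemma needle_convexlike:
  "almost_convexlike {..n} (\<lambda>i w. integral {0..T} (needle \<tau> i w)) (admissible T U)"
  unfolding almost_convexlike_def
proof (intro ballI allI impI)
  fix w1 w2 and a e :: real
  assume w: "w1 \<in> admissible T U" "w2 \<in> admissible T U" and a: "a \<in> {0..1}" and e: "0 < e"
  have T': "T \<in> {0..T}" using T by simp
  \<comment> \<open>The fraction is prescribed for the differences: the switched control contributes
    the integral for \<open>w1\<close> exactly, plus that of the difference over
    \<open>L\<close>.\<close>
  define h where "h i s = needle \<tau> i w2 s - needle \<tau> i w1 s" for i s
  have h_int: "integrable (lebesgue_on {0..T}) (h i)" for i
    unfolding h_def[abs_def] by (intro Bochner_Integration.integrable_diff needle_int w)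
  have "\<exists>L\<in>sets lebesgue. \<forall>g\<in>h ` {..n}.
      \<bar>integral {0..T} (\<lambda>s. indicator L s * g s) - a * integral {0..T} g\<bar> \<le> e"
    by (rule proportional_indicator) (use a e h_int in auto)
  then obtain L where L: "L \<in> sets lebesgue" and close: "\<And>i. i \<le> n \<Longrightarrow>
      \<bar>integral {0..T} (\<lambda>s. indicator L s * h i s) - a * integral {0..T} (h i)\<bar> \<le> e" by blast
  show "\<exists>w\<in>admissible T U. \<forall>i\<in>{..n}. \<bar>integral {0..T} (needle \<tau> i w)
      - ((1 - a) * integral {0..T} (needle \<tau> i w1) + a * integral {0..T} (needle \<tau> i w2))\<bar> \<le> e"
  proof (intro bexI ballI)
    show "(\<lambda>t. if t \<in> L then w2 t else w1 t) \<in> admissible T U"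
      by (rule admissible_switch[OF w(2,1) L])
    fix i assume "i \<in> {..n}"
    then have i: "i \<le> n" by simp
    have "integral {0..T} (needle \<tau> i (\<lambda>t. if t \<in> L then w2 t else w1 t))
        = integral {0..T} (\<lambda>s. needle \<tau> i w1 s + indicator L s * h i s)"
      by (rule integral_cong) (simp only: needle_switch h_def)
    also have "\<dots> = integral {0..T} (needle \<tau> i w1) + integral {0..T} (\<lambda>s. indicator L s * h i s)"
      by (rule integral_add_Icc[OF needle_int[OF w(1)] integrable_indicator_mult[OF L h_int] T'])
    finally have 1: "integral {0..T} (needle \<tau> i (\<lambda>t. if t \<in> L then w2 t else w1 t))
        = integral {0..T} (needle \<tau> i w1) + integral {0..T} (\<lambda>s. indicator L s * h i s)" .
    have 2: "integral {0..T} (h i) = integral {0..T} (needle \<tau> i w2) - integral {0..T} (needle \<tau> i w1)"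
      unfolding h_def by (rule integral_diff_Icc[OF needle_int[OF w(2)] needle_int[OF w(1)] T'])
    show "\<bar>integral {0..T} (needle \<tau> i (\<lambda>t. if t \<in> L then w2 t else w1 t))
      - ((1 - a) * integral {0..T} (needle \<tau> i w1) + a * integral {0..T} (needle \<tau> i w2))\<bar> \<le> e"
      using close[OF i] unfolding 1 2 by (simp add: algebra_simps)
  qed
qed

text \<open>If all first-order gains were strictly positive, they would outweigh the remainders for
  large \<open>m\<close>, and a spike variation would be feasible and strictly cheaper than the
  optimum.\<close>

lemma no_improving_direction:
  assumes n: "\<tau> 0 = 0" "\<tau> n = T" "0 < n" "\<And>i. i \<le> n \<Longrightarrow> \<tau> i \<in> {0..T}"
    and feasible: "\<And>i. i \<le> n \<Longrightarrow> 0 \<le> X (\<tau> i)"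
    and optimal: "\<And>v Y. v \<in> admissible T U \<Longrightarrow> state_solution T x0 b v Y \<Longrightarrow> \<forall>i\<le>n. 0 \<le> Y (\<tau> i) \<Longrightarrow>
      total_cost T f Psi u X \<le> total_cost T f Psi v Y"
    and w: "w \<in> admissible T U"
  shows "\<not> (\<forall>i\<le>n. 0 < integral {0..T} (needle \<tau> i w))"
proof
  assume pos: "\<forall>i\<le>n. 0 < integral {0..T} (needle \<tau> i w)"
  define J where "J = \<tau> ` {..n}"
  define \<epsilon> where "\<epsilon> m = inverse (real (Suc m))" for m
  define G where "G = {\<lambda>_. 1, k, \<lambda>s. Theta s * Q s * \<eta> w s, \<zeta> w} \<union>
        (\<lambda>\<tau> s. if s \<in> {0..\<tau>} then Theta s * \<eta> w s else 0) ` J"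
  have J: "finite J" "J \<subseteq> {0..T}" "T \<in> J" using n by (auto simp: J_def)
  have \<epsilon>: "0 < \<epsilon> m" "\<epsilon> m \<le> 1" for m
    by (auto simp: \<epsilon>_def inverse_le_1_iff)
  have \<epsilon>0: "\<epsilon> \<longlonglongrightarrow> 0" unfolding \<epsilon>_def[abs_def] by (rule LIMSEQ_inverse_real_of_nat)
  have i\<eta>: "integrable (lebesgue_on {0..T}) (\<lambda>s. Theta s * \<eta> w s)"
    by (rule integrable_continuous_mult[OF \<eta>_int[OF w] Theta(1)])
  have G_int: "integrable (lebesgue_on {0..T}) g" if "g \<in> G" for g
  proof -
    have 1: "integrable (lebesgue_on {0..T}) (\<lambda>s. Theta s * Q s * \<eta> w s)"
      by (intro integrable_continuous_mult \<eta>_int w continuous_intros Theta(1) Q_cont)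
    have 2: "integrable (lebesgue_on {0..T}) (\<lambda>s. if s \<in> {0..t} then Theta s * \<eta> w s else 0)" for t
    proof -
      have "(\<lambda>s. if s \<in> {0..t} then Theta s * \<eta> w s else 0) = (\<lambda>s. indicator {0..t} s * (Theta s * \<eta> w s))"
        by (auto simp: indicator_def)
      then show ?thesis using integrable_indicator_mult[OF _ i\<eta>, of "{0..t}"] by simp
    qed
    from that consider "g = (\<lambda>_. 1)" | "g = k" | "g = (\<lambda>s. Theta s * Q s * \<eta> w s)" | "g = \<zeta> w"
      | t where "g = (\<lambda>s. if s \<in> {0..t} then Theta s * \<eta> w s else 0)"
      unfolding G_def by blast
    then show ?thesis
      using 1 2 k_int \<zeta>_int[OF w] integrable_continuous_Icc[OF continuous_on_const] by cases simp_all
  qed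
  have "\<exists>L\<in>sets lebesgue. \<forall>g\<in>G. \<bar>integral {0..T} (\<lambda>s. indicator L s * g s) - \<epsilon> m * integral {0..T} g\<bar> \<le> \<epsilon> m * \<epsilon> m" for m
    by (rule proportional_indicator[OF _ G_int]) (use \<epsilon>[of m] J(1) in \<open>auto simp: G_def\<close>)
  then obtain L where L: "\<And>m. L m \<in> sets lebesgue"
    and close: "\<And>m g. g \<in> G \<Longrightarrow> \<bar>integral {0..T} (\<lambda>s. indicator (L m) s * g s) - \<epsilon> m * integral {0..T} g\<bar> \<le> \<epsilon> m * \<epsilon> m"
    by metis
  define v where "v m = (\<lambda>t. if t \<in> L m then w t else u t)" for m
  have v: "v m \<in> admissible T U" for m
    unfolding v_def by (rule admissible_switch[OF w u L])
  obtain Y where Y: "\<And>m. state_solution T x0 b (v m) (Y m)"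
    using state_solution_exists[OF v] by metis
  interpret spike_variation T x0 c M K U b f u X k Phi Theta Psi \<delta> \<kappa> w J L v Y \<epsilon>
    by unfold_locales (use w J \<epsilon> \<epsilon>0 L close Y in \<open>auto simp: G_def v_def\<close>)
  have "\<forall>\<^sub>F m in sequentially. 0 \<le> Y m (\<tau> i)" if i: "i \<le> n" for i
  proof (cases "i = 0")
    \<comment> \<open>Index 0 stands for the cost among the densities but for time 0 among the
      constraints. The constraint at time 0 holds because all trajectories start at
      \<open>x0\<close>.\<close>
    case True
    then show ?thesis using feasible[OF i] Y X n T by (simp add: state_solution_def)
  next
    case False
    have t: "\<tau> i \<in> {0..T}" by (rule n(4)[OF i])
    have "integral {0..T} (needle \<tau> i w)
        = integral {0..T} (\<lambda>s. if s \<in> {0..\<tau> i} then Phi (\<tau> i) * (Theta s * \<eta> w s) else 0)"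
      using False by (simp add: needle_def[abs_def])
    also have "\<dots> = Phi (\<tau> i) * integral {0..\<tau> i} (\<lambda>s. Theta s * \<eta> w s)"
      using integral_if_Icc[OF t, of "\<lambda>s. Phi (\<tau> i) * (Theta s * \<eta> w s)"] by simp
    finally have "integral {0..T} (needle \<tau> i w) = Phi (\<tau> i) * integral {0..\<tau> i} (\<lambda>s. Theta s * \<eta> w s)" .
    with pos i have "0 < Phi (\<tau> i) * integral {0..\<tau> i} (\<lambda>s. Theta s * \<eta> w s)" by metis
    moreover have "\<tau> i \<in> J" using i by (simp add: J_def)
    ultimately have "\<forall>\<^sub>F m in sequentially. 0 < z m (\<tau> i) / \<epsilon> m"
      by (intro order_tendstoD(1)[OF state_expansion])
    then show ?thesis
    proof (rule eventually_mono)
      fix m assume "0 < z m (\<tau> i) / \<epsilon> m"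
      then have "0 < z m (\<tau> i)" using \<epsilon>(1)[of m] by (simp add: zero_less_divide_iff)
      then show "0 \<le> Y m (\<tau> i)" using feasible[OF i] unfolding z_def by linarith
    qed
  qed
  then have "\<forall>\<^sub>F m in sequentially. \<forall>i\<in>{..n}. 0 \<le> Y m (\<tau> i)"
    by (intro eventually_ball_finite) auto
  moreover have "integral {0..T} (needle \<tau> 0 w) = - integral {0..T} (\<lambda>s. \<zeta> w s + Theta s * (Q s + \<kappa> * Phi T) * \<eta> w s)"
  proof -
    have "needle \<tau> 0 w = (\<lambda>s. - (\<zeta> w s + Theta s * (Q s + \<kappa> * Phi T) * \<eta> w s))"
      by (simp add: needle_def[abs_def])
    then show ?thesis by (simp only: Henstock_Kurzweil_Integration.integral_neg)
  qed
  then have "integral {0..T} (\<lambda>s. \<zeta> w s + Theta s * (Q s + \<kappa> * Phi T) * \<eta> w s) < 0" using pos by auto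
  then have "\<forall>\<^sub>F m in sequentially. (total_cost T f Psi (v m) (Y m) - total_cost T f Psi u X) / \<epsilon> m < 0"
    by (rule order_tendstoD(2)[OF cost_expansion])
  ultimately have "\<forall>\<^sub>F m in sequentially. False"
  proof eventually_elim
    case (elim m)
    then have "total_cost T f Psi u X \<le> total_cost T f Psi (v m) (Y m)" by (intro optimal v Y) simp
    then show ?case using elim(2) \<epsilon>(1)[of m] by (simp add: divide_less_0_iff)
  qed
  then show False by simp
qed

lemma multipliers_exist:
  assumes n: "\<tau> 0 = 0" "\<tau> n = T" "0 < n" "\<And>i. i \<le> n \<Longrightarrow> \<tau> i \<in> {0..T}"
    and feasible: "\<And>i. i \<le> n \<Longrightarrow> 0 \<le> X (\<tau> i)"
    and optimal: "\<And>v Y. v \<in> admissible T U \<Longrightarrow> state_solution T x0 b v Y \<Longrightarrow> \<forall>i\<le>n. 0 \<le> Y (\<tau> i) \<Longrightarrow>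
      total_cost T f Psi u X \<le> total_cost T f Psi v Y"
  obtains l :: "nat \<Rightarrow> real" where "\<And>i. 0 \<le> l i" "(\<Sum>i\<le>n. (l i)\<^sup>2) = 1"
    "\<And>w. w \<in> admissible T U \<Longrightarrow> (\<Sum>i\<le>n. l i * integral {0..T} (needle \<tau> i w)) \<le> 0"
proof -
  have "\<exists>l. (\<forall>i. 0 \<le> l i) \<and> (\<Sum>i\<le>n. l i) = 1 \<and>
      (\<forall>w\<in>admissible T U. (\<Sum>i\<le>n. l i * integral {0..T} (needle \<tau> i w)) \<le> 0)"
  proof (rule convexlike_alternative[OF needle_convexlike])
    show "\<not> (\<forall>i\<le>n. 0 < integral {0..T} (needle \<tau> i w))" if "w \<in> admissible T U" for w
      by (rule no_improving_direction[OF n feasible optimal that])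
  qed
  then obtain l where l: "\<And>i. 0 \<le> l i" "(\<Sum>i\<le>n. l i) = 1"
    "\<And>w. w \<in> admissible T U \<Longrightarrow> (\<Sum>i\<le>n. l i * integral {0..T} (needle \<tau> i w)) \<le> 0" by blast
  \<comment> \<open>The alternative normalises the sum of the multipliers, the maximum principle
    their Euclidean norm; the inequality is homogeneous.\<close>
  define \<rho> where "\<rho> = sqrt (\<Sum>i\<le>n. (l i)\<^sup>2)"
  have "(\<Sum>i\<le>n. (l i)\<^sup>2) \<noteq> 0"
  proof
    assume "(\<Sum>i\<le>n. (l i)\<^sup>2) = 0"
    then have "\<forall>i\<in>{..n}. (l i)\<^sup>2 = 0" by (subst (asm) sum_nonneg_eq_0_iff) auto
    then show False using l(2) by simp
  qed
  moreover have "0 \<le> (\<Sum>i\<le>n. (l i)\<^sup>2)" by (intro sum_nonneg) simp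
  ultimately have \<rho>: "0 < \<rho>" "\<rho>\<^sup>2 = (\<Sum>i\<le>n. (l i)\<^sup>2)" by (auto simp: \<rho>_def)
  show ?thesis
  proof (rule that[of "\<lambda>i. l i / \<rho>"])
    show "0 \<le> l i / \<rho>" for i using l(1) \<rho> by simp
    have "(\<Sum>i\<le>n. (l i / \<rho>)\<^sup>2) = (\<Sum>i\<le>n. (l i)\<^sup>2) / \<rho>\<^sup>2"
      by (simp add: power_divide sum_divide_distrib)
    also have "\<dots> = 1" unfolding \<rho>(2)[symmetric] using \<rho>(1) by simp
    finally show "(\<Sum>i\<le>n. (l i / \<rho>)\<^sup>2) = 1" .
    fix w assume "w \<in> admissible T U"
    from l(3)[OF this] show "(\<Sum>i\<le>n. l i / \<rho> * integral {0..T} (needle \<tau> i w)) \<le> 0"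
      using \<rho>(1) by (simp add: divide_le_0_iff flip: sum_divide_distrib)
  qed
qed

section \<open>The costate and the Hamiltonian inequality\<close>

text \<open>The adjoint equations solved in closed form: \<open>l j\<close> acts up to
  \<open>\<tau> j\<close>, and crossing that time drops its term. The non-strict comparison assigns
  the value at \<open>\<tau> j\<close> to the interval on its left, as the terminal values in
  \<open>adjoint_solution\<close> require.\<close>

definition costate :: "(nat \<Rightarrow> real) \<Rightarrow> nat \<Rightarrow> (nat \<Rightarrow> real) \<Rightarrow> real \<Rightarrow> real" where
  "costate \<tau> n l t = - Theta t * (l 0 * (Q t + \<kappa> * Phi T) - (\<Sum>j\<in>{j\<in>{1..n}. t \<le> \<tau> j}. l j * Phi (\<tau> j)))"

text \<open>The factors of \<open>\<eta>\<close> collect into the costate, so the combined density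
  is the Hamiltonian at \<open>w\<close> minus the Hamiltonian at \<open>u\<close>.\<close>

lemma sum_needle:
  assumes t: "0 \<le> t"
  shows "(\<Sum>i\<le>n. l i * needle \<tau> i w t) = costate \<tau> n l t * \<eta> w t - l 0 * \<zeta> w t"
proof -
  have "(\<Sum>i\<le>n. l i * needle \<tau> i w t) = l 0 * needle \<tau> 0 w t + (\<Sum>i\<in>{1..n}. l i * needle \<tau> i w t)"
    by (simp add: atMost_atLeast0 sum.atLeast_Suc_atMost)
  also have "(\<Sum>i\<in>{1..n}. l i * needle \<tau> i w t)
      = (\<Sum>i\<in>{1..n}. if t \<le> \<tau> i then l i * Phi (\<tau> i) * (Theta t * \<eta> w t) else 0)"
    by (rule sum.cong) (use t in \<open>auto simp: needle_def\<close>)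
  also have "\<dots> = (\<Sum>j\<in>{j\<in>{1..n}. t \<le> \<tau> j}. l j * Phi (\<tau> j)) * (Theta t * \<eta> w t)"
    unfolding sum_distrib_right by (rule sum.inter_filter[symmetric]) simp
  finally show ?thesis by (simp add: needle_def costate_def algebra_simps)
qed

lemma pointwise_maximum:
  assumes l: "\<And>w. w \<in> admissible T U \<Longrightarrow> (\<Sum>i\<le>n. l i * integral {0..T} (needle \<tau> i w)) \<le> 0"
    and p: "p \<in> U"
  shows "AE t in lebesgue_on {0..T}. costate \<tau> n l t * \<eta> (\<lambda>_. p) t - l 0 * \<zeta> (\<lambda>_. p) t \<le> 0"
proof -
  have T': "T \<in> {0..T}" using T by simp
  have cp: "(\<lambda>_. p) \<in> admissible T U"
    using p integrable_continuous_Icc[of T "\<lambda>_. p\<^sup>2"] by (simp add: admissible_def)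
  define g where "g t = (\<Sum>i\<le>n. l i * needle \<tau> i (\<lambda>_. p) t)" for t
  have g_int: "integrable (lebesgue_on {0..T}) g"
    unfolding g_def[abs_def] by (intro Bochner_Integration.integrable_sum integrable_mult_right needle_int cp)
  \<comment> \<open>The test control uses \<open>p\<close> exactly where the claim would fail. The
    integral of \<open>g\<close> over \<open>A\<close> is then nonpositive while \<open>g\<close> is
    positive there, which makes \<open>A\<close> a null set.\<close>
  define A where "A = {t \<in> space (lebesgue_on {0..T}). 0 < g t}"
  have "A \<in> sets (lebesgue_on {0..T})"
    unfolding A_def using borel_measurable_integrable[OF g_int] by measurable
  then have A: "A \<in> sets lebesgue" by (simp add: sets_restrict_space_iff)
  define w where "w t = (if t \<in> A then p else u t)" for t
  have w: "w \<in> admissible T U"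
    unfolding w_def[abs_def] by (rule admissible_switch[OF cp u A])
  \<comment> \<open>The reference control has density 0, so only \<open>A\<close>
    contributes.\<close>
  have nu: "needle \<tau> i u s = 0" for i s by (simp add: needle_def \<zeta>_def \<eta>_def)
  have nw: "needle \<tau> i w s = indicator A s * needle \<tau> i (\<lambda>_. p) s" for i s
    unfolding w_def[abs_def] needle_switch by (simp add: nu)
  have gi: "integrable (lebesgue_on {0..T}) (\<lambda>s. indicator A s * g s)"
    by (rule integrable_indicator_mult[OF A g_int])
  have "integral {0..T} (\<lambda>s. indicator A s * g s) = integral {0..T} (\<lambda>s. \<Sum>i\<le>n. l i * needle \<tau> i w s)"
    by (simp add: g_def nw sum_distrib_left mult_ac)
  also have "\<dots> = (\<Sum>i\<le>n. integral {0..T} (\<lambda>s. l i * needle \<tau> i w s))"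
    by (rule Henstock_Kurzweil_Integration.integral_sum)
      (auto intro!: integrable_on_Icc[where T = T] integrable_mult_right needle_int w)
  also have "\<dots> \<le> 0" using l[OF w] by simp
  finally have "integral\<^sup>L (lebesgue_on {0..T}) (\<lambda>s. indicator A s * g s) \<le> 0"
    using lebesgue_integral_Icc(2)[OF gi, of 0 T] by simp
  moreover have nonneg: "AE s in lebesgue_on {0..T}. 0 \<le> indicator A s * g s"
    by (rule AE_I2) (auto simp: A_def indicator_def)
  ultimately have "integral\<^sup>L (lebesgue_on {0..T}) (\<lambda>s. indicator A s * g s) = 0"
    using integral_nonneg_AE[OF nonneg] by linarith
  then have "AE s in lebesgue_on {0..T}. indicator A s * g s = 0"
    using integral_nonneg_eq_0_iff_AE[OF gi nonneg] by simp
  moreover have "AE s in lebesgue_on {0..T}. s \<in> space (lebesgue_on {0..T})" by (rule AE_space)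
  ultimately show ?thesis
  proof eventually_elim
    case (elim s)
    have "g s \<le> 0"
    proof (rule ccontr)
      assume "\<not> g s \<le> 0"
      then have "s \<in> A" using elim(2) by (simp add: A_def)
      then show False using elim(1) \<open>\<not> g s \<le> 0\<close> by simp
    qed
    moreover have "0 \<le> s" using elim(2) by simp
    ultimately show ?case unfolding g_def using sum_needle[of s l \<tau> "\<lambda>_. p" n] by simp
  qed
qed

section \<open>The costate solves the adjoint equations\<close>

text \<open>The costate on one interval of the partition, with its sum of multiplier terms frozen to
  \<open>S\<close>. It is continuous on the whole of [0,T], so a right limit at a partition point is
  the value of the next branch there.\<close>

definition costate_branch :: "real \<Rightarrow> real \<Rightarrow> real \<Rightarrow> real" where
  "costate_branch l0 S t = - Theta t * (l0 * (Q t + \<kappa> * Phi T) - S)"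

lemma costate_branch_cont: "continuous_on {0..T} (costate_branch l0 S)"
  unfolding costate_branch_def[abs_def] by (intro continuous_intros Theta(1) Q_cont)

lemma costate_branch_rhs_int:
  "integrable (lebesgue_on {0..T}) (\<lambda>s. a s * costate_branch l0 S s - l0 * d s)"
  by (intro Bochner_Integration.integrable_diff integrable_a_mult costate_branch_cont integrable_mult_right d_int)

text \<open>Product rule for \<open>Theta * R\<close>, where \<open>R\<close> has the density
  \<open>- (l0 * (d s * Phi s))\<close>; replacing \<open>Phi s * Theta s\<close> by 1 leaves the
  inhomogeneity \<open>l0 * d s\<close>. Subtracting the identities at \<open>s\<close> and
  \<open>t\<close> gives the backward form.\<close>

lemma costate_branch_eq:
  assumes "0 \<le> s" "s \<le> t" "t \<le> T"
  shows "costate_branch l0 S s = costate_branch l0 S t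
    + integral {s..t} (\<lambda>s. a s * costate_branch l0 S s - l0 * d s)"
proof -
  define R where "R t = l0 * (Q t + \<kappa> * Phi T) - S" for t
  have iT: "integrable (lebesgue_on {0..T}) (\<lambda>s. - a s * Theta s)"
    using integrable_a_mult[OF Theta(1)] by simp
  have iR: "integrable (lebesgue_on {0..T}) (\<lambda>s. - (l0 * (d s * Phi s)))" using d_Phi_int by simp
  have key: "costate_branch l0 S t = - (1 * R 0) - integral {0..t} (\<lambda>s. a s * costate_branch l0 S s - l0 * d s)"
    if t: "t \<in> {0..T}" for t
  proof -
    have "Theta t * R t = 1 * R 0 + integral {0..t} (\<lambda>s. R s * (- a s * Theta s) + Theta s * (- (l0 * (d s * Phi s))))"
    proof (rule integral_product_rule[OF iT iR _ _ t])
      fix t assume t: "t \<in> {0..T}"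
      show "Theta t = 1 + integral {0..t} (\<lambda>s. - a s * Theta s)"
        using Theta(2)[OF t] by (simp add: a_def)
      show "R t = R 0 + integral {0..t} (\<lambda>s. - (l0 * (d s * Phi s)))"
        using arg_cong[OF Q_eq[OF t], of "\<lambda>x. l0 * x"] by (simp add: R_def algebra_simps)
    qed
    also have "integral {0..t} (\<lambda>s. R s * (- a s * Theta s) + Theta s * (- (l0 * (d s * Phi s))))
        = integral {0..t} (\<lambda>s. a s * costate_branch l0 S s - l0 * d s)"
    proof (rule integral_cong)
      fix s assume "s \<in> {0..t}"
      then have "Phi s * Theta s = 1" using t by (intro Phi_Theta) auto
      then have "l0 * d s = l0 * d s * (Phi s * Theta s)" by simp
      then show "R s * (- a s * Theta s) + Theta s * (- (l0 * (d s * Phi s))) = a s * costate_branch l0 S s - l0 * d s"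
        by (simp add: costate_branch_def R_def algebra_simps)
    qed
    finally show ?thesis by (simp add: costate_branch_def R_def)
  qed
  show ?thesis
    using key[of s] key[of t] integral_Icc_diff[OF costate_branch_rhs_int assms, of l0 S] assms by simp
qed

lemma fundamental_solutions_normalised: "t \<in> {0..T} \<Longrightarrow> Theta t * (x * Phi t) = x"
  using arg_cong[OF Phi_Theta[of t], of "\<lambda>y. x * y"] by (simp add: ac_simps)

end

text \<open>Transfers integrals between the given control and its modification on a null set.
  Measurability of \<open>h\<close> is part of the conclusion; it rests on the completeness of
  Lebesgue measure.\<close>

lemma lebesgue_on_spike:
  fixes g h :: "real \<Rightarrow> real"
  assumes g: "integrable (lebesgue_on {s..t}) g" and N: "negligible N"
    and eq: "\<And>r. r \<in> {s..t} \<Longrightarrow> r \<notin> N \<Longrightarrow> h r = g r"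
  shows "integrable (lebesgue_on {s..t}) h"
    and "integral\<^sup>L (lebesgue_on {s..t}) h = integral\<^sup>L (lebesgue_on {s..t}) g"
proof -
  have "g absolutely_integrable_on {s..t}"
    using g by (simp add: set_integrable_def integrable_restrict_space)
  then have "h absolutely_integrable_on {s..t}"
    by (rule absolutely_integrable_spike[OF _ N]) (use eq in auto)
  then show h: "integrable (lebesgue_on {s..t}) h"
    by (simp add: set_integrable_def integrable_restrict_space)
  have "integral {s..t} g = integral {s..t} h"
    by (rule integral_spike[OF N]) (use eq in auto)
  then show "integral\<^sup>L (lebesgue_on {s..t}) h = integral\<^sup>L (lebesgue_on {s..t}) g"
    using lebesgue_integral_eq_integral[OF g] lebesgue_integral_eq_integral[OF h] by simp
qed

lemma partition_mono:
  fixes \<tau> :: "nat \<Rightarrow> real"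
  assumes "\<forall>i<n. \<tau> i < \<tau> (Suc i)" "i \<le> j" "j \<le> n"
  shows "\<tau> i \<le> \<tau> j"
  using assms(2,3)
proof (induction j rule: dec_induct)
  case (step j)
  then show ?case using assms(1)[rule_format, of j] by simp
qed simp

context reference_pair
begin

text \<open>The partition is increasing, so the constraints still ahead at such a \<open>t\<close>
  are those with indices from \<open>i\<close> to \<open>n\<close>.\<close>

lemma costate_on_interval:
  assumes \<tau>: "\<forall>i<n. \<tau> i < \<tau> (Suc i)" and i: "i \<in> {1..n}" and t: "\<tau> (i - 1) < t" "t \<le> \<tau> i"
  shows "costate \<tau> n l t = costate_branch (l 0) (\<Sum>j\<in>{i..n}. l j * Phi (\<tau> j)) t"
proof -
  have "{j\<in>{1..n}. t \<le> \<tau> j} = {i..n}"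
  proof (intro equalityI subsetI)
    fix j assume j: "j \<in> {j\<in>{1..n}. t \<le> \<tau> j}"
    have "\<not> j \<le> i - 1"
    proof
      assume "j \<le> i - 1"
      then have "\<tau> j \<le> \<tau> (i - 1)" by (rule partition_mono[OF \<tau>]) (use i in auto)
      then show False using j t by auto
    qed
    then show "j \<in> {i..n}" using j by auto
  next
    fix j assume "j \<in> {i..n}"
    then show "j \<in> {j\<in>{1..n}. t \<le> \<tau> j}" using partition_mono[OF \<tau>, of i j] i t by auto
  qed
  then show ?thesis by (simp add: costate_def costate_branch_def)
qed

text \<open>Consecutive branches differ at \<open>\<tau> i\<close> by
  \<open>Theta (\<tau> i) * (l i * Phi (\<tau> i)) = l i\<close>, which is the jump
  \<open>- \<beta> i\<close>. The equation is stated for \<open>u0\<close>, which agrees with the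
  control of the locale only off \<open>N\<close>.\<close>

lemma adjoint_costate:
  assumes \<tau>: "\<tau> 0 = 0" "\<tau> n = T" "\<forall>i<n. \<tau> i < \<tau> (Suc i)"
    and N: "negligible N" and u0: "\<And>t. t \<in> {0..T} \<Longrightarrow> t \<notin> N \<Longrightarrow> u0 t = u t"
    and \<beta>: "\<beta> 0 = l 0" "\<And>i. i \<in> {1..n} \<Longrightarrow> \<beta> i = - l i"
  shows "adjoint_solution b f Psi n \<tau> \<beta> u0 X (costate \<tau> n l)"
proof -
  define S where "S i = (\<Sum>j\<in>{i..n}. l j * Phi (\<tau> j))" for i
  define P where "P i = costate_branch (l 0) (S i)" for i
  \<comment> \<open>At \<open>i = n\<close> the right limit is 0 by convention; there the branch
    \<open>P (Suc n)\<close>, whose sum is empty, supplies the terminal term.\<close>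
  define r where "r i = (if i = n then 0 else P (Suc i) (\<tau> i))" for i
  define g where "g t = partial_x b (X t) (u0 t) * costate \<tau> n l t - \<beta> 0 * partial_x f (X t) (u0 t)" for t
  have range: "\<tau> i \<in> {0..T}" if "i \<le> n" for i
    using partition_mono[OF \<tau>(3), of 0 i] partition_mono[OF \<tau>(3), of i n] that \<tau>(1,2) by auto
  have step: "\<tau> (i - 1) < \<tau> i" "0 \<le> \<tau> (i - 1)" "\<tau> i \<le> T" if i: "i \<in> {1..n}" for i
    using \<tau>(3)[rule_format, of "i - 1"] range[of i] range[of "i - 1"] i by auto
  have on: "costate \<tau> n l t = P i t" if "i \<in> {1..n}" "\<tau> (i - 1) < t" "t \<le> \<tau> i" for i t
    unfolding P_def S_def by (rule costate_on_interval[OF \<tau>(3) that])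
  have lim: "(costate \<tau> n l \<longlongrightarrow> r i) (at_right (\<tau> i))" if i: "i \<in> {1..<n}" for i
  proof -
    have s: "\<tau> i < \<tau> (Suc i)" "0 \<le> \<tau> i" "\<tau> (Suc i) \<le> T" using step[of "Suc i"] i by auto
    have "continuous_on {\<tau> i..\<tau> (Suc i)} (P (Suc i))"
      unfolding P_def by (rule continuous_on_subset[OF costate_branch_cont]) (use s in auto)
    then have "(P (Suc i) \<longlongrightarrow> P (Suc i) (\<tau> i)) (at (\<tau> i) within {\<tau> i..\<tau> (Suc i)})"
      using s by (simp add: continuous_on_def)
    then have "(P (Suc i) \<longlongrightarrow> r i) (at_right (\<tau> i))"
      using s i by (simp add: at_within_Icc_at_right r_def)
    moreover have "\<forall>\<^sub>F t in at_right (\<tau> i). P (Suc i) t = costate \<tau> n l t"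
      unfolding eventually_at_right_field
    proof (intro exI[of _ "\<tau> (Suc i)"] conjI allI impI)
      fix t assume "\<tau> i < t" "t < \<tau> (Suc i)"
      then show "P (Suc i) t = costate \<tau> n l t" by (intro on[symmetric]) (use i in auto)
    qed (rule s)
    ultimately show ?thesis by (rule Lim_transform_eventually)
  qed
  have spike: "integrable (lebesgue_on {s..\<tau> i}) g"
      "integral\<^sup>L (lebesgue_on {s..\<tau> i}) g = integral {s..\<tau> i} (\<lambda>s. a s * P i s - l 0 * d s)"
    if i: "i \<in> {1..n}" and s: "\<tau> (i - 1) \<le> s" for i s
  proof -
    have int: "integrable (lebesgue_on {s..\<tau> i}) (\<lambda>s. a s * P i s - l 0 * d s)"
      and val: "integral\<^sup>L (lebesgue_on {s..\<tau> i}) (\<lambda>s. a s * P i s - l 0 * d s)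
        = integral {s..\<tau> i} (\<lambda>s. a s * P i s - l 0 * d s)"
      unfolding P_def
      using lebesgue_integral_Icc[OF costate_branch_rhs_int, of s "\<tau> i" "l 0" "S i"] step[OF i] s by simp_all
    \<comment> \<open>The left end point joins the null set because for \<open>i > 1\<close> the
      costate takes the value of the preceding branch there.\<close>
    have N': "negligible (N \<union> {\<tau> (i - 1)})" using N by simp
    have eq: "g t = a t * P i t - l 0 * d t" if "t \<in> {s..\<tau> i}" "t \<notin> N \<union> {\<tau> (i - 1)}" for t
    proof -
      have "\<tau> (i - 1) < t" "t \<in> {0..T}" using that s step[OF i] by auto
      then show ?thesis using on[OF i, of t] u0[of t] that by (simp add: g_def a_def d_def \<beta>)
    qed
    show "integrable (lebesgue_on {s..\<tau> i}) g" by (rule lebesgue_on_spike(1)[OF int N' eq])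
    show "integral\<^sup>L (lebesgue_on {s..\<tau> i}) g = integral {s..\<tau> i} (\<lambda>s. a s * P i s - l 0 * d s)"
      using lebesgue_on_spike(2)[OF int N' eq] val by simp
  qed
  have ode: "costate \<tau> n l t = costate \<tau> n l (\<tau> i) + integral\<^sup>L (lebesgue_on {t..\<tau> i}) g"
    if i: "i \<in> {1..n}" and t: "t \<in> {\<tau> (i - 1)<..<\<tau> i}" for i t
  proof -
    have "P i t = P i (\<tau> i) + integral {t..\<tau> i} (\<lambda>s. a s * P i s - l 0 * d s)"
      unfolding P_def by (rule costate_branch_eq) (use step[OF i] t in auto)
    then show ?thesis using on[OF i, of t] on[OF i, of "\<tau> i"] spike(2)[OF i, of t] t step[OF i] by simp
  qed
  have jump: "costate \<tau> n l (\<tau> i) = - \<beta> 0 * deriv Psi (X (\<tau> n)) * (if i = n then 1 else 0) - \<beta> i + r i"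
    if i: "i \<in> {1..n}" for i
  proof -
    have c: "costate \<tau> n l (\<tau> i) = P i (\<tau> i)" using on[OF i, of "\<tau> i"] step[OF i] by simp
    have ti: "\<tau> i \<in> {0..T}" using range i by simp
    have Si: "S i = l i * Phi (\<tau> i) + S (Suc i)"
      using i by (simp add: S_def sum.atLeast_Suc_atMost)
    have "P i (\<tau> i) = P (Suc i) (\<tau> i) + Theta (\<tau> i) * (l i * Phi (\<tau> i))"
      unfolding P_def costate_branch_def Si by (simp add: algebra_simps)
    then have Pi: "P i (\<tau> i) = P (Suc i) (\<tau> i) + l i"
      by (simp only: fundamental_solutions_normalised[OF ti])
    show ?thesis
    proof (cases "i = n")
      case True
      have "P (Suc n) T = - (Theta T * ((l 0 * \<kappa>) * Phi T))"
        by (simp add: P_def costate_branch_def S_def Q_def)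
      also have "Theta T * ((l 0 * \<kappa>) * Phi T) = l 0 * \<kappa>"
        by (rule fundamental_solutions_normalised) (use T in simp)
      finally show ?thesis using c Pi True \<tau>(2) \<beta> i by (simp add: r_def DERIV_imp_deriv[OF Psi])
    next
      case False
      then show ?thesis using c Pi \<beta> i by (simp add: r_def)
    qed
  qed
  show ?thesis
    unfolding adjoint_solution_def Let_def g_def[symmetric]
  proof (intro exI[of _ r] conjI ballI)
    show "r n = 0" by (simp add: r_def)
    fix i assume i: "i \<in> {1..n}"
    show "integrable (lebesgue_on {\<tau> (i - 1)..\<tau> i}) g" by (rule spike(1)[OF i order_refl])
  qed (fact lim ode jump)+
qed

end

section \<open>Pointwise bounds from the standing assumptions\<close>

text \<open>A connected subset of the line is convex, so the segment from \<open>(0, v0)\<close> to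
  \<open>(x, v)\<close> stays in \<open>UNIV \<times> U\<close>. It is cut into steps so short that
  \<open>f\<close> changes by less than 1 on each; their number grows linearly with the length of
  the segment.\<close>

lemma uniformly_continuous_linear_growth:
  fixes f :: "real \<Rightarrow> real \<Rightarrow> real"
  assumes f: "uniformly_continuous_on (UNIV \<times> U) (\<lambda>(x, v). f x v)" and U: "connected U"
  shows "\<exists>K. \<forall>x. \<forall>v\<in>U. \<bar>f x v\<bar> \<le> K * (1 + \<bar>x\<bar> + \<bar>v\<bar>)"
proof (cases "U = {}")
  case False
  then obtain v0 where v0: "v0 \<in> U" by auto
  have convU: "convex U" using U by (simp add: is_interval_connected_1[symmetric] is_interval_convex_1)
  obtain \<delta> where \<delta>: "0 < \<delta>" and near: "\<And>x y v w. v \<in> U \<Longrightarrow> w \<in> U \<Longrightarrow> \<bar>x - y\<bar> + \<bar>v - w\<bar> < \<delta> \<Longrightarrow> \<bar>f x v - f y w\<bar> < 1"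
  proof -
    obtain \<delta> where \<delta>: "0 < \<delta>" and H: "\<forall>p\<in>UNIV \<times> U. \<forall>q\<in>UNIV \<times> U. dist q p < \<delta> \<longrightarrow>
        dist (case q of (x, v) \<Rightarrow> f x v) (case p of (x, v) \<Rightarrow> f x v) < 1"
      using f zero_less_one unfolding uniformly_continuous_on_def by blast
    have "\<bar>f x v - f y w\<bar> < 1" if "v \<in> U" "w \<in> U" "\<bar>x - y\<bar> + \<bar>v - w\<bar> < \<delta>" for x y v w
    proof -
      have "dist (x, v) (y, w) \<le> \<bar>x - y\<bar> + \<bar>v - w\<bar>"
        unfolding dist_Pair_Pair dist_real_def by (rule sqrt_sum_squares_le_sum_abs[THEN order_trans]) simp
      then show ?thesis using H[rule_format, of "(y, w)" "(x, v)"] that by (simp add: dist_real_def)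
    qed
    then show ?thesis using that \<delta> by blast
  qed
  have "\<bar>f x v\<bar> \<le> (\<bar>f 0 v0\<bar> + 1 + (1 + \<bar>v0\<bar>) / \<delta>) * (1 + \<bar>x\<bar> + \<bar>v\<bar>)" if v: "v \<in> U" for x v
  proof -
    define len where "len = \<bar>x\<bar> + \<bar>v - v0\<bar>"
    \<comment> \<open>One more than the floor makes the steps shorter than \<open>\<delta>\<close>,
      with at most \<open>len / \<delta> + 1\<close> of them.\<close>
    define n where "n = Suc (nat \<lfloor>len / \<delta>\<rfloor>)"
    have len: "0 \<le> len" by (simp add: len_def)
    have n0: "0 < real n" by (simp add: n_def)
    have n1: "len / \<delta> < real n" and n2: "real n \<le> len / \<delta> + 1"
      using len \<delta> by (simp_all add: n_def) linarith+
    define s where "s k = real k / real n" for k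
    define y where "y k = s k * x" for k
    define w where "w k = (1 - s k) * v0 + s k * v" for k
    have wU: "w k \<in> U" if "k \<le> n" for k
    proof -
      have "0 \<le> s k" "s k \<le> 1" using that n0 by (auto simp: s_def)
      then show ?thesis using convexD_alt[OF convU v0 v, of "s k"] by (simp add: w_def)
    qed
    have small: "\<bar>f (y (Suc k)) (w (Suc k)) - f (y k) (w k)\<bar> \<le> 1" if k: "k < n" for k
    proof -
      have ds: "s (Suc k) - s k = 1 / real n" by (simp add: s_def add_divide_distrib)
      have "y (Suc k) - y k = (s (Suc k) - s k) * x" "w (Suc k) - w k = (s (Suc k) - s k) * (v - v0)"
        by (simp_all add: y_def w_def algebra_simps)
      then have "\<bar>y (Suc k) - y k\<bar> + \<bar>w (Suc k) - w k\<bar> = len / real n"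
        unfolding ds len_def by (simp add: abs_mult add_divide_distrib)
      also have "\<dots> < \<delta>" using n1 n0 \<delta> by (simp add: field_simps)
      finally show ?thesis using near[OF wU wU, of "Suc k" k "y (Suc k)" "y k"] k by simp
    qed
    have "f x v - f 0 v0 = (\<Sum>k<n. f (y (Suc k)) (w (Suc k)) - f (y k) (w k))"
      unfolding sum_lessThan_telescope[of "\<lambda>k. f (y k) (w k)"] using n0 by (simp add: y_def w_def s_def)
    also have "\<bar>\<dots>\<bar> \<le> (\<Sum>k<n. 1)"
      by (rule order_trans[OF sum_abs sum_mono]) (use small in simp)
    finally have "\<bar>f x v - f 0 v0\<bar> \<le> real n" by simp
    then have "\<bar>f x v\<bar> \<le> \<bar>f 0 v0\<bar> + 1 + len / \<delta>" using n2 by linarith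
    also have "len / \<delta> \<le> (1 + \<bar>v0\<bar>) / \<delta> * (1 + \<bar>x\<bar> + \<bar>v\<bar>)"
    proof -
      have "len \<le> \<bar>x\<bar> + \<bar>v\<bar> + \<bar>v0\<bar>" by (simp add: len_def)
      also have "\<dots> \<le> (1 + \<bar>v0\<bar>) * (1 + \<bar>x\<bar> + \<bar>v\<bar>)" by (simp add: algebra_simps)
      finally show ?thesis using \<delta> by (simp add: divide_right_mono)
    qed
    also have "\<bar>f 0 v0\<bar> + 1 \<le> (\<bar>f 0 v0\<bar> + 1) * (1 + \<bar>x\<bar> + \<bar>v\<bar>)" by (simp add: algebra_simps)
    finally show ?thesis by (simp add: algebra_simps)
  qed
  then show ?thesis by blast
qed simp

text \<open>Constant functions with value in \<open>U\<close> belong to \<open>controls\<close>, and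
  for them the integral bound reads \<open>\<bar>b 0 v\<bar>^2 * T \<le> c\<close>.\<close>

lemma square_bounded_drift_bound:
  assumes A2: "square_bounded_drift T U b" and T: "0 < T"
  shows "\<exists>M. \<forall>v\<in>U. \<bar>b 0 v\<bar> \<le> M"
proof -
  obtain c where c: "0 < c"
    and sup: "(SUP u\<in>controls T U. \<integral>\<^sup>+t. ennreal (\<bar>b 0 (u t)\<bar>\<^sup>2) \<partial>lebesgue_on {0..T}) \<le> ennreal c"
    using A2 by (auto simp: square_bounded_drift_def)
  have "\<bar>b 0 v\<bar> \<le> sqrt (c / T)" if v: "v \<in> U" for v
  proof -
    have "(\<lambda>_. v) \<in> controls T U"
      using v integrable_continuous_Icc[of T "\<lambda>_. v\<^sup>2"] by (simp add: controls_def)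
    then have "(\<integral>\<^sup>+t. ennreal (\<bar>b 0 v\<bar>\<^sup>2) \<partial>lebesgue_on {0..T}) \<le> ennreal c"
      by (rule order_trans[OF SUP_upper2[OF _ order_refl] sup])
    moreover have "(\<integral>\<^sup>+t. ennreal (\<bar>b 0 v\<bar>\<^sup>2) \<partial>lebesgue_on {0..T}) = ennreal (\<bar>b 0 v\<bar>\<^sup>2 * T)"
      using T by (simp add: emeasure_restrict_space ennreal_mult')
    ultimately have "\<bar>b 0 v\<bar>\<^sup>2 * T \<le> c" using c by simp
    then have "\<bar>b 0 v\<bar>\<^sup>2 \<le> c / T" using T by (simp add: pos_le_divide_eq)
    then show ?thesis by (rule real_le_rsqrt)
  qed
  then show ?thesis by blast
qed

section \<open>The maximum principle\<close>

context control_system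
begin

lemma linear_solution_exists:
  assumes a: "a \<in> borel_measurable (lebesgue_on {0..T})" and le: "\<And>t. t \<in> {0..T} \<Longrightarrow> \<bar>a t\<bar> \<le> c"
  shows "\<exists>Y. continuous_on {0..T} Y \<and> (\<forall>t\<in>{0..T}. Y t = 1 + integral {0..t} (\<lambda>s. a s * Y s))"
proof (rule caratheodory_solution_exists[of c T "\<lambda>s x. a s * x" 1])
  show "integrable (lebesgue_on {0..T}) (\<lambda>s. a s * Y s)" if "continuous_on {0..T} Y" for Y
    by (rule integrable_bounded_mult[OF integrable_continuous_Icc[OF that] a le])
  fix s x y assume s: "s \<in> {0..T}"
  have "\<bar>a s * x - a s * y\<bar> = \<bar>a s\<bar> * \<bar>x - y\<bar>" by (simp add: abs_mult flip: right_diff_distrib)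
  also have "\<dots> \<le> c * \<bar>x - y\<bar>" by (intro mult_right_mono le s) simp
  finally show "\<bar>a s * x - a s * y\<bar> \<le> c * \<bar>x - y\<bar>" .
next
  fix Y :: "real \<Rightarrow> real" assume "continuous_on {0..T} Y" "\<And>t. t \<in> {0..T} \<Longrightarrow> Y t = 1 + integral {0..t} (\<lambda>s. a s * Y s)"
  then show ?thesis by blast
qed (rule c)

lemma admissible_control: "v \<in> admissible T U \<Longrightarrow> v \<in> controls T U"
  using admissibleD[of v] by (auto simp: controls_def intro!: AE_I2)

lemma admissible_trajectory:
  assumes v: "v \<in> admissible T U" and Y: "state_solution T x0 b v Y"
  shows "trajectory T x0 b v Y"
proof -
  have cY: "continuous_on {0..T} Y" using Y by (simp add: state_solution_def)
  have int: "integrable (lebesgue_on {0..T}) (\<lambda>s. b (Y s) (v s))" by (rule integrable_b_along[OF v cY])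
  have "Y t = x0 + integral\<^sup>L (lebesgue_on {0..t}) (\<lambda>s. b (Y s) (v s))" if t: "t \<in> {0..T}" for t
  proof -
    have "Y t = x0 + integral {0..t} (\<lambda>s. b (Y s) (v s))" using Y t by (simp add: state_solution_def)
    then show ?thesis using lebesgue_integral_Icc(2)[OF int, of 0 t] t by simp
  qed
  then show ?thesis using int unfolding trajectory_def by blast
qed

lemma cost_eq_total_cost:
  assumes "v \<in> admissible T U" "state_solution T x0 b v Y"
  shows "cost T f \<Psi> v Y = total_cost T f \<Psi> v Y"
  using lebesgue_integral_Icc(2)[OF integrable_f_along[OF assms(1), of Y], of 0 T] assms(2)
  by (simp add: cost_def total_cost_def state_solution_def)

end

theorem theoremA3:
  fixes T x0 :: real
    and U :: "real set"
    and b f :: "real \<Rightarrow> real \<Rightarrow> real"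
    and \<Psi> :: "real \<Rightarrow> real"
    and n :: nat
    and \<tau> :: "nat \<Rightarrow> real"
    and u X :: "real \<Rightarrow> real"
  assumes T_pos: "T > 0"
    and U_connected: "connected U"
    and b_uc: "uniformly_continuous_on (UNIV \<times> U) (\<lambda>(x, v). b x v)"
    and f_uc: "uniformly_continuous_on (UNIV \<times> U) (\<lambda>(x, v). f x v)"
    and Psi_uc: "uniformly_continuous_on UNIV \<Psi>"
    and A1: "lipschitz_in_x U b"
    and A2: "square_bounded_drift T U b"
    and A3_b: "C1_in_x U b"
    and A3_f: "C1_in_x U f"
    and A3_Psi: "\<forall>x. \<Psi> differentiable (at x)" "continuous_on UNIV (deriv \<Psi>)"
    and partition: "\<tau> 0 = 0" "\<tau> n = T" "\<forall>i<n. \<tau> i < \<tau> (Suc i)"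
    and optimal: "optimal_pair T x0 U b f \<Psi> n \<tau> u X"
    and dominated: "dominated_partial_x T f u X"
  shows "\<exists>(\<beta> :: nat \<Rightarrow> real) p.
      \<beta> 0 \<ge> 0 \<and>
      \<bar>\<beta> 0\<bar>\<^sup>2 + (\<Sum>j=1..n. \<bar>\<beta> j\<bar>\<^sup>2) = 1 \<and>
      (\<forall>j\<in>{1..n}. \<forall>\<gamma>\<le>0. \<beta> j * (\<gamma> - X (\<tau> j)) \<ge> 0) \<and>
      adjoint_solution b f \<Psi> n \<tau> \<beta> u X p \<and>
      (\<forall>v\<in>U. \<forall>i<n. AE t in lebesgue_on {\<tau> i<..<\<tau> (Suc i)}.
         Hamiltonian b f (\<beta> 0) (X t) (u t) (p t) \<ge> Hamiltonian b f (\<beta> 0) (X t) v (p t))"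
proof -
  have n0: "0 < n" using partition(1,2) T_pos by (cases n) auto
  have range: "\<tau> i \<in> {0..T}" if "i \<le> n" for i
    using partition_mono[OF partition(3), of 0 i] partition_mono[OF partition(3), of i n] that partition(1,2) by auto
  have u: "u \<in> controls T U" and traj: "trajectory T x0 b u X" and feas: "\<And>i. i \<le> n \<Longrightarrow> 0 \<le> X (\<tau> i)"
    and opt: "\<And>v Y. feasible_pair T x0 U b n \<tau> v Y \<Longrightarrow> cost T f \<Psi> u X \<le> cost T f \<Psi> v Y"
    using optimal unfolding optimal_pair_def feasible_pair_def by blast+
  obtain c where c: "0 < c" and lip: "\<And>x y v. v \<in> U \<Longrightarrow> \<bar>b x v - b y v\<bar> \<le> c * \<bar>x - y\<bar>"
    using A1 unfolding lipschitz_in_x_def by blast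
  obtain M where M: "\<And>v. v \<in> U \<Longrightarrow> \<bar>b 0 v\<bar> \<le> M" using square_bounded_drift_bound[OF A2 T_pos] by blast
  obtain K where K: "\<And>x v. v \<in> U \<Longrightarrow> \<bar>f x v\<bar> \<le> K * (1 + \<bar>x\<bar> + \<bar>v\<bar>)"
    using uniformly_continuous_linear_growth[OF f_uc U_connected] by blast
  have b_der: "((\<lambda>y. b y v) has_real_derivative partial_x b x v) (at x)" if "v \<in> U" for x v
    using A3_b that unfolding C1_in_x_def partial_x_def by (simp add: DERIV_deriv_iff_real_differentiable)
  have f_der: "((\<lambda>y. f y v) has_real_derivative partial_x f x v) (at x)" if "v \<in> U" for x v
    using A3_f that unfolding C1_in_x_def partial_x_def by (simp add: DERIV_deriv_iff_real_differentiable)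
  have bx: "continuous_on (UNIV \<times> U) (\<lambda>(x, v). partial_x b x v)"
    and fx: "continuous_on (UNIV \<times> U) (\<lambda>(x, v). partial_x f x v)"
    using A3_b A3_f unfolding C1_in_x_def by blast+
  interpret control_system T x0 c M K U b f
    by unfold_locales (fact T_pos c uniformly_continuous_imp_continuous[OF b_uc] lip M b_der bx f_uc K f_der fx)+
  have int_b: "integrable (lebesgue_on {0..T}) (\<lambda>s. b (X s) (u s))"
    using traj unfolding trajectory_def by blast
  have X_eq: "X t = x0 + integral {0..t} (\<lambda>s. b (X s) (u s))" if t: "t \<in> {0..T}" for t
  proof -
    have "X t = x0 + integral\<^sup>L (lebesgue_on {0..t}) (\<lambda>s. b (X s) (u s))"
      using traj t unfolding trajectory_def by blast
    then show ?thesis using lebesgue_integral_Icc(2)[OF int_b, of 0 t] t by simp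
  qed
  have X_cont: "continuous_on {0..T} X"
    by (rule continuous_on_eq[OF continuous_on_indefinite_integral[OF int_b] X_eq[symmetric]])

  text \<open>
    Off a null set the control takes values in \<open>U\<close> and the domination holds. Redefining the
    control there as a constant makes both hold everywhere.
  \<close>
  obtain \<delta> k where \<delta>: "0 < \<delta>" and k: "integrable (lebesgue_on {0..T}) k"
    and dom: "AE t in lebesgue_on {0..T}. \<forall>x. \<bar>x - X t\<bar> \<le> \<delta> \<longrightarrow> \<bar>partial_x f x (u t)\<bar> \<le> k t"
    using dominated unfolding dominated_partial_x_def by blast
  have uU: "AE t in lebesgue_on {0..T}. u t \<in> U" using u unfolding controls_def by blast
  have "AE t in lebesgue_on {0..T}. u t \<in> U \<and> (\<forall>x. \<bar>x - X t\<bar> \<le> \<delta> \<longrightarrow> \<bar>partial_x f x (u t)\<bar> \<le> k t)"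
    using uU dom by eventually_elim blast
  then obtain N where N_sub: "{t \<in> space (lebesgue_on {0..T}). \<not> (u t \<in> U \<and>
        (\<forall>x. \<bar>x - X t\<bar> \<le> \<delta> \<longrightarrow> \<bar>partial_x f x (u t)\<bar> \<le> k t))} \<subseteq> N"
    and N0: "emeasure (lebesgue_on {0..T}) N = 0" and N_sets: "N \<in> sets (lebesgue_on {0..T})"
    by (rule AE_E)
  have NL: "N \<in> sets lebesgue" "N \<subseteq> {0..T}" using N_sets by (auto simp: sets_restrict_space_iff)
  have "emeasure lebesgue N = 0" using N0 NL by (simp add: emeasure_restrict_space)
  then have N: "negligible N" using NL(1) by (simp add: negligible_iff_null_sets null_sets_def)
  have good: "u t \<in> U" "\<And>x. \<bar>x - X t\<bar> \<le> \<delta> \<Longrightarrow> \<bar>partial_x f x (u t)\<bar> \<le> k t"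
    if "t \<in> {0..T}" "t \<notin> N" for t
    using N_sub that by auto
  \<comment> \<open>The exceptional set is not all of [0,T], so some value of \<open>u\<close> lies
    in \<open>U\<close>; such a value becomes the default \<open>v0\<close> on
    \<open>N\<close>.\<close>
  have "\<not> {0..T} \<subseteq> N"
  proof
    assume "{0..T} \<subseteq> N"
    then have "negligible (cbox 0 T)" using negligible_subset[OF N] by simp
    then show False using negligible_interval(1)[of 0 T] T_pos by simp
  qed
  then obtain t0 where "t0 \<in> {0..T}" "t0 \<notin> N" by blast
  from good(1)[OF this] obtain v0 where v0: "v0 \<in> U" ..
  define ut where "ut t = (if t \<in> N then v0 else u t)" for t
  have ut_eq: "ut t = u t" if "t \<notin> N" for t using that by (simp add: ut_def)
  have ut: "ut \<in> admissible T U"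
  proof -
    have "(\<lambda>t. if t \<in> N then v0 else u t) \<in> borel_measurable (lebesgue_on {0..T})"
      using u N_sets unfolding controls_def
      by (intro measurable_If_set) (auto simp: sets.Int_space_eq2)
    then have m: "ut \<in> borel_measurable (lebesgue_on {0..T})" by (simp add: ut_def[abs_def])
    have "integrable (lebesgue_on {0..T}) (\<lambda>t. (ut t)\<^sup>2)"
    proof (rule integrable_dominated)
      show "integrable (lebesgue_on {0..T}) (\<lambda>t. v0\<^sup>2 + (u t)\<^sup>2)"
        using u integrable_continuous_Icc[of T "\<lambda>_. v0\<^sup>2"] unfolding controls_def by simp
    qed (auto simp: ut_def intro: borel_measurable_power[OF m, unfolded ut_def])
    moreover have "ut t \<in> U" if "t \<in> {0..T}" for t
      using good(1)[OF that] v0 by (cases "t \<in> N") (simp_all add: ut_def)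
    ultimately show ?thesis using m unfolding admissible_def by blast
  qed
  have ut_sol: "state_solution T x0 b ut X"
    unfolding state_solution_def
  proof (intro conjI ballI X_cont)
    fix t assume t: "t \<in> {0..T}"
    have "integral {0..t} (\<lambda>s. b (X s) (u s)) = integral {0..t} (\<lambda>s. b (X s) (ut s))"
      by (rule integral_spike[OF N]) (simp add: ut_eq)
    then show "X t = x0 + integral {0..t} (\<lambda>s. b (X s) (ut s))" using X_eq[OF t] by simp
  qed
  have cost_u: "cost T f \<Psi> u X = total_cost T f \<Psi> ut X"
  proof -
    have "integral\<^sup>L (lebesgue_on {0..T}) (\<lambda>t. f (X t) (u t)) = integral\<^sup>L (lebesgue_on {0..T}) (\<lambda>t. f (X t) (ut t))"
      by (rule lebesgue_on_spike(2)[OF integrable_f_along[OF ut X_cont] N]) (simp add: ut_eq)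
    then show ?thesis using cost_eq_total_cost[OF ut ut_sol, of \<Psi>] by (simp add: cost_def)
  qed
  \<comment> \<open>On \<open>N\<close> the control is now \<open>v0\<close>. As \<open>X\<close> is
    bounded, f_x at \<open>v0\<close> is bounded by some \<open>K0\<close> on all states within
    \<open>\<delta>\<close> of the trajectory; adding \<open>K0\<close> to
    \<open>\<bar>k\<bar>\<close> gives a domination at every time.\<close>
  obtain B where B: "\<And>t. t \<in> {0..T} \<Longrightarrow> \<bar>X t\<bar> \<le> B" by (rule continuous_on_Icc_bound[OF X_cont]) blast
  have "continuous_on {- (B + \<delta>)..B + \<delta>} (\<lambda>x. partial_x f x v0)"
  proof -
    have "continuous_on {- (B + \<delta>)..B + \<delta>} (\<lambda>x. (x, v0))" by (intro continuous_intros)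
    from continuous_on_compose2[OF fx this] show ?thesis using v0 by force
  qed
  then obtain K0 where K0: "0 \<le> K0" "\<And>x. x \<in> {- (B + \<delta>)..B + \<delta>} \<Longrightarrow> \<bar>partial_x f x v0\<bar> \<le> K0"
    by (rule continuous_on_Icc_bound) blast
  define k' where "k' t = \<bar>k t\<bar> + K0" for t
  have k': "integrable (lebesgue_on {0..T}) k'"
    unfolding k'_def[abs_def]
    by (intro Bochner_Integration.integrable_add integrable_abs k integrable_continuous_Icc continuous_on_const)
  have k'_dom: "\<bar>partial_x f x (ut t)\<bar> \<le> k' t" if t: "t \<in> {0..T}" and x: "\<bar>x - X t\<bar> \<le> \<delta>" for t x
  proof (cases "t \<in> N")
    case True
    have "x \<in> {- (B + \<delta>)..B + \<delta>}" using B[OF t] x by auto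
    then show ?thesis using K0(2)[of x] True by (simp add: ut_def k'_def)
  next
    case False
    then show ?thesis using good(2)[OF t False x] K0(1) by (simp add: ut_def k'_def)
  qed
  have am: "(\<lambda>t. partial_x b (X t) (ut t)) \<in> borel_measurable (lebesgue_on {0..T})"
    by (rule measurable_along(3)[OF ut X_cont])
  have ale: "\<bar>partial_x b (X t) (ut t)\<bar> \<le> c" if "t \<in> {0..T}" for t
    by (rule derivative_le_lipschitz[OF b_der zero_less_one lip]) (use admissibleD(2)[OF ut that] in auto)
  obtain Phi where Phi: "continuous_on {0..T} Phi"
    "\<And>t. t \<in> {0..T} \<Longrightarrow> Phi t = 1 + integral {0..t} (\<lambda>s. partial_x b (X s) (ut s) * Phi s)"
    using linear_solution_exists[OF am ale] by blast
  obtain Theta where Theta: "continuous_on {0..T} Theta"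
    "\<And>t. t \<in> {0..T} \<Longrightarrow> Theta t = 1 + integral {0..t} (\<lambda>s. - partial_x b (X s) (ut s) * Theta s)"
    using linear_solution_exists[of "\<lambda>t. - partial_x b (X t) (ut t)"] am ale by auto
  have Psi': "(\<Psi> has_real_derivative deriv \<Psi> (X T)) (at (X T))"
    using A3_Psi(1) by (simp add: DERIV_deriv_iff_real_differentiable)
  interpret reference_pair T x0 c M K U b f ut X k' Phi Theta \<Psi> \<delta> "deriv \<Psi> (X T)"
    by unfold_locales (fact ut ut_sol \<delta> k' k'_dom Phi Theta Psi')+
  \<comment> \<open>The modification changes neither the trajectory nor the cost, and admissible
    controls are controls, so optimality is inherited.\<close>
  have opt': "total_cost T f \<Psi> ut X \<le> total_cost T f \<Psi> v Y"
    if "v \<in> admissible T U" "state_solution T x0 b v Y" "\<forall>i\<le>n. 0 \<le> Y (\<tau> i)" for v Y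
  proof -
    have "feasible_pair T x0 U b n \<tau> v Y"
      unfolding feasible_pair_def using that admissible_control admissible_trajectory by blast
    then show ?thesis using opt[of v Y] cost_u cost_eq_total_cost[OF that(1,2), of \<Psi>] by simp
  qed
  obtain l where l: "\<And>i. 0 \<le> l i" "(\<Sum>i\<le>n. (l i)\<^sup>2) = 1"
    "\<And>w. w \<in> admissible T U \<Longrightarrow> (\<Sum>i\<le>n. l i * integral {0..T} (needle \<tau> i w)) \<le> 0"
    by (rule multipliers_exist[OF partition(1,2) n0 range feas opt']) blast+
  \<comment> \<open>The alternative yields nonnegative multipliers, whereas the sign condition asks
    for nonpositive ones at the constraints.\<close>
  define \<beta> where "\<beta> i = (if i = 0 then l 0 else - l i)" for i :: nat
  show ?thesis
  proof (intro exI[of _ \<beta>] exI[of _ "costate \<tau> n l"] conjI ballI allI impI)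
    show "\<beta> 0 \<ge> 0" using l(1) by (simp add: \<beta>_def)
    have "(\<Sum>i\<le>n. (l i)\<^sup>2) = (l 0)\<^sup>2 + (\<Sum>i=1..n. (l i)\<^sup>2)"
      by (simp add: atMost_atLeast0 sum.atLeast_Suc_atMost)
    also have "(\<Sum>i=1..n. (l i)\<^sup>2) = (\<Sum>i=1..n. \<bar>\<beta> i\<bar>\<^sup>2)"
      by (rule sum.cong) (auto simp: \<beta>_def)
    finally show "\<bar>\<beta> 0\<bar>\<^sup>2 + (\<Sum>j=1..n. \<bar>\<beta> j\<bar>\<^sup>2) = 1" using l(2) by (simp add: \<beta>_def)
  next
    fix j \<gamma> assume "j \<in> {1..n}" "\<gamma> \<le> (0::real)"
    then show "\<beta> j * (\<gamma> - X (\<tau> j)) \<ge> 0"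
      using l(1)[of j] feas[of j] by (auto simp: \<beta>_def intro: mult_nonneg_nonpos)
  next
    show "adjoint_solution b f \<Psi> n \<tau> \<beta> u X (costate \<tau> n l)"
      by (rule adjoint_costate[OF partition N]) (auto simp: ut_eq \<beta>_def)
  next
    fix v i assume v: "v \<in> U" and i: "i < n"
    have sub: "{\<tau> i<..<\<tau> (Suc i)} \<subseteq> {0..T}" using range[of i] range[of "Suc i"] i by auto
    have "AE t in lebesgue. t \<in> {0..T} \<longrightarrow> costate \<tau> n l t * \<eta> (\<lambda>_. v) t - l 0 * \<zeta> (\<lambda>_. v) t \<le> 0"
      using pointwise_maximum[OF l(3) v] by (simp add: AE_restrict_space_iff)
    \<comment> \<open>Two null sets are removed: one from the localisation, depending on
      \<open>v\<close>, and \<open>N\<close>, off which \<open>ut\<close> is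
      \<open>u\<close>.\<close>
    moreover have "AE t in lebesgue. t \<notin> N"
      using N by (auto simp: negligible_iff_null_sets intro: AE_not_in)
    ultimately have "AE t in lebesgue. t \<in> {\<tau> i<..<\<tau> (Suc i)} \<longrightarrow>
      Hamiltonian b f (\<beta> 0) (X t) v (costate \<tau> n l t) \<le> Hamiltonian b f (\<beta> 0) (X t) (u t) (costate \<tau> n l t)"
    proof eventually_elim
      case (elim t)
      show ?case
      proof
        assume "t \<in> {\<tau> i<..<\<tau> (Suc i)}"
        then have "t \<in> {0..T}" using sub by blast
        then have "costate \<tau> n l t * \<eta> (\<lambda>_. v) t - l 0 * \<zeta> (\<lambda>_. v) t \<le> 0" using elim(1) by blast
        then show "Hamiltonian b f (\<beta> 0) (X t) v (costate \<tau> n l t) \<le> Hamiltonian b f (\<beta> 0) (X t) (u t) (costate \<tau> n l t)"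
          using elim(2) by (simp add: Hamiltonian_def \<eta>_def \<zeta>_def ut_eq \<beta>_def algebra_simps)
      qed
    qed
    then show "AE t in lebesgue_on {\<tau> i<..<\<tau> (Suc i)}.
         Hamiltonian b f (\<beta> 0) (X t) v (costate \<tau> n l t) \<le> Hamiltonian b f (\<beta> 0) (X t) (u t) (costate \<tau> n l t)"
      by (simp add: AE_restrict_space_iff)
  qed
qed

end
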